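(* There exist rational Cayley cycles in $X$ representing the Hodge classes $$M=\mathbb{D}\,(dz_1\wedge d\bar z_2\wedge dz_3\wedge d\bar z_4+d\bar z_1\wedge dz_2\wedge d\bar z_3\wedge dz_4)\quad\text{and}\quad M'=i\,(dz_1\wedge d\bar z_2\wedge dz_3\wedge d\bar z_4-d\bar z_1\wedge dz_2\wedge d\bar z_3\wedge dz_4).$$
   Context: Setting. Let $P(x)=p_4x^4+p_2x^2+p_1x+p_0\in\mathbb{Q}[x]$ be irreducible with four real roots $x_1>x_2>x_3>x_4$, such that the splitting field $\mathbb{Q}(x_1,\dots,x_4)\subset\mathbb{R}$ has Galois group $S_4$. Put $\mathbb{D}=\prod_{i<j}(x_i-x_j)>0$, $\Delta=\mathbb{D}^2\in\mathbb{Q}$; it is assumed (after scaling the roots if necessary) that $\Delta$ is an integer. Let $F=\mathbb{Q}(x_1,i\mathbb{D})$, a field of degree 8. Its embeddings in $\mathbb{C}$ are $\varphi_j,\varphi_{\bar j}$ ($j=1,2,3,4$), where $\varphi_j(x_1)=x_j$, $\varphi_j(i\mathbb{D})=(-1)^{j+1}i\mathbb{D}$, and $\varphi_{\bar j}$ is the complex conjugate of $\varphi_j$. Let $V=\mathbb{R}\otimes_{\mathbb{Q}}F$, let $\Lambda=\mathfrak{o}_F\subset V$ be the lattice given by the ring of integers, and let $z_j:V\to\mathbb{C}$ be the $\mathbb{R}$-linear extension of $\varphi_j$; $(z_1,z_2,z_3,z_4):V\to\mathbb{C}^4$ is an isomorphism of real vector spaces and makes $X=V/\Lambda$ a complex torus.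 Cohomology of $X$ is identified with translation-invariant forms. Let $\mu_j=\prod_{k\ne j}(x_j-x_k)$ and let $\omega=\frac{i\mathbb{D}}{\Delta}(\mu_1dz_1\wedge d\bar z_1-\mu_2dz_2\wedge d\bar z_2+\mu_3dz_3\wedge d\bar z_3-\mu_4dz_4\wedge d\bar z_4)$, a (flat) K\"ahler form, and $\theta=\frac1{\mathbb{D}}dz_1\wedge dz_2\wedge dz_3\wedge dz_4$, so that $\omega^4/4!=\theta\wedge\bar\theta$. $X$ carries the Riemannian metric of $\omega$. The Cayley calibration is the closed 4-form $\Omega=\frac{\omega^2}{2}+4\,\mathrm{Re}(\theta)$. A Cayley submanifold is an oriented 4-dimensional submanifold on which $\Omega$ restricts to the Riemannian volume form; images of such submanifolds under isogenies of $X$ compatible with the calibration (possibly with self-intersections, i.e. compact oriented 4-manifolds $N$ with an immersion $f:N\to X$ with $f^*\Omega$ the induced volume form) are also allowed. A rational Cayley cycle is a finite linear combination, with rational coefficients of arbitrary sign, of compact such Cayley submanifolds. A cycle represents a class $\eta\in H^4(X,\mathbb{Q})$ if its homology class is Poincar\'e dual to $\eta$. *)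

theory Defs
  imports
    "HOL-Analysis.Analysis"
    "HOL-Algebra.Algebraic_Closure_Type"
    "HOL-Algebra.Generated_Fields"
    "HOL-Algebra.Sym_Groups"
begin

section \<open>The number fields\<close>

text \<open>The field generated over the rationals: the generated subfield of a field of
  characteristic 0 automatically contains the prime field.\<close>

definition rat_adjoin :: "'a::field_char_0 set \<Rightarrow> 'a set" where
  "rat_adjoin S = generate_field (ring_of_type_algebra :: 'a ring) S"

definition field_on :: "'a::field_char_0 set \<Rightarrow> 'a ring" where
  "field_on K = (ring_of_type_algebra :: 'a ring)\<lparr>carrier := K\<rparr>"

text \<open>Every ring automorphism of a field of characteristic 0 fixes the rationals, so the
  Galois group over the rationals consists of all automorphisms.  Automorphisms are taken to be
  \<open>extensional\<close>, so that they are determined by their values on \<open>K\<close>.\<close>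

definition galois_group :: "'a::field_char_0 set \<Rightarrow> ('a \<Rightarrow> 'a) monoid" where
  "galois_group K =
    \<lparr>carrier = ring_iso (field_on K) (field_on K) \<inter> extensional K,
     monoid.mult = compose K, one = restrict id K\<rparr>"

text \<open>The roots are indexed by the numeral type \<open>4\<close>, whose elements are
  \<open>1, 2, 3\<close> and \<open>4 = 0\<close>.\<close>

definition disc_root :: "(4 \<Rightarrow> real) \<Rightarrow> real" where
  "disc_root x = (x 1 - x 2) * (x 1 - x 3) * (x 1 - x 4) * (x 2 - x 3) * (x 2 - x 4) * (x 3 - x 4)"

definition discrim :: "(4 \<Rightarrow> real) \<Rightarrow> real" where
  "discrim x = (disc_root x)\<^sup>2"

text \<open>\<open>eps j\<close> is \<open>(-1) ^ (j + 1)\<close>.\<close>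

definition eps :: "4 \<Rightarrow> real" where
  "eps j = (if j = 1 \<or> j = 3 then 1 else - 1)"

definition mu :: "(4 \<Rightarrow> real) \<Rightarrow> 4 \<Rightarrow> real" where
  "mu x j = (\<Prod>k\<in>UNIV - {j}. x j - x k)"

definition field_F :: "(4 \<Rightarrow> real) \<Rightarrow> complex set" where
  "field_F x = rat_adjoin {complex_of_real (x 1), \<i> * complex_of_real (disc_root x)}"

text \<open>The values on \<open>field_F x\<close> of the embedding chosen here are determined by its values on
  the two generators; elsewhere they are irrelevant.\<close>

definition embed :: "(4 \<Rightarrow> real) \<Rightarrow> 4 \<Rightarrow> complex \<Rightarrow> complex" where
  "embed x j = (SOME h. h \<in> ring_hom (field_on (field_F x)) (ring_of_type_algebra :: complex ring)
     \<and> h (complex_of_real (x 1)) = complex_of_real (x j)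
     \<and> h (\<i> * complex_of_real (disc_root x))
         = complex_of_real (eps j) * (\<i> * complex_of_real (disc_root x)))"

definition ring_of_integers :: "complex set \<Rightarrow> complex set" where
  "ring_of_integers K = {a \<in> K. algebraic_int a}"

section \<open>The torus\<close>

text \<open>The real vector space \<open>\<real> \<otimes> F\<close> is identified with \<open>complex ^ 4\<close> by means of the
  coordinates \<open>z\<^sub>1, \<dots>, z\<^sub>4\<close>; an element \<open>a\<close> of \<open>F\<close> then has the coordinates
  \<open>embed x j a\<close>.\<close>

definition period_lattice :: "(4 \<Rightarrow> real) \<Rightarrow> (complex ^ 4) set" where
  "period_lattice x = (\<lambda>a. \<chi> j. embed x j a) ` ring_of_integers (field_F x)"

text \<open>The points of \<open>X\<close> are the cosets of the lattice.\<close>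

definition torus_proj :: "(complex ^ 4) set \<Rightarrow> complex ^ 4 \<Rightarrow> (complex ^ 4) set" where
  "torus_proj L v = (+) v ` L"

section \<open>Translation-invariant forms\<close>

text \<open>A \<open>k\<close>-form is a complex-valued function of a sequence of vectors that depends only on the
  vectors with indices \<open>0, \<dots>, k - 1\<close>.\<close>

type_synonym form = "(nat \<Rightarrow> complex ^ 4) \<Rightarrow> complex"

definition alt_form :: "nat \<Rightarrow> form \<Rightarrow> bool" where
  "alt_form k b \<longleftrightarrow>
     (\<forall>u v. (\<forall>i<k. u i = v i) \<longrightarrow> b u = b v)
   \<and> (\<forall>v. \<forall>i<k. linear (\<lambda>w. b (v(i := w))))
   \<and> (\<forall>v i j. i < j \<and> j < k \<and> v i = v j \<longrightarrow> b v = 0)"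

text \<open>The exterior product of a \<open>p\<close>-form and a \<open>q\<close>-form, normalised so that the
  product of 1-forms is the determinant.\<close>

definition wedge :: "nat \<Rightarrow> nat \<Rightarrow> form \<Rightarrow> form \<Rightarrow> form" where
  "wedge p q a b = (\<lambda>v. (\<Sum>\<sigma> | \<sigma> permutes {..<p + q}.
     of_int (sign \<sigma>) * a (\<lambda>i. v (\<sigma> i)) * b (\<lambda>i. v (\<sigma> (p + i)))) / (fact p * fact q))"

definition dz :: "4 \<Rightarrow> form" where
  "dz j = (\<lambda>v. v 0 $ j)"

definition dzb :: "4 \<Rightarrow> form" where
  "dzb j = (\<lambda>v. cnj (v 0 $ j))"

definition wedge4 :: "form \<Rightarrow> form \<Rightarrow> form \<Rightarrow> form \<Rightarrow> form" where
  "wedge4 a b c d = wedge 3 1 (wedge 2 1 (wedge 1 1 a b) c) d"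

definition kahler :: "(4 \<Rightarrow> real) \<Rightarrow> form" where
  "kahler x = (\<lambda>v. \<i> * complex_of_real (disc_root x) / complex_of_real (discrim x) *
     (\<Sum>j\<in>UNIV. complex_of_real (eps j * mu x j) * wedge 1 1 (dz j) (dzb j) v))"

definition theta :: "(4 \<Rightarrow> real) \<Rightarrow> form" where
  "theta x = (\<lambda>v. wedge4 (dz 1) (dz 2) (dz 3) (dz 4) v / complex_of_real (disc_root x))"

definition cayley_form :: "(4 \<Rightarrow> real) \<Rightarrow> form" where
  "cayley_form x = (\<lambda>v. wedge 2 2 (kahler x) (kahler x) v / 2 + 4 * complex_of_real (Re (theta x v)))"

text \<open>The Riemannian metric \<open>g(u, w) = \<omega>(u, J w)\<close>, where \<open>J\<close> is multiplication by \<open>\<i>\<close>.\<close>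

definition metric :: "(4 \<Rightarrow> real) \<Rightarrow> complex ^ 4 \<Rightarrow> complex ^ 4 \<Rightarrow> real" where
  "metric x u w = Re (kahler x (\<lambda>i. if i = 0 then u else (\<chi> j. \<i> * w $ j)))"

definition class_M :: "(4 \<Rightarrow> real) \<Rightarrow> form" where
  "class_M x = (\<lambda>v. complex_of_real (disc_root x) *
     (wedge4 (dz 1) (dzb 2) (dz 3) (dzb 4) v + wedge4 (dzb 1) (dz 2) (dzb 3) (dz 4) v))"

definition class_M' :: form where
  "class_M' = (\<lambda>v. \<i> *
     (wedge4 (dz 1) (dzb 2) (dz 3) (dzb 4) v - wedge4 (dzb 1) (dz 2) (dzb 3) (dz 4) v))"

text \<open>A cohomology class of degree \<open>4\<close>, given by an invariant form, is rational iff the form is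
  rational-valued on \<open>L = H\<^sub>1(X, \<int>)\<close>.\<close>

definition rational_class :: "(complex ^ 4) set \<Rightarrow> form \<Rightarrow> bool" where
  "rational_class L b \<longleftrightarrow> alt_form 4 b \<and> (\<forall>v. (\<forall>i<4. v i \<in> L) \<longrightarrow> b v \<in> \<rat>)"

definition type_2_2 :: "form \<Rightarrow> bool" where
  "type_2_2 b \<longleftrightarrow> (\<exists>c :: 4 \<Rightarrow> 4 \<Rightarrow> 4 \<Rightarrow> 4 \<Rightarrow> complex.
     b = (\<lambda>v. \<Sum>j\<in>UNIV. \<Sum>k\<in>UNIV. \<Sum>l\<in>UNIV. \<Sum>m\<in>UNIV.
            c j k l m * wedge4 (dz j) (dz k) (dzb l) (dzb m) v))"

definition hodge_class :: "(complex ^ 4) set \<Rightarrow> form \<Rightarrow> bool" where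
  "hodge_class L b \<longleftrightarrow> rational_class L b \<and> type_2_2 b"

text \<open>The integral over \<open>X\<close>, with its complex orientation, of an invariant form of degree 8: the
  volume of a fundamental domain times the value on the oriented standard basis
  \<open>e\<^sub>1, \<i> e\<^sub>1, \<dots>, e\<^sub>4, \<i> e\<^sub>4\<close>.\<close>

definition std_frame :: "nat \<Rightarrow> complex ^ 4" where
  "std_frame i = axis (of_nat (i div 2 + 1)) (if even i then 1 else \<i>)"

definition fundamental_domain :: "(complex ^ 4) set \<Rightarrow> (complex ^ 4) set \<Rightarrow> bool" where
  "fundamental_domain L A \<longleftrightarrow> A \<in> fmeasurable lborel \<and> (\<forall>v. \<exists>!l. l \<in> L \<and> v + l \<in> A)"

definition has_torus_integral :: "(complex ^ 4) set \<Rightarrow> form \<Rightarrow> complex \<Rightarrow> bool" where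
  "has_torus_integral L t s \<longleftrightarrow>
     (\<exists>A. fundamental_domain L A \<and> s = complex_of_real (measure lborel A) * t std_frame)"

section \<open>Compact oriented 4-manifolds\<close>

primrec Ck_on :: "nat \<Rightarrow> 'a::real_normed_vector set \<Rightarrow> ('a \<Rightarrow> 'b::real_normed_vector) \<Rightarrow> bool" where
  "Ck_on 0 S f = continuous_on S f"
| "Ck_on (Suc k) S f = (\<exists>f'. (\<forall>x\<in>S. (f has_derivative f' x) (at x)) \<and> (\<forall>v. Ck_on k S (\<lambda>x. f' x v)))"

definition smooth_on :: "'a::real_normed_vector set \<Rightarrow> ('a \<Rightarrow> 'b::real_normed_vector) \<Rightarrow> bool" where
  "smooth_on S f \<longleftrightarrow> open S \<and> (\<forall>k. Ck_on k S f)"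

text \<open>A chart is an open set together with a coordinate map.  The manifold carries the topology
  and the oriented smooth structure of the given (not necessarily maximal) atlas.\<close>

type_synonym 'p chart = "'p set \<times> ('p \<Rightarrow> real ^ 4)"

record 'p atlas_space =
  top_of :: "'p topology"
  charts_of :: "'p chart set"

abbreviation chart_dom :: "'p chart \<Rightarrow> 'p set" where
  "chart_dom c \<equiv> fst c"

abbreviation chart_map :: "'p chart \<Rightarrow> 'p \<Rightarrow> real ^ 4" where
  "chart_map c \<equiv> snd c"

abbreviation chart_img :: "'p chart \<Rightarrow> (real ^ 4) set" where
  "chart_img c \<equiv> chart_map c ` chart_dom c"

abbreviation chart_inv :: "'p chart \<Rightarrow> real ^ 4 \<Rightarrow> 'p" where
  "chart_inv c \<equiv> inv_into (chart_dom c) (chart_map c)"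

definition compact_oriented_manifold :: "'p atlas_space \<Rightarrow> bool" where
  "compact_oriented_manifold N \<longleftrightarrow>
     Hausdorff_space (top_of N) \<and> compact_space (top_of N)
   \<and> (\<Union>c\<in>charts_of N. chart_dom c) = topspace (top_of N)
   \<and> (\<forall>c\<in>charts_of N. openin (top_of N) (chart_dom c) \<and> open (chart_img c)
        \<and> homeomorphic_map (subtopology (top_of N) (chart_dom c)) (top_of_set (chart_img c)) (chart_map c))
   \<and> (\<forall>c\<in>charts_of N. \<forall>d\<in>charts_of N.
        smooth_on (chart_map c ` (chart_dom c \<inter> chart_dom d)) (chart_map d \<circ> chart_inv c)
      \<and> (\<forall>y \<in> chart_map c ` (chart_dom c \<inter> chart_dom d).
           det (jacobian (chart_map d \<circ> chart_inv c) (at y)) > 0))"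

section \<open>Maps to the torus\<close>

text \<open>Since \<open>V \<rightarrow> X\<close> is a local diffeomorphism, a map to \<open>X\<close> is smooth iff it is, in each chart,
  locally the projection of a smooth map \<open>g\<close> to \<open>V\<close>.  Two local lifts differ by a locally
  constant function, so the derivative of the lift does not depend on the choice.\<close>

definition local_lift ::
  "(complex ^ 4) set \<Rightarrow> 'p chart \<Rightarrow> ('p \<Rightarrow> (complex ^ 4) set) \<Rightarrow> real ^ 4 \<Rightarrow> (real ^ 4 \<Rightarrow> complex ^ 4) \<Rightarrow> bool" where
  "local_lift L c f y g \<longleftrightarrow> (\<exists>W. y \<in> W \<and> W \<subseteq> chart_img c \<and> smooth_on W g
     \<and> (\<forall>u\<in>W. f (chart_inv c u) = torus_proj L (g u)))"

definition smooth_to_torus ::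
  "(complex ^ 4) set \<Rightarrow> 'p atlas_space \<Rightarrow> ('p \<Rightarrow> (complex ^ 4) set) \<Rightarrow> bool" where
  "smooth_to_torus L N f \<longleftrightarrow> (\<forall>c\<in>charts_of N. \<forall>y\<in>chart_img c. \<exists>g. local_lift L c f y g)"

definition torus_deriv ::
  "(complex ^ 4) set \<Rightarrow> 'p chart \<Rightarrow> ('p \<Rightarrow> (complex ^ 4) set) \<Rightarrow> real ^ 4 \<Rightarrow> real ^ 4 \<Rightarrow> complex ^ 4" where
  "torus_deriv L c f y = frechet_derivative (SOME g. local_lift L c f y g) (at y)"

text \<open>The coefficient of the pullback \<open>f\<^sup>* b\<close> of an invariant 4-form with respect to the
  coordinate form \<open>dy\<^sub>1 \<and> \<dots> \<and> dy\<^sub>4\<close> of a chart.\<close>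

definition pullback_coeff ::
  "(complex ^ 4) set \<Rightarrow> 'p chart \<Rightarrow> ('p \<Rightarrow> (complex ^ 4) set) \<Rightarrow> form \<Rightarrow> real ^ 4 \<Rightarrow> complex" where
  "pullback_coeff L c f b y = b (\<lambda>i. torus_deriv L c f y (axis (of_nat (i + 1)) 1))"

text \<open>The integral of \<open>f\<^sup>* b\<close> over \<open>N\<close>, computed by cutting \<open>N\<close> into finitely many disjoint Borel
  pieces, each contained in the domain of an (oriented) chart.  By the change of variables formula
  the value does not depend on the pieces and charts chosen.\<close>

definition has_form_integral ::
  "(complex ^ 4) set \<Rightarrow> 'p atlas_space \<Rightarrow> ('p \<Rightarrow> (complex ^ 4) set) \<Rightarrow> form \<Rightarrow> complex \<Rightarrow> bool" where
  "has_form_integral L N f b s \<longleftrightarrow> (\<exists>P :: ('p chart \<times> 'p set) set.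
     finite P \<and> disjoint_family_on snd P \<and> (\<Union>p\<in>P. snd p) = topspace (top_of N)
   \<and> (\<forall>(c, B)\<in>P. c \<in> charts_of N \<and> B \<subseteq> chart_dom c \<and> chart_map c ` B \<in> sets lborel
        \<and> set_integrable lborel (chart_map c ` B) (pullback_coeff L c f b))
   \<and> s = (\<Sum>(c, B)\<in>P. set_lebesgue_integral lborel (chart_map c ` B) (pullback_coeff L c f b)))"

section \<open>Cayley cycles\<close>

text \<open>The induced volume form on an immersed oriented manifold has, in an oriented chart, the
  coefficient \<open>sqrt (det g\<^sub>i\<^sub>j)\<close>.\<close>

definition cayley_immersion ::
  "(4 \<Rightarrow> real) \<Rightarrow> 'p atlas_space \<Rightarrow> ('p \<Rightarrow> (complex ^ 4) set) \<Rightarrow> bool" where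
  "cayley_immersion x N f \<longleftrightarrow> compact_oriented_manifold N \<and> smooth_to_torus (period_lattice x) N f
   \<and> (\<forall>c\<in>charts_of N. \<forall>y\<in>chart_img c.
        inj (torus_deriv (period_lattice x) c f y)
      \<and> pullback_coeff (period_lattice x) c f (cayley_form x) y
          = complex_of_real (sqrt (det ((\<chi> i j. metric x (torus_deriv (period_lattice x) c f y (axis i 1))
                                                   (torus_deriv (period_lattice x) c f y (axis j 1))) :: real ^ 4 ^ 4))))"

text \<open>The points of the manifolds occurring in a cycle are taken from the type of the points of \<open>X\<close>.
  This includes all submanifolds of \<open>X\<close> and, since that type is at least of the cardinality of
  the continuum, every compact manifold up to diffeomorphism.\<close>

type_synonym cycle =
  "(rat \<times> (complex ^ 4) set atlas_space \<times> ((complex ^ 4) set \<Rightarrow> (complex ^ 4) set)) list"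

definition rational_cayley_cycle :: "(4 \<Rightarrow> real) \<Rightarrow> cycle \<Rightarrow> bool" where
  "rational_cayley_cycle x C \<longleftrightarrow> (\<forall>(q, N, f)\<in>set C. cayley_immersion x N f)"

text \<open>The homology class of the cycle is Poincare dual to \<open>h\<close>, i.e. integrating any closed 4-form
  \<open>b\<close> over the cycle gives the integral of \<open>h \<and> b\<close> over \<open>X\<close>.  As every cohomology
  class contains an invariant form, it suffices to test invariant \<open>b\<close>.\<close>

definition represents :: "(complex ^ 4) set \<Rightarrow> cycle \<Rightarrow> form \<Rightarrow> bool" where
  "represents L C h \<longleftrightarrow> (\<forall>b. alt_form 4 b \<longrightarrow>
     (\<exists>I. (\<forall>k<length C. case C ! k of (q, N, f) \<Rightarrow> has_form_integral L N f b (I k))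
        \<and> has_torus_integral L (wedge 4 4 h b) (\<Sum>k<length C. of_rat (fst (C ! k)) * I k)))"

end

theory Submission
  imports Defs
begin

text \<open>
  Write \<open>D\<close> for the square root of the discriminant \<open>\<Delta>\<close>, and let \<open>c = s + t \<i> D\<close> with rational integers
  \<open>s\<close> and \<open>t\<close>.  The embeddings \<open>\<phi>\<^sub>1, \<dots>, \<phi>\<^sub>4\<close> send \<open>c\<close> to \<open>c\<close>, its conjugate, \<open>c\<close> and its
  conjugate.  Multiplication by \<open>c\<close> therefore carries the real points of \<open>V\<close> (all \<open>z\<^sub>j\<close> real) to a real
  4-plane on which \<open>\<omega>\<close> vanishes, because \<open>\<omega>\<close> is diagonal, and on which \<open>\<theta>\<close> is a positive multiple of
  \<open>dx\<^sub>1 \<and> dx\<^sub>2 \<and> dx\<^sub>3 \<and> dx\<^sub>4\<close>, because the product of the four conjugates of \<open>c\<close> is the square of its norm.  So the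
  plane is special Lagrangian, hence Cayley.  It is spanned by the lattice vectors \<open>c y\<^sup>k\<close> with
  \<open>0 \<le> k \<le> 3\<close>, where \<open>y\<close> is an integral multiple of \<open>x\<^sub>1\<close>, and its image in \<open>X\<close> is a compact torus.  All
  cycles used below are rational combinations of five such tori.

  The integral of an invariant form \<open>b\<close> over the torus of \<open>c\<close> is a fixed multiple of the value of \<open>b\<close> at
  the vectors \<open>\<phi>\<^sub>k(c) e\<^sub>k\<close>.  Expanding in \<open>s\<close> and \<open>t\<close> gives a sum over subsets \<open>K\<close> of the four coordinates:
  \<open>\<i> e\<^sub>k\<close> is inserted for \<open>k\<close> in \<open>K\<close> and \<open>e\<^sub>k\<close> otherwise, and the coefficient is
  \<open>s\<^bsup>4 - |K|\<^esup> (t D)\<^bsup>|K|\<^esup>\<close> up to a sign that does not depend on \<open>c\<close> (\<open>frame_plane_expand\<close>).  On the other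
  side, the product of \<open>M\<close> or \<open>M'\<close> with \<open>b\<close>, evaluated at the standard frame, is a combination of the same sixteen
  values of \<open>b\<close> with coefficients that depend, up to the same signs, only on the size of \<open>K\<close>
  (\<open>weil_wedge_std_frame\<close>).  So the cycle has to satisfy five linear conditions, one for each monomial in
  a binary quartic form in \<open>s\<close> and \<open>t\<close>.  Evaluation at five pairwise non-proportional points \<open>(s, t)\<close> is a basis of
  the dual of the space of binary quartic forms (\<open>quartic_moments\<close>), and this basis is rational; it remains to see that
  the required moments are rational.  They are rational multiples of odd powers of \<open>D\<close> times the quotient of two
  covolumes: that of the lattice of \<open>X\<close>, which is rational (\<open>fundamental_domain_rational_volume\<close>),
  and that of the powers of \<open>y\<close> in the real 4-space, which is a Vandermonde determinant and so a rational multiple of \<open>D\<close>.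

  That \<open>M\<close> and \<open>M'\<close> are rational has a similar reason.  Writing \<open>z'\<close> for the conjugate of \<open>z\<close>, the four embeddings in
  \<open>dz\<^sub>1 \<and> dz'\<^sub>2 \<and> dz\<^sub>3 \<and> dz'\<^sub>4\<close> all fix \<open>\<i> D\<close>, so this form is the determinant of \<open>F\<close> over
  \<open>\<rat>(\<i> D)\<close>: on lattice vectors it is the Vandermonde determinant times a determinant with entries in
  \<open>\<rat>(\<i> D)\<close> (\<open>coord_form_lattice\<close>).
\<close>

text \<open>In what follows \<open>$\<close> denotes components of vectors, and degrees, coefficients and fractions are those of the types \<open>poly\<close> and \<open>rat\<close>.\<close>

no_notation fps_nth (infixl "$" 75)
hide_const (open) Polynomials.lead_coeff Polynomials.degree up_ring.coeff up_ring.monom Fraction_Field.Fract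


section \<open>Sums and products of algebraic integers\<close>

definition ipoly :: "int poly \<Rightarrow> 'a::field_char_0 \<Rightarrow> 'a" where
  "ipoly p z = poly (map_poly of_int p) z"

lemma ipoly_simps [simp]:
  "ipoly 0 z = 0" "ipoly (pCons a p) z = of_int a + z * ipoly p z"
  by (simp_all add: ipoly_def map_poly_pCons)

lemma ipoly_add: "ipoly (p + q) z = ipoly p z + ipoly q z"
  by (induction p q rule: poly_induct2) (simp_all add: algebra_simps)

lemma ipoly_smult: "ipoly (Polynomial.smult a p) z = of_int a * ipoly p z"
  by (induction p) (auto simp: algebra_simps)

lemma ipoly_uminus: "ipoly (- p) z = - ipoly p z"
  by (induction p) auto

lemma ipoly_minus: "ipoly (p - q) z = ipoly p z - ipoly q z"
  using ipoly_add[of p "- q" z] ipoly_uminus[of q z] by simp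

lemma ipoly_mult: "ipoly (p * q) z = ipoly p z * ipoly q z"
  by (induction p) (auto simp: algebra_simps ipoly_add ipoly_smult)

lemma algebraic_int_iff_ipoly: "algebraic_int z \<longleftrightarrow> (\<exists>p. ipoly p z = 0 \<and> lead_coeff p = 1)"
  by (simp add: algebraic_int_altdef_ipoly ipoly_def)

lemma monic_mult_minus:
  fixes p q r s :: "'a::idom poly"
  assumes "degree p = d" "lead_coeff p = 1" "degree q = d" "lead_coeff q = 1"
    and "degree r < d" "degree s < d"
  shows "degree (p * q - r * s) = 2 * d" "lead_coeff (p * q - r * s) = 1"
proof -
  have nz: "p \<noteq> 0" "q \<noteq> 0" using assms by auto
  have pq: "degree (p * q) = 2 * d" using nz assms by (simp add: degree_mult_eq)
  have rs: "degree (r * s) < 2 * d" using degree_mult_le[of r s] assms by linarith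
  have dd: "degree (- (r * s)) < degree (p * q)" using pq rs by simp
  have "degree (p * q + - (r * s)) = degree (p * q)"
    by (rule degree_add_eq_left[OF dd])
  then show d: "degree (p * q - r * s) = 2 * d" using pq by simp
  have "coeff (r * s) (2 * d) = 0" using rs by (simp add: coeff_eq_0)
  moreover have "coeff (p * q) (2 * d) = 1"
    using lead_coeff_mult[of p q] pq assms by simp
  ultimately show "lead_coeff (p * q - r * s) = 1" using d by simp
qed

text \<open>Fraction-free elimination.  The matrices considered have monic diagonal entries of one degree \<open>d\<close> and
  off-diagonal entries of smaller degree, as the matrix \<open>X \<cdot> 1 - U\<close> has for an integer matrix \<open>U\<close>.  Eliminating one unknown
  preserves this shape with \<open>2 d\<close> in place of \<open>d\<close>, so in the end a single equation \<open>p(z) v = 0\<close> with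
  \<open>p\<close> monic and \<open>v \<noteq> 0\<close> remains.\<close>

lemma algebraic_int_of_linear_system:
  fixes z :: "'a::field_char_0" and v :: "'i \<Rightarrow> 'a" and A :: "'i \<Rightarrow> 'i \<Rightarrow> int poly"
  assumes "finite I" and "d > 0"
    and "\<And>i. i \<in> I \<Longrightarrow> degree (A i i) = d \<and> lead_coeff (A i i) = 1"
    and "\<And>i j. i \<in> I \<Longrightarrow> j \<in> I \<Longrightarrow> i \<noteq> j \<Longrightarrow> degree (A i j) < d"
    and "\<And>i. i \<in> I \<Longrightarrow> (\<Sum>j\<in>I. ipoly (A i j) z * v j) = 0"
    and "\<exists>i\<in>I. v i \<noteq> 0"
  shows "algebraic_int z"
  using assms
proof (induction I arbitrary: d A rule: finite_induct)
  case empty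
  then show ?case by simp
next
  case (insert n I)
  show ?case
  proof (cases "\<exists>i\<in>I. v i \<noteq> 0")
    case False
    then have "v n \<noteq> 0" using insert.prems(5) by auto
    moreover have "(\<Sum>j\<in>I. ipoly (A n j) z * v j) = 0" using False by (intro sum.neutral) auto
    moreover have "(\<Sum>j\<in>insert n I. ipoly (A n j) z * v j) = 0" using insert.prems(4) by blast
    ultimately have "ipoly (A n n) z = 0" using insert.hyps by simp
    then show ?thesis using insert.prems(2) algebraic_int_iff_ipoly by blast
  next
    case True
    \<comment> \<open>\<open>B\<close> is the system for the unknowns other than \<open>v n\<close>, obtained from row \<open>i\<close> and row \<open>n\<close>.\<close>
    define B where "B i j = A n n * A i j - A i n * A n j" for i j
    show ?thesis
    proof (rule insert.IH[of "2 * d" B])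
      show "2 * d > 0" using insert.prems(1) by simp
    next
      fix i assume i: "i \<in> I"
      then have ne: "i \<noteq> n" using insert.hyps by auto
      have "degree (A n n) = d" "lead_coeff (A n n) = 1" "degree (A i i) = d" "lead_coeff (A i i) = 1"
        using insert.prems(2) i by auto
      moreover have "degree (A i n) < d" "degree (A n i) < d"
        using insert.prems(3) i ne by auto
      ultimately show "degree (B i i) = 2 * d \<and> lead_coeff (B i i) = 1"
        unfolding B_def using monic_mult_minus by blast
    next
      fix i j assume ij: "i \<in> I" "j \<in> I" "i \<noteq> j"
      then have ne: "i \<noteq> n" "j \<noteq> n" using insert.hyps by auto
      have "degree (A n n) = d" "degree (A i j) < d" "degree (A i n) < d" "degree (A n j) < d"
        using insert.prems ij ne by auto
      then have "degree (A n n * A i j) < 2 * d" "degree (A i n * A n j) < 2 * d"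
        using degree_mult_le[of "A n n" "A i j"] degree_mult_le[of "A i n" "A n j"] by linarith+
      then show "degree (B i j) < 2 * d"
        unfolding B_def by (rule degree_diff_less)
    next
      fix i assume i: "i \<in> I"
      have s: "(\<Sum>j\<in>I. ipoly (A k j) z * v j) = - (ipoly (A k n) z * v n)" if "k \<in> insert n I" for k
        using insert.prems(4)[OF that] insert.hyps by (simp add: eq_neg_iff_add_eq_0 add.commute)
      have "(\<Sum>j\<in>I. ipoly (B i j) z * v j)
          = ipoly (A n n) z * (\<Sum>j\<in>I. ipoly (A i j) z * v j)
            - ipoly (A i n) z * (\<Sum>j\<in>I. ipoly (A n j) z * v j)"
        by (simp add: B_def ipoly_minus ipoly_mult sum_distrib_left algebra_simps sum_subtractf)
      also have "\<dots> = 0" using s[of i] s[of n] i by simp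
      finally show "(\<Sum>j\<in>I. ipoly (B i j) z * v j) = 0" .
    qed (use True in auto)
  qed
qed

interpretation int_module: Modules.module "\<lambda>(a::int) (z::'a::field_char_0). of_int a * z"
  by unfold_locales (auto simp: algebra_simps)

abbreviation zspan :: "'a::field_char_0 set \<Rightarrow> 'a set" where
  "zspan \<equiv> int_module.span"

text \<open>The usual criterion: an element that maps a nonzero finitely generated additive group to itself by
  multiplication is integral.\<close>

lemma algebraic_int_of_stable_span:
  fixes z :: "'a::field_char_0"
  assumes fin: "finite S" and ne: "s \<in> S" "s \<noteq> 0" and st: "\<And>w. w \<in> S \<Longrightarrow> z * w \<in> zspan S"
  shows "algebraic_int z"
proof -
  have "\<forall>w\<in>S. \<exists>u. z * w = (\<Sum>v\<in>S. of_int (u v) * v)"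
    using st int_module.span_finite[OF fin] by auto
  then obtain u where u: "\<And>w. w \<in> S \<Longrightarrow> z * w = (\<Sum>v\<in>S. of_int (u w v) * v)"
    by metis
  define A where "A w v = (if w = v then [:- u w v, 1:] else [:- u w v:])" for w v
  show ?thesis
  proof (rule algebraic_int_of_linear_system[of S 1 A z "\<lambda>w. w"])
    fix w assume w: "w \<in> S"
    have "ipoly (A w v) z * v = (if v = w then z * w else 0) - of_int (u w v) * v" for v
      by (simp add: A_def algebra_simps)
    then have "(\<Sum>v\<in>S. ipoly (A w v) z * v)
        = (\<Sum>v\<in>S. if v = w then z * w else 0) - (\<Sum>v\<in>S. of_int (u w v) * v)"
      by (simp add: sum_subtractf)
    then show "(\<Sum>v\<in>S. ipoly (A w v) z * v) = 0"
      using u[OF w] w fin by simp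
  qed (use fin ne in \<open>auto simp: A_def\<close>)
qed

definition power_products :: "'a::field_char_0 \<Rightarrow> nat \<Rightarrow> 'a \<Rightarrow> nat \<Rightarrow> 'a set" where
  "power_products x n y m = (\<lambda>(i, j). x ^ i * y ^ j) ` ({..<n} \<times> {..<m})"

lemma power_products_commute: "power_products x n y m = power_products y m x n"
  unfolding power_products_def by (force simp: mult.commute image_iff)

lemma power_in_lower_powers:
  fixes x :: "'a::field_char_0"
  assumes "ipoly p x = 0" "lead_coeff p = 1" "degree p = n"
  shows "x ^ n * w \<in> zspan ((\<lambda>i. x ^ i * w) ` {..<n})"
proof -
  have "ipoly p x = (\<Sum>i\<le>n. of_int (coeff p i) * x ^ i)"
    unfolding ipoly_def using assms by (subst poly_altdef) (simp add: degree_map_poly coeff_map_poly)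
  also have "{..n} = insert n {..<n}" by auto
  finally have "x ^ n = - (\<Sum>i<n. of_int (coeff p i) * x ^ i)"
    using assms by (simp add: eq_neg_iff_add_eq_0)
  then have "x ^ n * w = - (\<Sum>i<n. of_int (coeff p i) * (x ^ i * w))"
    by (simp add: sum_distrib_right mult.assoc)
  also have "\<dots> \<in> zspan ((\<lambda>i. x ^ i * w) ` {..<n})"
    by (intro int_module.span_neg int_module.span_sum int_module.span_scale int_module.span_base) auto
  finally show ?thesis .
qed

lemma mult_power_products:
  fixes x :: "'a::field_char_0"
  assumes "ipoly p x = 0" "lead_coeff p = 1" "degree p = n" and w: "w \<in> power_products x n y m"
  shows "x * w \<in> zspan (power_products x n y m)"
proof -
  from w obtain i j where ij: "i < n" "j < m" "w = x ^ i * y ^ j"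
    unfolding power_products_def by auto
  show ?thesis
  proof (cases "Suc i < n")
    case True
    then have "x * w \<in> power_products x n y m"
      unfolding power_products_def using ij by (auto intro!: image_eqI[of _ _ "(Suc i, j)"])
    then show ?thesis by (rule int_module.span_base)
  next
    case False
    then have n: "n = Suc i" using ij by simp
    have "x * w = x ^ n * y ^ j" using ij n by simp
    also have "\<dots> \<in> zspan ((\<lambda>i. x ^ i * y ^ j) ` {..<n})"
      by (rule power_in_lower_powers) fact+
    also have "\<dots> \<subseteq> zspan (power_products x n y m)"
      unfolding power_products_def using ij by (intro int_module.span_mono) auto
    finally show ?thesis .
  qed
qed

lemma mult_zspan:
  fixes z :: "'a::field_char_0"
  assumes "\<And>w. w \<in> S \<Longrightarrow> z * w \<in> zspan S" and "v \<in> zspan S"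
  shows "z * v \<in> zspan S"
  using assms(2)
proof (induction rule: int_module.span_induct_alt)
  case base
  then show ?case by (simp add: int_module.span_zero)
next
  case (step c x y)
  have "z * (of_int c * x + y) = of_int c * (z * x) + z * y" by (simp add: algebra_simps)
  then show ?case using step assms(1) by (auto intro: int_module.span_add int_module.span_scale)
qed

lemma
  fixes x y :: "'a::field_char_0"
  assumes "algebraic_int x" "algebraic_int y"
  shows algebraic_int_add: "algebraic_int (x + y)" and algebraic_int_mult: "algebraic_int (x * y)"
proof -
  obtain p where p: "ipoly p x = 0" "lead_coeff p = 1" using assms algebraic_int_iff_ipoly by blast
  obtain q where q: "ipoly q y = 0" "lead_coeff q = 1" using assms algebraic_int_iff_ipoly by blast
  define S where "S = power_products x (degree p) y (degree q)"
  have fin: "finite S" unfolding S_def power_products_def by simp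
  have pos: "degree r > 0" if "ipoly r z = 0" "lead_coeff r = 1" for r and z :: 'a
  proof (rule ccontr)
    assume "\<not> degree r > 0"
    then obtain c where "r = [:c:]" using degree_eq_zeroE by blast
    then show False using that by simp
  qed
  have one: "1 \<in> S"
    unfolding S_def power_products_def using pos[OF p] pos[OF q] by (auto intro!: image_eqI[of _ _ "(0, 0)"])
  have x: "x * w \<in> zspan S" if "w \<in> S" for w
    using mult_power_products[OF p refl] that unfolding S_def by blast
  have y: "y * w \<in> zspan S" if "w \<in> S" for w
    using mult_power_products[OF q refl] that unfolding S_def by (metis power_products_commute)
  show "algebraic_int (x + y)"
    by (rule algebraic_int_of_stable_span[OF fin one])
      (auto simp: distrib_right intro: int_module.span_add x y)
  show "algebraic_int (x * y)"
    by (rule algebraic_int_of_stable_span[OF fin one])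
      (auto simp: mult.assoc intro: mult_zspan[OF x] y)
qed

lemma algebraic_int_diff:
  fixes x y :: "'a::field_char_0"
  assumes "algebraic_int x" "algebraic_int y"
  shows "algebraic_int (x - y)"
  using algebraic_int_add[OF assms(1) algebraic_int_minus[OF assms(2)]] by simp

lemma algebraic_int_power:
  fixes x :: "'a::field_char_0"
  shows "algebraic_int x \<Longrightarrow> algebraic_int (x ^ n)"
  by (induction n) (auto intro: algebraic_int_mult)

lemma algebraic_int_sum:
  fixes f :: "'b \<Rightarrow> 'a::field_char_0"
  shows "(\<And>i. i \<in> I \<Longrightarrow> algebraic_int (f i)) \<Longrightarrow> algebraic_int (\<Sum>i\<in>I. f i)"
  by (induction I rule: infinite_finite_induct) (auto intro: algebraic_int_add)

lemma algebraic_int_prod: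
  fixes f :: "'b \<Rightarrow> 'a::field_char_0"
  shows "(\<And>i. i \<in> I \<Longrightarrow> algebraic_int (f i)) \<Longrightarrow> algebraic_int (\<Prod>i\<in>I. f i)"
  by (induction I rule: infinite_finite_induct) (auto intro: algebraic_int_mult)


section \<open>The field and its embeddings\<close>

definition qpoly :: "rat poly \<Rightarrow> 'a::field_char_0 \<Rightarrow> 'a" where
  "qpoly p z = poly (map_poly of_rat p) z"

lemma qpoly_simps [simp]:
  "qpoly 0 z = 0" "qpoly (pCons a p) z = of_rat a + z * qpoly p z"
  by (simp_all add: qpoly_def map_poly_pCons)

lemma qpoly_1 [simp]: "qpoly 1 z = 1"
  unfolding one_pCons by simp

lemma qpoly_add: "qpoly (p + q) z = qpoly p z + qpoly q z"
  by (induction p q rule: poly_induct2) (simp_all add: algebra_simps of_rat_add)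

lemma qpoly_smult: "qpoly (Polynomial.smult a p) z = of_rat a * qpoly p z"
  by (induction p) (auto simp: algebra_simps of_rat_mult)

lemma qpoly_uminus: "qpoly (- p) z = - qpoly p z"
  by (induction p) (auto simp: of_rat_minus)

lemma qpoly_diff: "qpoly (p - q) z = qpoly p z - qpoly q z"
  using qpoly_add[of p "- q" z] qpoly_uminus[of q z] by simp

lemma qpoly_mult: "qpoly (p * q) z = qpoly p z * qpoly q z"
  by (induction p) (auto simp: algebra_simps qpoly_add qpoly_smult)

lemma of_rat_eq_of_real: "of_rat a = (of_real (of_rat a) :: 'a::{real_field, field_char_0})"
  by (induction a) (simp add: of_rat_rat)

lemma qpoly_of_real: "qpoly p (of_real y :: 'a::{real_field, field_char_0}) = of_real (qpoly p y)"
  using of_rat_eq_of_real[where 'a = 'a] by (induction p) auto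

lemma irreducible_bezout:
  fixes P A :: "rat poly"
  assumes "Factorial_Ring.irreducible P" "qpoly P z = 0" "qpoly A z \<noteq> 0"
  shows "\<exists>U V. U * P + V * A = 1"
proof -
  have "\<not> P dvd A"
    using assms by (auto simp: dvd_def qpoly_mult)
  then have "coprime P A"
    using assms(1) by (meson Factorial_Ring.irreducible_imp_prime_elem prime_elem_imp_coprime)
  then show ?thesis
    by (metis bezout_coefficients_fst_snd coprime_imp_gcd_eq_1)
qed

lemma qpoly_inverse_at_root:
  fixes z :: "'a::field_char_0"
  assumes "Factorial_Ring.irreducible P" "qpoly P z = 0" "qpoly A z \<noteq> 0"
  shows "\<exists>B. qpoly A z * qpoly B z = 1"
proof -
  obtain U V where "U * P + V * A = 1" using irreducible_bezout[OF assms] by blast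
  then have "qpoly (U * P + V * A) z = 1" by simp
  then have "qpoly A z * qpoly V z = 1" using assms(2) by (simp add: qpoly_add qpoly_mult mult.commute)
  then show ?thesis ..
qed

text \<open>This is what makes the embeddings well defined: a relation between the powers of one root of an irreducible
  polynomial holds for every other root.\<close>

lemma qpoly_zero_at_conjugate:
  fixes z w :: "'a::field_char_0"
  assumes "Factorial_Ring.irreducible P" "qpoly P z = 0" "qpoly P w = 0" "qpoly A z = 0"
  shows "qpoly A w = 0"
proof (rule ccontr)
  assume "qpoly A w \<noteq> 0"
  then obtain U V where "U * P + V * A = 1" using irreducible_bezout[OF assms(1,3)] by blast
  then have "qpoly (U * P + V * A) z = 1" by simp
  then show False using assms by (simp add: qpoly_add qpoly_mult)
qed

text \<open>Since \<open>F\<close> is a generated subfield of the ring structure on \<open>complex\<close>, the abstract operations have to be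
  translated to those of the type.\<close>

abbreviation RR :: "complex ring" where "RR \<equiv> ring_of_type_algebra"

lemma RR_simps [simp]:
  "carrier RR = UNIV" "a \<otimes>\<^bsub>RR\<^esub> b = a * b" "a \<oplus>\<^bsub>RR\<^esub> b = a + b" "\<one>\<^bsub>RR\<^esub> = 1" "\<zero>\<^bsub>RR\<^esub> = 0"
  by (simp_all add: ring_of_type_algebra_def)

lemma RR_a_inv [simp]: "\<ominus>\<^bsub>RR\<^esub> a = - a"
proof -
  interpret cring RR by (rule cring_from_type_algebra)
  show ?thesis by (rule minus_equality) auto
qed

lemma RR_m_inv: "a * b = 1 \<Longrightarrow> inv\<^bsub>RR\<^esub> a = b"
proof -
  interpret cring RR by (rule cring_from_type_algebra)
  show "a * b = 1 \<Longrightarrow> inv\<^bsub>RR\<^esub> a = b" by (rule comm_inv_char) auto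
qed

lemma of_nat_in_generate_field: "of_nat n \<in> generate_field RR S"
proof (induction n)
  case 0
  have "- 1 \<in> generate_field RR S"
    using generate_field.a_inv[OF generate_field.one, of RR S] by simp
  then show ?case
    using generate_field.eng_add[OF generate_field.one, of "-1" RR S] by simp
next
  case (Suc n)
  then show ?case using generate_field.eng_add[OF generate_field.one Suc] by simp
qed

lemma of_int_in_generate_field: "of_int n \<in> generate_field RR S"
  using of_nat_in_generate_field[of "nat n" S] generate_field.a_inv[OF of_nat_in_generate_field[of "nat (- n)" S]]
  by (cases "n \<ge> 0") simp_all

lemma of_rat_in_generate_field: "of_rat q \<in> generate_field RR S"
proof (induction q)
  case (Fract a b)
  have "inv\<^bsub>RR\<^esub> of_int b \<in> generate_field RR S"
    using generate_field.m_inv[OF of_int_in_generate_field[of b S]] Fract by simp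
  moreover have "inv\<^bsub>RR\<^esub> (of_int b) = inverse (of_int b :: complex)"
    using Fract by (intro RR_m_inv) simp
  ultimately show ?case
    using generate_field.eng_mult[OF of_int_in_generate_field[of a S]] Fract
    by (simp add: of_rat_rat divide_inverse)
qed

lemma qpoly_in_generate_field: "z \<in> generate_field RR S \<Longrightarrow> qpoly p z \<in> generate_field RR S"
proof (induction p)
  case 0
  then show ?case using of_nat_in_generate_field[of 0 S] by simp
next
  case (pCons a p)
  have "z * qpoly p z \<in> generate_field RR S"
    using generate_field.eng_mult[OF pCons(3) pCons(2)] pCons(3) by simp
  then show ?case using generate_field.eng_add[OF of_rat_in_generate_field[of a S]] by simp
qed

text \<open>The elements \<open>A(y) + w B(y)\<close>.  With \<open>w\<^sup>2\<close> rational they form a ring, and for \<open>w \<noteq> 0\<close> purely imaginary and \<open>y\<close> real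
  both parts \<open>A(y)\<close> and \<open>B(y)\<close> are determined by the element.\<close>

definition quad_elem :: "real \<Rightarrow> complex \<Rightarrow> rat poly \<times> rat poly \<Rightarrow> complex" where
  "quad_elem y w = (\<lambda>(A, B). of_real (qpoly A y) + w * of_real (qpoly B y))"

lemma quad_elem_alg:
  assumes "w ^ 2 = of_rat c"
  shows "quad_elem y w (A, B) + quad_elem y w (C, D) = quad_elem y w (A + C, B + D)"
    and "- quad_elem y w (A, B) = quad_elem y w (- A, - B)"
    and "quad_elem y w (A, B) * quad_elem y w (C, D)
       = quad_elem y w (A * C + Polynomial.smult c (B * D), A * D + B * C)"
proof -
  have c: "of_real (of_rat c) = w * w"
    using assms by (metis of_rat_eq_of_real[where 'a = complex] power2_eq_square)
  show "quad_elem y w (A, B) + quad_elem y w (C, D) = quad_elem y w (A + C, B + D)"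
    "- quad_elem y w (A, B) = quad_elem y w (- A, - B)"
    by (simp_all add: quad_elem_def qpoly_add qpoly_uminus algebra_simps)
  show "quad_elem y w (A, B) * quad_elem y w (C, D)
       = quad_elem y w (A * C + Polynomial.smult c (B * D), A * D + B * C)"
    by (simp add: quad_elem_def qpoly_add qpoly_mult qpoly_smult c algebra_simps)
qed


lemma quad_elem_eq_iff:
  assumes "D \<noteq> 0"
  shows "quad_elem y (\<i> * of_real D) (A, B) = quad_elem y (\<i> * of_real D) (A', B')
    \<longleftrightarrow> qpoly A y = qpoly A' y \<and> qpoly B y = qpoly B' y"
  using assms by (auto simp: quad_elem_def complex_eq_iff)

text \<open>The norm \<open>A(y)\<^sup>2 + D\<^sup>2 B(y)\<^sup>2\<close> is a positive element of \<open>\<rat>(y)\<close>, which is a field, so the conjugate divided by the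
  norm is an inverse.\<close>

lemma quad_elem_inverse:
  assumes "Factorial_Ring.irreducible P" "qpoly P y = 0"
    and w: "(\<i> * of_real D) ^ 2 = of_rat c" "D \<noteq> 0"
    and nz: "quad_elem y (\<i> * of_real D) (A, B) \<noteq> 0"
  shows "\<exists>A' B'. quad_elem y (\<i> * of_real D) (A, B) * quad_elem y (\<i> * of_real D) (A', B') = 1"
proof -
  define N where "N = A * A - Polynomial.smult c (B * B)"
  have "complex_of_real (of_rat c) = of_real (- (D\<^sup>2))"
    using w(1) by (simp add: power_mult_distrib of_rat_eq_of_real[where 'a = complex])
  then have c: "of_rat c = - (D\<^sup>2)" by (simp only: of_real_eq_iff)
  have N: "qpoly N y = (qpoly A y)\<^sup>2 + D\<^sup>2 * (qpoly B y)\<^sup>2"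
    by (simp add: N_def qpoly_diff qpoly_mult qpoly_smult c power2_eq_square)
  have "qpoly A y \<noteq> 0 \<or> qpoly B y \<noteq> 0"
    using nz by (auto simp: quad_elem_def)
  then have "qpoly N y > 0"
    using w(2) unfolding N by (elim disjE) (simp_all add: add_pos_nonneg add_nonneg_pos)
  then obtain C where C: "qpoly N y * qpoly C y = 1"
    using qpoly_inverse_at_root[OF assms(1,2), of N] by auto
  have "(of_real a + \<i> * of_real D * of_real b) * (of_real (a * k) + \<i> * of_real D * of_real (- b * k))
      = complex_of_real ((a\<^sup>2 + D\<^sup>2 * b\<^sup>2) * k)" for a b k :: real
    by (simp add: complex_eq_iff power2_eq_square algebra_simps)
  then have "quad_elem y (\<i> * of_real D) (A, B) * quad_elem y (\<i> * of_real D) (A * C, (- B) * C)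
      = of_real (((qpoly A y)\<^sup>2 + D\<^sup>2 * (qpoly B y)\<^sup>2) * qpoly C y)"
    by (simp only: quad_elem_def prod.case qpoly_mult qpoly_uminus)
  also have "\<dots> = of_real (qpoly N y * qpoly C y)" by (simp only: N)
  also have "\<dots> = 1" by (simp only: C of_real_1)
  finally show ?thesis by (intro exI)
qed

lemma rat_adjoin_quad:
  assumes "Factorial_Ring.irreducible P" "qpoly P y = 0"
    and w: "(\<i> * of_real D) ^ 2 = of_rat c" "D \<noteq> 0"
  shows "rat_adjoin {complex_of_real y, \<i> * of_real D} = range (quad_elem y (\<i> * of_real D))"
proof (intro subset_antisym subsetI)
  fix z assume "z \<in> rat_adjoin {complex_of_real y, \<i> * of_real D}"
  then have "z \<in> generate_field RR {complex_of_real y, \<i> * of_real D}" by (simp add: rat_adjoin_def)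
  then show "z \<in> range (quad_elem y (\<i> * of_real D))"
  proof induction
    case one
    have "1 = quad_elem y (\<i> * of_real D) (1, 0)" by (simp add: quad_elem_def)
    then show ?case unfolding RR_simps by (rule range_eqI)
  next
    case (incl h)
    have "complex_of_real y = quad_elem y (\<i> * of_real D) ([:0, 1:], 0)"
      by (simp add: quad_elem_def)
    then have 1: "complex_of_real y \<in> range (quad_elem y (\<i> * of_real D))" by (rule range_eqI)
    have "\<i> * of_real D = quad_elem y (\<i> * of_real D) (0, 1)"
      by (simp add: quad_elem_def)
    then have 2: "\<i> * of_real D \<in> range (quad_elem y (\<i> * of_real D))" by (rule range_eqI)
    from incl consider "h = complex_of_real y" | "h = \<i> * of_real D" by blast
    then show ?case by cases (simp_all only: 1 2)
  next
    case (a_inv h)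
    then obtain A B where h: "h = quad_elem y (\<i> * of_real D) (A, B)" by (metis imageE surj_pair)
    show ?case unfolding RR_a_inv h quad_elem_alg(2)[OF w(1)] by (rule rangeI)
  next
    case (m_inv h)
    then obtain A B where h: "h = quad_elem y (\<i> * of_real D) (A, B)" by (metis imageE surj_pair)
    have "h \<noteq> 0" using m_inv by simp
    then obtain A' B' where "h * quad_elem y (\<i> * of_real D) (A', B') = 1"
      using quad_elem_inverse[OF assms, of A B] unfolding h by blast
    then show ?case using RR_m_inv[of h] by (simp only: rangeI)
  next
    case (eng_add h1 h2)
    then obtain p q where h: "h1 = quad_elem y (\<i> * of_real D) p" "h2 = quad_elem y (\<i> * of_real D) q"
      by blast
    show ?case unfolding RR_simps h
      by (cases p; cases q) (simp only: quad_elem_alg(1)[OF w(1)] rangeI)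
  next
    case (eng_mult h1 h2)
    then obtain p q where h: "h1 = quad_elem y (\<i> * of_real D) p" "h2 = quad_elem y (\<i> * of_real D) q"
      by blast
    show ?case unfolding RR_simps h
      by (cases p; cases q) (simp only: quad_elem_alg(3)[OF w(1)] rangeI)
  qed
next
  fix z assume "z \<in> range (quad_elem y (\<i> * of_real D))"
  then obtain A B where z: "z = quad_elem y (\<i> * of_real D) (A, B)" by auto
  define G where "G = generate_field RR {complex_of_real y, \<i> * of_real D}"
  have y: "complex_of_real y \<in> G" and w': "\<i> * of_real D \<in> G"
    unfolding G_def by (auto intro: generate_field.incl)
  have q: "qpoly C (complex_of_real y) \<in> G" for C
    using qpoly_in_generate_field y unfolding G_def by blast
  have "(\<i> * of_real D) * qpoly B (complex_of_real y) \<in> G"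
    using generate_field.eng_mult[OF w'[unfolded G_def] q[of B, unfolded G_def]] unfolding G_def by simp
  then have "qpoly A (complex_of_real y) + (\<i> * of_real D) * qpoly B (complex_of_real y) \<in> G"
    using generate_field.eng_add[OF q[of A, unfolded G_def]] unfolding G_def by simp
  then show "z \<in> rat_adjoin {complex_of_real y, \<i> * of_real D}"
    unfolding z G_def rat_adjoin_def by (simp add: quad_elem_def qpoly_of_real)
qed

lemma ring_hom_field_on_iff:
  "h \<in> ring_hom (field_on K) RR \<longleftrightarrow>
    (\<forall>a\<in>K. \<forall>b\<in>K. h (a * b) = h a * h b \<and> h (a + b) = h a + h b) \<and> h 1 = 1"
  unfolding ring_hom_def field_on_def by (auto simp: ring_of_type_algebra_def)

lemma quad_embedding_exists:
  fixes y z D :: real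
  assumes "Factorial_Ring.irreducible P" "qpoly P y = 0" "qpoly P z = 0"
    and w: "(\<i> * of_real D) ^ 2 = of_rat c" "D \<noteq> 0"
    and v: "v ^ 2 = of_rat c"
    and K: "K = range (quad_elem y (\<i> * of_real D))"
  shows "\<exists>h. h \<in> ring_hom (field_on K) RR \<and> h (of_real y) = of_real z \<and> h (\<i> * of_real D) = v"
proof -
  define q where "q = quad_elem y (\<i> * of_real D)"
  define h where "h a = quad_elem z v (SOME p. q p = a)" for a
  have transfer: "quad_elem z v r = quad_elem z v p" if e: "q r = q p" for r p
  proof -
    obtain A B where r: "r = (A, B)" by (rule prod.exhaust)
    obtain A' B' where p: "p = (A', B')" by (rule prod.exhaust)
    have "qpoly (A - A') y = 0" "qpoly (B - B') y = 0"
      using e unfolding r p q_def quad_elem_eq_iff[OF w(2)] by (simp_all add: qpoly_diff)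
    then have "qpoly (A - A') z = 0" "qpoly (B - B') z = 0"
      using qpoly_zero_at_conjugate[OF assms(1-3)] by blast+
    then show ?thesis by (simp add: quad_elem_def r p qpoly_diff)
  qed
  have h: "h (q p) = quad_elem z v p" for p
  proof -
    have "q (SOME p'. q p' = q p) = q p" by (rule someI) (rule refl)
    then show ?thesis unfolding h_def by (rule transfer)
  qed
  have hom: "h (a * b) = h a * h b \<and> h (a + b) = h a + h b" if "a \<in> K" "b \<in> K" for a b
  proof -
    from that obtain A B A' B' where "a = q (A, B)" "b = q (A', B')" unfolding K q_def by auto
    then show ?thesis
      using h by (simp add: q_def quad_elem_alg(1,3)[OF w(1)] quad_elem_alg(1,3)[OF v])
  qed
  have h1: "h 1 = 1"
    using h[of "(1, 0)"] by (simp add: q_def quad_elem_def)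
  have "h (of_real y) = of_real z"
    using h[of "([:0, 1:], 0)"] by (simp add: q_def quad_elem_def)
  moreover have "h (\<i> * of_real D) = v"
    using h[of "(0, 1)"] by (simp add: q_def quad_elem_def)
  moreover have "h \<in> ring_hom (field_on K) RR"
    unfolding ring_hom_field_on_iff using hom h1 by simp
  ultimately show ?thesis by (intro exI[of _ h] conjI)
qed

lemma ring_hom_of_rat:
  fixes S :: "complex set"
  assumes h: "h \<in> ring_hom (field_on K) RR" and K: "K = rat_adjoin S"
  shows "h (of_rat q) = of_rat q"
proof -
  have in_K: "of_rat q \<in> K" for q unfolding K rat_adjoin_def by (rule of_rat_in_generate_field)
  have hm: "h (of_rat (a * b)) = h (of_rat a) * h (of_rat b)" and ha: "h (of_rat (a + b)) = h (of_rat a) + h (of_rat b)" for a b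
    using h in_K unfolding ring_hom_field_on_iff by (auto simp: of_rat_mult of_rat_add)
  have h1: "h 1 = 1" using h unfolding ring_hom_field_on_iff by blast
  have h0: "h 0 = 0" using ha[of 0 0] by simp
  have hn: "h (of_nat n) = of_nat n" for n
  proof (induction n)
    case (Suc n)
    then show ?case using ha[of 1 "of_nat n"] h1 by (simp add: of_rat_add)
  qed (use h0 in simp)
  have hneg: "h (of_rat (- a)) = - h (of_rat a)" for a
    using ha[of a "- a"] h0 by (simp add: add_eq_0_iff)
  have hi: "h (of_int n) = of_int n" for n
  proof (cases "n \<ge> 0")
    case True
    then show ?thesis using hn[of "nat n"] by simp
  next
    case False
    then have "of_nat (nat (- n)) = (of_int (- n) :: complex)" by simp
    then have "h (of_int (- n)) = of_int (- n)" using hn[of "nat (- n)"] by simp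
    then show ?thesis using hneg[of "of_int (- n)"] by (simp add: of_rat_minus)
  qed
  show ?thesis
  proof (induction q)
    case (Fract a b)
    have "h (of_rat (Fract a b)) * of_int b = of_int a"
      using hm[of "Fract a b" "of_int b"] hi[of a] hi[of b] Fract
      by (simp add: of_rat_mult of_rat_rat)
    then show ?case using Fract by (simp add: of_rat_rat field_simps)
  qed
qed

lemma ring_hom_qpoly:
  fixes S :: "complex set"
  assumes h: "h \<in> ring_hom (field_on K) RR" and K: "K = rat_adjoin S" and a: "a \<in> K"
  shows "h (qpoly p a) = qpoly p (h a)"
proof (induction p)
  case 0
  then show ?case using ring_hom_of_rat[OF h K, of 0] by simp
next
  case (pCons c p)
  have inK: "of_rat c \<in> K" "qpoly p a \<in> K" "a * qpoly p a \<in> K"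
    using of_rat_in_generate_field[of c S] qpoly_in_generate_field[of a S p] a
      generate_field.eng_mult[of a RR S "qpoly p a"]
    unfolding K rat_adjoin_def by simp_all
  then show ?case
    using h a pCons ring_hom_of_rat[OF h K, of c] unfolding ring_hom_field_on_iff by simp
qed

lemma ring_hom_quad_elem:
  assumes h: "h \<in> ring_hom (field_on K) RR" and K: "K = rat_adjoin {complex_of_real y, w}"
    and "h (of_real y) = of_real z" "h w = v"
  shows "h (quad_elem y w p) = quad_elem z v p"
proof -
  obtain A B where p: "p = (A, B)" by force
  have y: "complex_of_real y \<in> K" and w: "w \<in> K"
    unfolding K rat_adjoin_def by (auto intro: generate_field.incl)
  have inK: "qpoly A (complex_of_real y) \<in> K" "qpoly B (complex_of_real y) \<in> K" "w * qpoly B (complex_of_real y) \<in> K"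
    using y w qpoly_in_generate_field[of "of_real y"] generate_field.eng_mult[of w RR _ "qpoly B (of_real y)"]
    unfolding K rat_adjoin_def by simp_all
  have "h (qpoly A (of_real y) + w * qpoly B (of_real y)) = qpoly A (of_real z) + v * qpoly B (of_real z)"
    using h inK w ring_hom_qpoly[OF h K y] assms(3,4) unfolding ring_hom_field_on_iff by simp
  then show ?thesis by (simp add: p quad_elem_def qpoly_of_real)
qed

section \<open>The period lattice in coordinates\<close>

text \<open>The position of an index in the order \<open>1, 2, 3, 4\<close>, counted from 0; it serves as the exponent attached to
  the index.\<close>

definition pw :: "4 \<Rightarrow> nat" where
  "pw k = (if k = 1 then 0 else if k = 2 then 1 else if k = 3 then 2 else 3)"

lemma pw_simps [simp]: "pw 1 = 0" "pw 2 = 1" "pw 3 = 2" "pw 4 = 3"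
  by (simp_all add: pw_def)

lemma eps_simps [simp]: "eps 1 = 1" "eps 2 = -1" "eps 3 = 1" "eps 4 = -1"
  by (simp_all add: eps_def)

lemma eps_cases: "eps j = 1 \<or> eps j = -1"
  by (simp add: eps_def)

lemma eps_mult_self [simp]: "eps j * eps j = 1" "(eps j)\<^sup>2 = 1"
  using eps_cases[of j] by auto

lemma det_4:
  "det (A::'a::comm_ring_1^4^4) =
     A$1$1 * A$2$2 * A$3$3 * A$4$4 - A$1$1 * A$2$2 * A$3$4 * A$4$3
   - A$1$1 * A$2$3 * A$3$2 * A$4$4 + A$1$1 * A$2$3 * A$3$4 * A$4$2
   + A$1$1 * A$2$4 * A$3$2 * A$4$3 - A$1$1 * A$2$4 * A$3$3 * A$4$2
   - A$1$2 * A$2$1 * A$3$3 * A$4$4 + A$1$2 * A$2$1 * A$3$4 * A$4$3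
   + A$1$2 * A$2$3 * A$3$1 * A$4$4 - A$1$2 * A$2$3 * A$3$4 * A$4$1
   - A$1$2 * A$2$4 * A$3$1 * A$4$3 + A$1$2 * A$2$4 * A$3$3 * A$4$1
   + A$1$3 * A$2$1 * A$3$2 * A$4$4 - A$1$3 * A$2$1 * A$3$4 * A$4$2
   - A$1$3 * A$2$2 * A$3$1 * A$4$4 + A$1$3 * A$2$2 * A$3$4 * A$4$1
   + A$1$3 * A$2$4 * A$3$1 * A$4$2 - A$1$3 * A$2$4 * A$3$2 * A$4$1
   - A$1$4 * A$2$1 * A$3$2 * A$4$3 + A$1$4 * A$2$1 * A$3$3 * A$4$2
   + A$1$4 * A$2$2 * A$3$1 * A$4$3 - A$1$4 * A$2$2 * A$3$3 * A$4$1
   - A$1$4 * A$2$3 * A$3$1 * A$4$2 + A$1$4 * A$2$3 * A$3$2 * A$4$1"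
proof -
  have f: "finite {2::4, 3, 4}" "1 \<notin> {2::4, 3, 4}" "finite {3::4, 4}" "2 \<notin> {3::4, 4}" "finite {4::4}" "3 \<notin> {4::4}"
    by auto
  show ?thesis
    unfolding det_def UNIV_4
    unfolding sum_over_permutations_insert[OF f(1,2)] sum_over_permutations_insert[OF f(3,4)]
      sum_over_permutations_insert[OF f(5,6)] permutes_sing
    by (simp add: sign_swap_id permutation_swap_id sign_compose sign_id transpose_apply_other permutation_compose algebra_simps)
qed

definition vand :: "(4 \<Rightarrow> real) \<Rightarrow> real^4^4" where
  "vand y = (\<chi> j k. y j ^ pw k)"

lemma vand_mult: "(vand y *v a) $ j = a$1 + a$2 * y j + a$3 * (y j)\<^sup>2 + a$4 * (y j)^3"
  by (simp add: vand_def matrix_vector_mult_def sum_4 mult.commute)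

lemma det_vand: "det (vand y) = disc_root y"
  unfolding det_4 vand_def disc_root_def by (simp add: power2_eq_square power3_eq_cube algebra_simps)

locale quartic_field =
  fixes P :: "rat poly" and x :: "4 \<Rightarrow> real"
  assumes irred: "Factorial_Ring.irreducible P" and degree_P: "degree P = 4"
    and root: "\<And>j. qpoly P (x j) = 0"
    and ordered: "x 1 > x 2" "x 2 > x 3" "x 3 > x 4"
    and discrim_int: "discrim x \<in> \<int>"
begin

abbreviation "D \<equiv> disc_root x"
abbreviation "w \<equiv> \<i> * complex_of_real D"

lemma D_pos: "D > 0"
  using ordered unfolding disc_root_def by (auto intro!: mult_pos_pos)

lemma D_square: "D\<^sup>2 = discrim x"
  by (simp add: discrim_def)

lemma D_square_rat: "D\<^sup>2 \<in> \<rat>"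
  using discrim_int D_square Ints_subset_Rats by auto

definition w_sq where "w_sq = (SOME q. w ^ 2 = of_rat q)"

lemma w_square: "w ^ 2 = of_rat w_sq"
proof -
  obtain n where "D\<^sup>2 = of_int n" using discrim_int D_square by (metis Ints_cases)
  then have "w ^ 2 = of_rat (of_int (- n))" by (simp add: power_mult_distrib of_rat_minus flip: of_real_power)
  then show ?thesis unfolding w_sq_def by (rule someI)
qed

lemma field_F_eq: "field_F x = range (quad_elem (x 1) w)"
  unfolding field_F_def using rat_adjoin_quad[OF irred root w_square] D_pos by simp

lemma embed_hom: "embed x j \<in> ring_hom (field_on (field_F x)) RR"
  "embed x j (of_real (x 1)) = of_real (x j)" "embed x j w = of_real (eps j) * w"
proof -
  have v: "(of_real (eps j) * w) ^ 2 = of_rat w_sq"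
    using w_square by (simp add: power_mult_distrib flip: of_real_power)
  have "\<exists>h. h \<in> ring_hom (field_on (field_F x)) RR \<and> h (of_real (x 1)) = of_real (x j)
      \<and> h w = of_real (eps j) * w"
    by (rule quad_embedding_exists[OF irred root root w_square _ v field_F_eq]) (use D_pos in simp)
  from someI_ex[OF this]
  show "embed x j \<in> ring_hom (field_on (field_F x)) RR"
    "embed x j (of_real (x 1)) = of_real (x j)" "embed x j w = of_real (eps j) * w"
    unfolding embed_def by blast+
qed

lemma embed_quad_elem: "embed x j (quad_elem (x 1) w p) = quad_elem (x j) (of_real (eps j) * w) p"
  by (rule ring_hom_quad_elem[OF embed_hom(1) _ embed_hom(2,3)]) (simp add: field_F_def)

lemma algebraic_int_embed:
  assumes "a \<in> field_F x" "algebraic_int a"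
  shows "algebraic_int (embed x j a)"
proof -
  obtain p where p: "ipoly p a = 0" "lead_coeff p = 1" using assms(2) algebraic_int_iff_ipoly by blast
  have q: "ipoly p z = qpoly (map_poly of_int p) z" for z :: complex
    by (induction p) (simp_all add: map_poly_pCons)
  have "ipoly p (embed x j a) = embed x j (ipoly p a)"
    unfolding q using ring_hom_qpoly[OF embed_hom(1) _ assms(1)] by (simp add: field_F_def)
  also have "\<dots> = 0"
    using ring_hom_of_rat[OF embed_hom(1), of _ j 0] p(1) by (simp add: field_F_def)
  finally show ?thesis using p(2) algebraic_int_iff_ipoly by blast
qed

lemma integral_multiple: "\<exists>m>0. \<forall>j. algebraic_int (of_nat m * x j)"
proof -
  define q where "q = Polynomial.smult (inverse (lead_coeff P)) P"
  have P0: "P \<noteq> 0" using degree_P by auto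
  have q: "degree q = 4" "lead_coeff q = 1" "qpoly q (x j) = 0" for j
  proof -
    have "lead_coeff P \<noteq> 0" using P0 by simp
    then show "degree q = 4" "lead_coeff q = 1" "qpoly q (x j) = 0"
      using degree_P root[of j] by (simp_all add: q_def qpoly_smult)
  qed
  define m where "m = (\<Prod>i<4. nat (snd (quotient_of (coeff q i))))"
  have den: "snd (quotient_of r) > 0" "r * of_int (snd (quotient_of r)) \<in> \<int>" for r :: rat
  proof -
    show *: "snd (quotient_of r) > 0" by (rule quotient_of_denom_pos')
    have "r = of_int (fst (quotient_of r)) / of_int (snd (quotient_of r))"
      by (rule quotient_of_div) simp
    then have "r * of_int (snd (quotient_of r)) = of_int (fst (quotient_of r))"
      using * by (metis nonzero_eq_divide_eq of_int_0_eq_iff order_less_irrefl)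
    then show "r * of_int (snd (quotient_of r)) \<in> \<int>" by simp
  qed
  have mq: "coeff q i * of_nat m \<in> \<int>" if "i < 4" for i
  proof -
    have "m = nat (snd (quotient_of (coeff q i))) * (\<Prod>i\<in>{..<4} - {i}. nat (snd (quotient_of (coeff q i))))"
      unfolding m_def using that by (subst prod.remove[of _ i]) auto
    then have "coeff q i * of_nat m = (coeff q i * of_int (snd (quotient_of (coeff q i))))
      * of_nat (\<Prod>i\<in>{..<4} - {i}. nat (snd (quotient_of (coeff q i))))"
      using den(1)[of "coeff q i"] by simp
    then show ?thesis using den(2) by (metis Ints_mult Ints_of_nat)
  qed
  have m: "m > 0" unfolding m_def using den(1) by (intro prod_pos) simp
  \<comment> \<open>If \<open>q\<close> is the monic polynomial of \<open>x j\<close>, then \<open>r\<close> is that of \<open>m (x j)\<close>.\<close>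
  define r where "r = [: coeff q 0 * of_nat m ^ 4, coeff q 1 * of_nat m ^ 3, coeff q 2 * of_nat m ^ 2, coeff q 3 * of_nat m, 1:]"
  have "algebraic_int (of_nat m * x j)" for j
  proof
    show "lead_coeff (map_poly of_rat r :: real poly) = 1" by (simp add: r_def map_poly_pCons)
    have "coeff r i \<in> \<int>" for i
    proof -
      have "coeff q 0 * of_nat m * of_nat m ^ 3 \<in> \<int>" "coeff q 1 * of_nat m * of_nat m ^ 2 \<in> \<int>"
        "coeff q 2 * of_nat m * of_nat m \<in> \<int>" "coeff q 3 * of_nat m \<in> \<int>"
        by (intro Ints_mult[OF mq] mq Ints_power Ints_of_nat; simp)+
      then show ?thesis
        by (simp add: r_def coeff_pCons power2_eq_square power3_eq_cube power4_eq_xxxx mult.assoc split: nat.splits)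
    qed
    then show "\<forall>i. coeff (map_poly of_rat r :: real poly) i \<in> \<int>"
      by (metis Ints_cases Ints_of_int coeff_map_poly of_rat_0 of_rat_of_int_eq)
    have "q = [: coeff q 0, coeff q 1, coeff q 2, coeff q 3, 1 :]"
    proof (rule poly_eqI)
      fix n :: nat
      consider "n = 0" | "n = 1" | "n = 2" | "n = 3" | "n = 4" | "n > 4" by linarith
      then show "coeff q n = coeff [: coeff q 0, coeff q 1, coeff q 2, coeff q 3, 1 :] n"
      proof cases
        case 5
        then show ?thesis using q by (simp add: numeral_eq_Suc)
      next
        case 6
        then show ?thesis using q coeff_eq_0[of q n] by (simp add: coeff_pCons split: nat.splits)
      qed (simp_all add: numeral_eq_Suc)
    qed
    then have "qpoly q (x j) = qpoly [: coeff q 0, coeff q 1, coeff q 2, coeff q 3, 1 :] (x j)" by simp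
    then have e: "of_rat (coeff q 0) + x j * (of_rat (coeff q 1) + x j * (of_rat (coeff q 2)
       + x j * (of_rat (coeff q 3) + x j))) = 0" using q(3)[of j] by simp
    have "qpoly r (of_nat m * x j) = of_nat m ^ 4 * (of_rat (coeff q 0) + x j * (of_rat (coeff q 1) + x j * (of_rat (coeff q 2)
       + x j * (of_rat (coeff q 3) + x j))))"
      by (simp add: r_def of_rat_mult of_rat_power power4_eq_xxxx power3_eq_cube power2_eq_square algebra_simps)
    then show "poly (map_poly of_rat r) (of_nat m * x j) = 0" using e unfolding qpoly_def by simp
  qed
  then show ?thesis using m by blast
qed

end

locale integral_quartic = quartic_field +
  fixes m :: nat
  assumes m_pos: "m > 0" and m_integral: "\<And>j. algebraic_int (of_nat m * x j)"
begin

definition gen :: "4 \<Rightarrow> real" where "gen j = of_nat m * x j"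

abbreviation "V \<equiv> vand gen"

lemma disc_root_gen: "disc_root gen = of_nat m ^ 6 * D"
  unfolding disc_root_def gen_def by (simp add: algebra_simps power_def)

lemma det_V: "det V = of_nat m ^ 6 * D" and det_V_pos: "det V > 0"
  using D_pos m_pos by (simp_all add: det_vand disc_root_gen)

lemma algebraic_int_gen: "algebraic_int (gen j)"
  unfolding gen_def by (rule m_integral)

lemma algebraic_int_V: "algebraic_int (V $ i $ j)"
  unfolding vand_def by (simp add: algebraic_int_power algebraic_int_gen)

text \<open>The coordinates \<open>z\<^sub>1, \<dots>, z\<^sub>4\<close> of \<open>a\<^sub>0 + \<dots> + a\<^sub>3 y\<^sup>3 + \<i> D (b\<^sub>0 + \<dots> + b\<^sub>3 y\<^sup>3)\<close>, where \<open>y\<close> is the integral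
  generator \<open>gen 1\<close>.  Rational vectors give the elements of \<open>F\<close>; integral vectors give elements of the ring of integers.\<close>

definition Psi :: "real^4 \<Rightarrow> real^4 \<Rightarrow> complex^4" where
  "Psi a b = (\<chi> j. Complex ((V *v a) $ j) (eps j * D * (V *v b) $ j))"

lemma Psi_nth: "Psi a b $ j = Complex ((V *v a) $ j) (eps j * D * (V *v b) $ j)"
  by (simp add: Psi_def)

lemma Psi_diff: "Psi a b - Psi a' b' = Psi (a - a') (b - b')"
  by (simp add: Psi_def vec_eq_iff complex_eq_iff matrix_vector_mult_diff_distrib algebra_simps)

definition ratvec :: "(real^4) set" where "ratvec = {a. \<forall>k. a $ k \<in> \<rat>}"
definition intvec :: "(real^4) set" where "intvec = {a. \<forall>k. a $ k \<in> \<int>}"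

text \<open>Reduction modulo the quartic leaves a polynomial of degree at most 3.\<close>

lemma qpoly_lower_degree:
  fixes A :: "rat poly"
  shows "\<exists>a\<in>ratvec. \<forall>j. qpoly A (x j) = (V *v a) $ j"
proof -
  define B where "B = A mod P"
  have B: "qpoly A (x j) = qpoly B (x j)" for j
  proof -
    have "qpoly A (x j) = qpoly (A div P * P + B) (x j)" by (simp add: B_def)
    then show ?thesis using root[of j] by (simp only: qpoly_add qpoly_mult mult_zero_right add_0)
  qed
  have "degree B < 4"
    using degree_mod_less[of P A] degree_P unfolding B_def by (cases "P = 0") auto
  define a :: "real^4" where "a = (\<chi> k. of_rat (coeff B (pw k)) / of_nat m ^ pw k)"
  have "a \<in> ratvec" unfolding ratvec_def a_def by simp
  moreover have "qpoly B (x j) = (V *v a) $ j" for j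
  proof -
    have "B = [: coeff B 0, coeff B 1, coeff B 2, coeff B 3 :]"
    proof (rule poly_eqI)
      fix n :: nat
      consider "n = 0" | "n = 1" | "n = 2" | "n = 3" | "n > 3" by linarith
      then show "coeff B n = coeff [: coeff B 0, coeff B 1, coeff B 2, coeff B 3 :] n"
      proof cases
        case 5
        then show ?thesis using \<open>degree B < 4\<close> coeff_eq_0[of B n] by (simp add: coeff_pCons split: nat.splits)
      qed (simp_all add: numeral_eq_Suc)
    qed
    then have "qpoly B (x j) = qpoly [: coeff B 0, coeff B 1, coeff B 2, coeff B 3 :] (x j)" by simp
    also have "\<dots> = (V *v a) $ j"
      using m_pos by (simp add: vand_mult a_def gen_def power2_eq_square power3_eq_cube field_simps)
    finally show ?thesis .
  qed
  ultimately show ?thesis using B by auto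
qed

lemma ratvec_qpoly:
  assumes "a \<in> ratvec"
  shows "\<exists>A. \<forall>j. qpoly A (x j) = (V *v a) $ j"
proof -
  have "\<forall>k. \<exists>q. a $ k = of_rat q" using assms unfolding ratvec_def by (auto elim: Rats_cases)
  then obtain q where q: "\<And>k. a $ k = of_rat (q k)" by metis
  define A where "A = [: q 1, q 2 * of_nat m, q 3 * of_nat m ^ 2, q 4 * of_nat m ^ 3 :]"
  have "qpoly A (x j) = (V *v a) $ j" for j
    by (simp add: vand_mult A_def gen_def q of_rat_mult of_rat_power power2_eq_square power3_eq_cube algebra_simps)
  then show ?thesis by blast
qed

lemma embed_eq_Psi:
  assumes "\<And>j. qpoly A (x j) = (V *v a) $ j" "\<And>j. qpoly B (x j) = (V *v b) $ j"
  shows "embed x j (quad_elem (x 1) w (A, B)) = Psi a b $ j"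
  unfolding embed_quad_elem by (simp add: quad_elem_def Psi_nth complex_eq_iff assms)

lemma quad_elem_eq_Psi:
  assumes "\<And>j. qpoly A (x j) = (V *v a) $ j" "\<And>j. qpoly B (x j) = (V *v b) $ j"
  shows "quad_elem (x 1) w (A, B) = Psi a b $ 1"
  by (simp add: quad_elem_def Psi_nth complex_eq_iff assms)

abbreviation "L \<equiv> period_lattice x"

lemma period_lattice_eq:
  "L = {Psi a b |a b. a \<in> ratvec \<and> b \<in> ratvec \<and> algebraic_int (Psi a b $ 1)}"
proof (intro subset_antisym subsetI)
  fix l assume "l \<in> L"
  then obtain \<alpha> where al: "l = (\<chi> j. embed x j \<alpha>)" "\<alpha> \<in> field_F x" "algebraic_int \<alpha>"
    unfolding period_lattice_def ring_of_integers_def by auto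
  then obtain A B where AB: "\<alpha> = quad_elem (x 1) w (A, B)" unfolding field_F_eq by auto
  obtain a where a: "a \<in> ratvec" "\<And>j. qpoly A (x j) = (V *v a) $ j" using qpoly_lower_degree by blast
  obtain b where b: "b \<in> ratvec" "\<And>j. qpoly B (x j) = (V *v b) $ j" using qpoly_lower_degree by blast
  have "l = Psi a b" using embed_eq_Psi[OF a(2) b(2)] by (simp add: al(1) AB vec_eq_iff)
  moreover have "algebraic_int (Psi a b $ 1)" using al(3) quad_elem_eq_Psi[OF a(2) b(2)] AB by simp
  ultimately show "l \<in> {Psi a b |a b. a \<in> ratvec \<and> b \<in> ratvec \<and> algebraic_int (Psi a b $ 1)}"
    using a(1) b(1) by blast
next
  fix l assume "l \<in> {Psi a b |a b. a \<in> ratvec \<and> b \<in> ratvec \<and> algebraic_int (Psi a b $ 1)}"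
  then obtain a b where l: "l = Psi a b" "a \<in> ratvec" "b \<in> ratvec" "algebraic_int (Psi a b $ 1)" by blast
  obtain A where A: "\<And>j. qpoly A (x j) = (V *v a) $ j" using ratvec_qpoly[OF l(2)] by blast
  obtain B where B: "\<And>j. qpoly B (x j) = (V *v b) $ j" using ratvec_qpoly[OF l(3)] by blast
  have "l = (\<chi> j. embed x j (quad_elem (x 1) w (A, B)))"
    using embed_eq_Psi[OF A B] by (simp add: l(1) vec_eq_iff)
  moreover have "quad_elem (x 1) w (A, B) \<in> ring_of_integers (field_F x)"
    unfolding ring_of_integers_def field_F_eq mem_Collect_eq
    using quad_elem_eq_Psi[OF A B] l(4) by (intro conjI rangeI) simp
  ultimately show "l \<in> L" unfolding period_lattice_def by blast
qed

lemma lattice_algebraic_int: "l \<in> L \<Longrightarrow> algebraic_int (l $ j)"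
  unfolding period_lattice_def ring_of_integers_def using algebraic_int_embed by auto

lemma lattice_diff: "l \<in> L \<Longrightarrow> l' \<in> L \<Longrightarrow> l - l' \<in> L"
proof -
  assume "l \<in> L" "l' \<in> L"
  then obtain a b a' b' where l: "l = Psi a b" "a \<in> ratvec" "b \<in> ratvec" "algebraic_int (Psi a b $ 1)"
    and l': "l' = Psi a' b'" "a' \<in> ratvec" "b' \<in> ratvec" "algebraic_int (Psi a' b' $ 1)"
    unfolding period_lattice_eq by blast
  have "l - l' = Psi (a - a') (b - b')" unfolding l(1) l'(1) by (rule Psi_diff)
  moreover have "a - a' \<in> ratvec" "b - b' \<in> ratvec" using l(2,3) l'(2,3) unfolding ratvec_def by auto
  moreover have "algebraic_int (Psi (a - a') (b - b') $ 1)"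
    using algebraic_int_diff[OF l(4) l'(4)] Psi_diff[of a b a' b'] by (metis vector_minus_component)
  ultimately show "l - l' \<in> L" unfolding period_lattice_eq by blast
qed

lemma D_algebraic_int: "algebraic_int D"
proof
  obtain n where n: "D\<^sup>2 = of_int n" using discrim_int D_square by (metis Ints_cases)
  show "lead_coeff [:- (D\<^sup>2), 0, 1:] = 1" "poly [:- (D\<^sup>2), 0, 1:] D = 0"
    by (simp_all add: power2_eq_square)
  show "\<forall>i. coeff [:- (D\<^sup>2), 0, 1:] i \<in> \<int>" by (auto simp: coeff_pCons n split: nat.splits)
qed

lemma algebraic_int_complex_iff:
  "algebraic_int a \<Longrightarrow> algebraic_int b \<Longrightarrow> algebraic_int (Complex a b)"
  unfolding Complex_eq
  by (intro algebraic_int_add algebraic_int_mult algebraic_int_ii algebraic_int_of_real) auto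

lemma lattice_contains_integral:
  assumes "a \<in> intvec" "b \<in> intvec"
  shows "Psi a b \<in> L"
proof -
  have V: "algebraic_int ((V *v a) $ j)" if "a \<in> intvec" for a j
    unfolding matrix_vector_mult_def vec_lambda_beta using that
    by (intro algebraic_int_sum algebraic_int_mult algebraic_int_V int_imp_algebraic_int) (simp add: intvec_def)
  have "algebraic_int (Psi a b $ 1)" unfolding Psi_nth
    using V[OF assms(1)] V[OF assms(2)]
    by (auto intro!: algebraic_int_complex_iff algebraic_int_mult D_algebraic_int)
  moreover have "a \<in> ratvec" "b \<in> ratvec"
    using assms Ints_subset_Rats by (auto simp: ratvec_def intvec_def)
  ultimately show ?thesis unfolding period_lattice_eq by blast
qed

lemma zero_in_lattice: "0 \<in> L"
proof -
  have "Psi 0 0 \<in> L" by (rule lattice_contains_integral) (simp_all add: intvec_def)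
  moreover have "Psi 0 0 = 0" by (simp add: Psi_def vec_eq_iff complex_eq_iff)
  ultimately show ?thesis by simp
qed

lemma lattice_add: "l \<in> L \<Longrightarrow> l' \<in> L \<Longrightarrow> l + l' \<in> L"
  using lattice_diff[OF _ lattice_diff[OF zero_in_lattice], of l l'] by simp

text \<open>Cramer's rule bounds the denominators of algebraic integers with respect to the powers of the generator.\<close>

lemma cramer_algebraic_int:
  assumes "\<And>j. algebraic_int (r * (V *v a) $ j)"
  shows "algebraic_int (r * det V * a $ k)"
proof -
  have "V *v (r *\<^sub>R a) = (\<chi> j. r * (V *v a) $ j)"
    by (simp add: vec_eq_iff matrix_vector_mult_scaleR)
  then have "r *\<^sub>R a = (\<chi> k. det (\<chi> i j. if j = k then (\<chi> j. r * (V *v a) $ j) $ i else V $ i $ j) / det V)"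
    using cramer[of V] det_V_pos by auto
  then have "(r *\<^sub>R a) $ k * det V = det (\<chi> i j. if j = k then r * (V *v a) $ i else V $ i $ j)"
    using det_V_pos by (simp cong: if_cong)
  also have "algebraic_int \<dots>"
    unfolding det_def
    by (intro algebraic_int_sum algebraic_int_mult algebraic_int_prod) (auto simp: assms algebraic_int_V)
  finally show ?thesis by (simp add: mult_ac)
qed

definition denom :: nat where "denom = nat (2 * m ^ 12 * \<lfloor>discrim x\<rfloor> * \<lfloor>discrim x\<rfloor>)"

lemma denom_eq: "real denom = 2 * of_nat m ^ 12 * discrim x * discrim x" and denom_pos: "denom > 0"
proof -
  have "discrim x > 0" unfolding discrim_def using D_pos by simp
  moreover obtain n where n: "discrim x = of_int n" using discrim_int by (metis Ints_cases)
  ultimately have "n > 0" by simp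
  then show "real denom = 2 * of_nat m ^ 12 * discrim x * discrim x" unfolding denom_def n by simp
  then have "real denom > 0" using m_pos \<open>discrim x > 0\<close> by simp
  then show "denom > 0" by simp
qed

text \<open>The real and imaginary parts of the conjugates of an algebraic integer \<open>l\<close> are, after multiplication by
  2 or by \<open>2 D\<close>, algebraic integers.  So Cramer's rule applies to both halves of the coordinates, and rational
  algebraic integers are integers.\<close>

lemma lattice_denominators:
  assumes "l \<in> L"
  obtains a b where "l = Psi a b" "\<And>k. real denom * a $ k \<in> \<int>" "\<And>k. real denom * b $ k \<in> \<int>"
proof -
  from assms obtain a b where l: "l = Psi a b" "a \<in> ratvec" "b \<in> ratvec" unfolding period_lattice_eq by blast
  have re: "algebraic_int (2 * (V *v a) $ j)" for j
  proof -
    have "complex_of_real (2 * (V *v a) $ j) = l $ j + cnj (l $ j)"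
      by (simp add: l(1) Psi_nth complex_eq_iff)
    moreover have "algebraic_int (l $ j + cnj (l $ j))"
      by (intro algebraic_int_add algebraic_int_cnj lattice_algebraic_int assms)
    ultimately show ?thesis by (metis algebraic_int_of_real_iff)
  qed
  have im: "algebraic_int ((2 * discrim x) * (V *v b) $ j)" for j
  proof -
    have "complex_of_real ((2 * discrim x) * (V *v b) $ j) =
        of_real (eps j) * of_real D * (- \<i>) * (l $ j - cnj (l $ j))"
      by (simp add: l(1) Psi_nth complex_eq_iff mult_ac flip: D_square power2_eq_square)
    moreover have "algebraic_int (of_real (eps j) * of_real D * (- \<i>) * (l $ j - cnj (l $ j)))"
      by (intro algebraic_int_mult algebraic_int_diff algebraic_int_minus algebraic_int_ii
          algebraic_int_cnj lattice_algebraic_int assms algebraic_int_of_real D_algebraic_int)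
        (auto simp: eps_def)
    ultimately show ?thesis by (metis algebraic_int_of_real_iff)
  qed
  have dV: "det V * det V = of_nat m ^ 12 * discrim x"
    by (simp add: det_V flip: D_square) (simp add: power_def algebra_simps)
  have disc: "algebraic_int (discrim x)" using discrim_int by (rule int_imp_algebraic_int)
  have detV: "algebraic_int (det V)"
    unfolding det_V by (intro algebraic_int_mult algebraic_int_power D_algebraic_int) auto
  have rat: "discrim x \<in> \<rat>" using discrim_int Ints_subset_Rats by auto
  have "real denom * a $ k \<in> \<int>" for k
  proof (rule rational_algebraic_int_is_int)
    have "algebraic_int (discrim x * (det V * (2 * det V * a $ k)))"
      by (intro algebraic_int_mult disc detV cramer_algebraic_int[where r = 2] re)
    also have "discrim x * (det V * (2 * det V * a $ k)) = 2 * discrim x * (det V * det V) * a $ k" by simp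
    finally show "algebraic_int (real denom * a $ k)" unfolding dV denom_eq by (simp add: mult_ac)
  qed (use l(2) in \<open>simp add: ratvec_def\<close>)
  moreover have "real denom * b $ k \<in> \<int>" for k
  proof (rule rational_algebraic_int_is_int)
    have "algebraic_int (det V * ((2 * discrim x) * det V * b $ k))"
      by (intro algebraic_int_mult[OF detV] cramer_algebraic_int im)
    also have "det V * ((2 * discrim x) * det V * b $ k) = 2 * discrim x * (det V * det V) * b $ k" by simp
    finally show "algebraic_int (real denom * b $ k)" unfolding dV denom_eq by (simp add: mult_ac)
  qed (use l(3) in \<open>simp add: ratvec_def\<close>)
  ultimately show thesis using that l(1) by blast
qed

end

section \<open>Alternating forms and exterior products\<close>

abbreviation swp :: "'a \<Rightarrow> 'a \<Rightarrow> 'a \<Rightarrow> 'a" where "swp \<equiv> Transposition.transpose"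

definition Alt :: "nat \<Rightarrow> form \<Rightarrow> form" where
  "Alt p f = (\<lambda>v. \<Sum>\<pi> | \<pi> permutes {..<p}. of_int (sign \<pi>) * f (\<lambda>i. v (\<pi> i)))"

lemma permutes_imp_permutation: "\<pi> permutes S \<Longrightarrow> finite S \<Longrightarrow> permutation \<pi>"
  using permutation_permutes by blast

lemma sign_permutes_compose:
  "\<pi> permutes S \<Longrightarrow> \<sigma> permutes T \<Longrightarrow> finite S \<Longrightarrow> finite T \<Longrightarrow> sign (\<pi> \<circ> \<sigma>) = sign \<pi> * sign \<sigma>"
  by (intro sign_compose permutes_imp_permutation)

lemma sum_permutations_compose_left:
  assumes "\<pi> permutes S"
  shows "(\<Sum>\<sigma> | \<sigma> permutes S. g (\<pi> \<circ> \<sigma>)) = (\<Sum>\<sigma> | \<sigma> permutes S. g \<sigma>)"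
  by (rule sum.reindex_bij_witness[of _ "\<lambda>\<sigma>. Hilbert_Choice.inv \<pi> \<circ> \<sigma>" "\<lambda>\<sigma>. \<pi> \<circ> \<sigma>"])
    (use assms in \<open>auto simp: permutes_inv_o intro: permutes_compose permutes_inv simp flip: comp_assoc\<close>)

text \<open>The antisymmetrisation in the left factor is absorbed by the sum over all permutations, since every
  permutation of the first \<open>p\<close> indices can be moved into the outer permutation.  Applied to an
  antisymmetrised product of 1-forms it expands iterated exterior products such as \<open>wedge4\<close>.\<close>

lemma wedge_Alt:
  "wedge p q (Alt p f) b v =
    (\<Sum>\<sigma> | \<sigma> permutes {..<p + q}. of_int (sign \<sigma>) * f (\<lambda>i. v (\<sigma> i)) * b (\<lambda>i. v (\<sigma> (p + i)))) / fact q"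
proof -
  define g where "g \<sigma> = of_int (sign \<sigma>) * f (\<lambda>i. v (\<sigma> i)) * b (\<lambda>i. v (\<sigma> (p + i)))" for \<sigma>
  define A where "A = {\<sigma>. \<sigma> permutes {..<p + q}}"
  have "(\<Sum>\<sigma>\<in>A. of_int (sign \<sigma>) * Alt p f (\<lambda>i. v (\<sigma> i)) * b (\<lambda>i. v (\<sigma> (p + i))))
      = (\<Sum>\<sigma>\<in>A. \<Sum>\<pi> | \<pi> permutes {..<p}. g (\<sigma> \<circ> \<pi>))"
  proof (rule sum.cong[OF refl])
    fix \<sigma> assume s: "\<sigma> \<in> A"
    have "of_int (sign \<sigma>) * (of_int (sign \<pi>) * f (\<lambda>i. v (\<sigma> (\<pi> i)))) * b (\<lambda>i. v (\<sigma> (p + i))) = g (\<sigma> \<circ> \<pi>)"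
      if "\<pi> permutes {..<p}" for \<pi>
    proof -
      have "sign (\<sigma> \<circ> \<pi>) = sign \<sigma> * sign \<pi>"
        by (rule sign_permutes_compose) (use that s A_def in auto)
      moreover have "\<pi> (p + i) = p + i" for i using that permutes_not_in[of \<pi> "{..<p}" "p + i"] by simp
      ultimately show ?thesis by (simp add: g_def)
    qed
    then show "of_int (sign \<sigma>) * Alt p f (\<lambda>i. v (\<sigma> i)) * b (\<lambda>i. v (\<sigma> (p + i)))
        = (\<Sum>\<pi> | \<pi> permutes {..<p}. g (\<sigma> \<circ> \<pi>))"
      unfolding Alt_def sum_distrib_left sum_distrib_right by (intro sum.cong) auto
  qed
  also have "\<dots> = (\<Sum>\<pi> | \<pi> permutes {..<p}. \<Sum>\<sigma>\<in>A. g (\<sigma> \<circ> \<pi>))" by (rule sum.swap)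
  also have "\<dots> = (\<Sum>\<pi> | \<pi> permutes {..<p}. \<Sum>\<sigma>\<in>A. g \<sigma>)"
  proof (rule sum.cong[OF refl])
    fix \<pi> assume "\<pi> \<in> {\<pi>. \<pi> permutes {..<p}}"
    then have "\<pi> permutes {..<p + q}" by (auto intro: permutes_subset)
    then show "(\<Sum>\<sigma>\<in>A. g (\<sigma> \<circ> \<pi>)) = (\<Sum>\<sigma>\<in>A. g \<sigma>)"
      unfolding A_def by (rule sum_permutations_compose_right[symmetric])
  qed
  also have "\<dots> = fact p * (\<Sum>\<sigma>\<in>A. g \<sigma>)" by (simp add: card_permutations[of "{..<p}" p])
  finally show ?thesis unfolding wedge_def A_def g_def by simp
qed

lemma Alt_1: "Alt 1 f = f"
proof -
  have "{\<pi>. \<pi> permutes {..<1::nat}} = {id}"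
    by (simp only: One_nat_def lessThan_Suc lessThan_0 permutes_sing singleton_conv)
  then show ?thesis by (simp add: Alt_def fun_eq_iff sign_id)
qed

lemma wedge_Alt_1: "wedge p 1 (Alt p f) b = Alt (p + 1) (\<lambda>v. f v * b (\<lambda>i. v (p + i)))"
  unfolding fun_eq_iff wedge_Alt by (simp add: Alt_def mult.assoc)

lemma wedge_1_1: "wedge 1 1 a b = Alt 2 (\<lambda>v. a v * b (\<lambda>i. v (1 + i)))"
  using wedge_Alt_1[of 1 a b] unfolding Alt_1 by (simp add: numeral_2_eq_2)

lemma wedge4_Alt:
  "wedge4 a b c e = Alt 4 (\<lambda>v. a v * b (\<lambda>i. v (1 + i)) * c (\<lambda>i. v (2 + i)) * e (\<lambda>i. v (3 + i)))"
  using wedge_Alt_1[of 2] wedge_Alt_1[of 3] unfolding wedge4_def wedge_1_1 by (simp add: numeral_eq_Suc)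

definition lin_prod :: "nat \<Rightarrow> (nat \<Rightarrow> complex^4 \<Rightarrow> complex) \<Rightarrow> form" where
  "lin_prod p \<alpha> = (\<lambda>v. \<Prod>k<p. \<alpha> k (v k))"

lemma Alt_permute:
  assumes "\<pi> permutes {..<p}"
  shows "Alt p f (\<lambda>i. v (\<pi> i)) = of_int (sign \<pi>) * Alt p f v"
proof -
  have "Alt p f (\<lambda>i. v (\<pi> i)) = (\<Sum>\<sigma> | \<sigma> permutes {..<p}. of_int (sign (Hilbert_Choice.inv \<pi> \<circ> (\<pi> \<circ> \<sigma>))) * f (\<lambda>i. v ((\<pi> \<circ> \<sigma>) i)))"
    unfolding Alt_def using assms by (simp flip: comp_assoc add: permutes_inv_o)
  also have "\<dots> = (\<Sum>\<sigma> | \<sigma> permutes {..<p}. of_int (sign (Hilbert_Choice.inv \<pi> \<circ> \<sigma>)) * f (\<lambda>i. v (\<sigma> i)))"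
    by (rule sum_permutations_compose_left[OF assms])
  also have "\<dots> = (\<Sum>\<sigma> | \<sigma> permutes {..<p}. of_int (sign \<pi>) * (of_int (sign \<sigma>) * f (\<lambda>i. v (\<sigma> i))))"
  proof (rule sum.cong[OF refl])
    fix \<sigma> assume "\<sigma> \<in> {\<sigma>. \<sigma> permutes {..<p}}"
    then have "sign (Hilbert_Choice.inv \<pi> \<circ> \<sigma>) = sign (Hilbert_Choice.inv \<pi>) * sign \<sigma>"
      using assms by (intro sign_permutes_compose[of _ "{..<p}" _ "{..<p}"]) (auto intro: permutes_inv)
    moreover have "sign (Hilbert_Choice.inv \<pi>) = sign \<pi>"
      using assms by (intro sign_inverse permutes_imp_permutation[of _ "{..<p}"]) auto
    ultimately show "of_int (sign (Hilbert_Choice.inv \<pi> \<circ> \<sigma>)) * f (\<lambda>i. v (\<sigma> i))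
        = of_int (sign \<pi>) * (of_int (sign \<sigma>) * f (\<lambda>i. v (\<sigma> i)))" by simp
  qed
  finally show ?thesis by (simp add: Alt_def sum_distrib_left)
qed

lemma alt_form_Alt_lin_prod:
  assumes "\<And>k. k < p \<Longrightarrow> linear (\<alpha> k)"
  shows "alt_form p (Alt p (lin_prod p \<alpha>))"
  unfolding alt_form_def
proof (intro conjI allI impI)
  fix u v :: "nat \<Rightarrow> complex^4" assume uv: "\<forall>i<p. u i = v i"
  have "lin_prod p \<alpha> (\<lambda>i. u (\<pi> i)) = lin_prod p \<alpha> (\<lambda>i. v (\<pi> i))" if "\<pi> permutes {..<p}" for \<pi>
    unfolding lin_prod_def using uv permutes_in_image[OF that] by (intro prod.cong) auto
  then show "Alt p (lin_prod p \<alpha>) u = Alt p (lin_prod p \<alpha>) v" unfolding Alt_def by (intro sum.cong) auto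
next
  fix v :: "nat \<Rightarrow> complex^4" and i assume i: "i < p"
  have "linear (\<lambda>w. of_int (sign \<pi>) * lin_prod p \<alpha> (\<lambda>k. (v(i := w)) (\<pi> k)))" if "\<pi> permutes {..<p}" for \<pi>
  proof -
    define k where "k = Hilbert_Choice.inv \<pi> i"
    have k: "\<pi> k = i" "k < p"
      using permutes_inverses[OF that] permutes_in_image[OF permutes_inv[OF that], of i] i by (simp_all add: k_def)
    have ne: "\<pi> l \<noteq> i" if "l \<noteq> k" for l
      using that k(1) permutes_inj[OF \<open>\<pi> permutes {..<p}\<close>] by (metis injD)
    have "lin_prod p \<alpha> (\<lambda>k. (v(i := w)) (\<pi> k)) = \<alpha> k w * (\<Prod>l\<in>{..<p} - {k}. \<alpha> l (v (\<pi> l)))" for w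
      unfolding lin_prod_def using k ne by (subst prod.remove[of _ k]) (auto intro!: prod.cong)
    moreover have "linear (\<lambda>w. of_int (sign \<pi>) * (\<alpha> k w * z))" for z
      using assms[OF k(2)] by (auto simp: linear_iff algebra_simps)
    ultimately show ?thesis by simp
  qed
  then show "linear (\<lambda>w. Alt p (lin_prod p \<alpha>) (v(i := w)))"
    unfolding Alt_def by (intro linear_compose_sum) auto
next
  fix v :: "nat \<Rightarrow> complex^4" and i j assume ij: "i < j \<and> j < p \<and> v i = v j"
  define \<tau> where "\<tau> = swp i j"
  have "\<tau> permutes {..<p}" unfolding \<tau>_def using ij by (intro permutes_swap_id) auto
  then have "Alt p (lin_prod p \<alpha>) (\<lambda>k. v (\<tau> k)) = of_int (sign \<tau>) * Alt p (lin_prod p \<alpha>) v" by (rule Alt_permute)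
  moreover have "(\<lambda>k. v (\<tau> k)) = v" unfolding \<tau>_def using ij by (auto simp: Transposition.transpose_def)
  moreover have "sign \<tau> = -1" unfolding \<tau>_def using ij by (simp add: sign_swap_id)
  ultimately show "Alt p (lin_prod p \<alpha>) v = 0" by simp
qed

lemma alt_form_cong: "alt_form p b \<Longrightarrow> (\<And>i. i < p \<Longrightarrow> u i = v i) \<Longrightarrow> b u = b v"
  unfolding alt_form_def by blast

lemma alt_form_linear: "alt_form p b \<Longrightarrow> i < p \<Longrightarrow> linear (\<lambda>w. b (v(i := w)))"
  unfolding alt_form_def by blast

lemma alt_form_zero: "alt_form p b \<Longrightarrow> i < j \<Longrightarrow> j < p \<Longrightarrow> v i = v j \<Longrightarrow> b v = 0"
  unfolding alt_form_def by blast

lemma alt_formI: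
  assumes "\<And>u v. (\<And>i. i < p \<Longrightarrow> u i = v i) \<Longrightarrow> b u = b v"
    and "\<And>v i. i < p \<Longrightarrow> linear (\<lambda>w. b (v(i := w)))"
    and "\<And>v i j. i < j \<Longrightarrow> j < p \<Longrightarrow> v i = v j \<Longrightarrow> b v = 0"
  shows "alt_form p b"
  unfolding alt_form_def by (intro conjI allI impI; (elim conjE)?; rule assms; assumption?; blast)

lemma alt_form_add:
  assumes "alt_form p a" "alt_form p b"
  shows "alt_form p (\<lambda>v. a v + b v)"
proof (rule alt_formI)
  fix u v :: "nat \<Rightarrow> complex^4" assume "\<And>i. i < p \<Longrightarrow> u i = v i"
  then show "a u + b u = a v + b v" using alt_form_cong[OF assms(1)] alt_form_cong[OF assms(2)] by metis
next
  fix v :: "nat \<Rightarrow> complex^4" and i assume "i < p"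
  then show "linear (\<lambda>w. a (v(i := w)) + b (v(i := w)))"
    by (intro linear_compose_add alt_form_linear[OF assms(1)] alt_form_linear[OF assms(2)])
next
  fix v :: "nat \<Rightarrow> complex^4" and i j assume "i < j" "j < p" "v i = v j"
  then show "a v + b v = 0" using alt_form_zero[OF assms(1)] alt_form_zero[OF assms(2)] by simp
qed

lemma alt_form_cmult: "alt_form p a \<Longrightarrow> alt_form p (\<lambda>v. z * a v)"
  unfolding alt_form_def by (auto simp: linear_iff algebra_simps)

lemma alt_form_swap:
  assumes b: "alt_form p b" and ij: "i < p" "j < p" "i \<noteq> j"
  shows "b (\<lambda>k. v (swp i j k)) = - b v"
proof -
  define B where "B s t = b (v(i := s, j := t))" for s t
  have lin: "linear (\<lambda>w. b (u(i := w)))" if "i < p" for u i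
    using b that unfolding alt_form_def by blast
  have zero: "b u = 0" if "u i = u j" for u
    using alt_form_zero[OF b, of i j u] alt_form_zero[OF b, of j i u] ij that by (cases "i < j") auto
  have B1: "B (s + s') t = B s t + B s' t" for s s' t
    using linear_add[OF lin[OF ij(1), of "v(j := t)"]] ij(3) by (simp add: B_def fun_upd_twist)
  have B2: "B s (t + t') = B s t + B s t'" for s t t'
    using linear_add[OF lin[OF ij(2), of "v(i := s)"]] by (simp add: B_def)
  have B0: "B s s = 0" for s using zero ij(3) by (simp add: B_def)
  have "B (v i + v j) (v i + v j) = 0" by (rule B0)
  moreover have "B (v i + v j) (v i + v j) = B (v i) (v i) + B (v j) (v i) + (B (v i) (v j) + B (v j) (v j))"
    by (simp only: B1 B2)
  ultimately have "B (v i) (v j) + B (v j) (v i) = 0" by (simp add: B0 add.commute)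
  moreover have "B (v i) (v j) = b v" by (simp add: B_def)
  moreover have "(\<lambda>k. v (swp i j k)) = v(i := v j, j := v i)"
    using ij(3) by (auto simp: Transposition.transpose_def)
  then have "B (v j) (v i) = b (\<lambda>k. v (swp i j k))" by (simp add: B_def)
  ultimately show ?thesis by (simp add: eq_neg_iff_add_eq_0 add.commute)
qed


text \<open>Exchanges \<open>k\<close> and \<open>n + k\<close> for all \<open>k\<close> in \<open>K\<close>.\<close>

definition flip :: "nat \<Rightarrow> nat set \<Rightarrow> nat \<Rightarrow> nat" where
  "flip n K i = (if i < n then if i \<in> K then n + i else i
                 else if i < n + n \<and> i - n \<in> K then i - n else i)"

lemma flip_flip: "flip n K (flip n K i) = i"
  by (auto simp: flip_def)

lemma flip_comp: "flip n K \<circ> flip n K = id"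
  by (simp add: fun_eq_iff flip_flip)

lemma flip_permutes: "flip n K permutes {..<n + n}"
proof (rule bij_imp_permutes)
  show "bij_betw (flip n K) {..<n + n} {..<n + n}"
    by (rule bij_betw_byWitness[of _ "flip n K"]) (auto simp: flip_def)
  show "\<And>i. i \<notin> {..<n + n} \<Longrightarrow> flip n K i = i" by (auto simp: flip_def)
qed

lemma sign_flip:
  assumes "K \<subseteq> {..<n}"
  shows "sign (flip n K) = (-1) ^ card K"
proof -
  have "finite K" using assms finite_subset by blast
  then show ?thesis using assms
  proof (induction K rule: finite_induct)
    case empty
    have "flip n {} = id" by (auto simp: flip_def)
    then show ?case by (simp add: sign_id)
  next
    case (insert k K)
    have "flip n (insert k K) = swp k (n + k) \<circ> flip n K"
      using insert.hyps insert.prems by (auto simp: fun_eq_iff flip_def Transposition.transpose_def)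
    moreover have "sign (swp k (n + k) \<circ> flip n K) = sign (swp k (n + k)) * sign (flip n K)"
      using insert by (intro sign_permutes_compose[of _ "{..<n + n}" _ "{..<n + n}"] permutes_swap_id flip_permutes) auto
    ultimately have "sign (flip n (insert k K)) = sign (swp k (n + k)) * sign (flip n K)" by metis
    then show ?case using insert by (simp add: sign_swap_id)
  qed
qed

lemma alt_form_permute_shifted:
  assumes b: "alt_form n b" and "\<rho> permutes {n..<n + n}"
  shows "b (\<lambda>i. v (\<rho> (n + i))) = of_int (sign \<rho>) * b (\<lambda>i. v (n + i))"
  using assms(2) finite_atLeastLessThan
proof (induction arbitrary: v rule: permutes_induct)
  case id
  then show ?case by (simp add: sign_id)
next
  case (swap i j \<rho>)
  define i' j' where "i' = i - n" and "j' = j - n"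
  have ij: "i = n + i'" "j = n + j'" "i' < n" "j' < n" "i' \<noteq> j'"
    using swap.hyps by (auto simp: i'_def j'_def)
  have t: "swp i j (n + k) = n + swp i' j' k" for k
    using ij by (simp add: Transposition.transpose_def)
  have "b (\<lambda>k. v ((swp i j \<circ> \<rho>) (n + k))) = of_int (sign \<rho>) * b (\<lambda>k. v (swp i j (n + k)))"
    using swap.IH[of "\<lambda>k. v (swp i j k)"] by simp
  also have "b (\<lambda>k. v (swp i j (n + k))) = - b (\<lambda>k. v (n + k))"
    unfolding t using alt_form_swap[OF b ij(3-5), of "\<lambda>k. v (n + k)"] by simp
  also have "sign (swp i j \<circ> \<rho>) = - sign \<rho>"
    using swap.hyps by (subst sign_permutes_compose[of _ "{n..<n + n}" _ "{n..<n + n}"]) (auto intro: permutes_swap_id simp: sign_swap_id)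
  then have "of_int (sign \<rho>) * - b (\<lambda>k. v (n + k)) = of_int (sign (swp i j \<circ> \<rho>)) * b (\<lambda>k. v (n + k))" by simp
  finally show ?case .
qed

text \<open>If \<open>\<alpha> k\<close> vanishes on all vectors of the frame except number \<open>k\<close> and number \<open>n + k\<close>, then a permutation
  contributes only if it chooses one of these two for each \<open>k\<close>.  Such a permutation is the product of \<open>flip n K\<close>, where
  \<open>K\<close> records the choices, and a permutation of the last \<open>n\<close> indices, which the alternating form \<open>b\<close>
  turns into its sign.\<close>

lemma sum_transversal_permutations:
  fixes u :: "nat \<Rightarrow> complex^4"
  assumes b: "alt_form n b"
    and zero: "\<And>k j. k < n \<Longrightarrow> j < n + n \<Longrightarrow> j \<noteq> k \<Longrightarrow> j \<noteq> n + k \<Longrightarrow> \<alpha> k (u j) = 0"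
  shows "(\<Sum>\<sigma> | \<sigma> permutes {..<n + n}. of_int (sign \<sigma>) * lin_prod n \<alpha> (\<lambda>i. u (\<sigma> i)) * b (\<lambda>i. u (\<sigma> (n + i))))
    = fact n * (\<Sum>K\<in>Pow {..<n}. (-1) ^ card K * (\<Prod>k<n. \<alpha> k (u (if k \<in> K then n + k else k)))
                  * b (\<lambda>i. u (if i \<in> K then i else n + i)))"
    (is "sum ?G _ = _")
proof -
  define S where "S = {\<sigma>. \<sigma> permutes {..<n + n}}"
  define S' where "S' = {\<sigma> \<in> S. \<forall>k<n. \<sigma> k = k \<or> \<sigma> k = n + k}"
  define R where "R = {\<rho>. \<rho> permutes {n..<n + n}}"
  have R_sub: "\<rho> permutes {..<n + n}" if "\<rho> \<in> R" for \<rho>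
    using that unfolding R_def by (auto intro: permutes_subset)
  have R_fix: "\<rho> k = k" if "\<rho> \<in> R" "k < n" for \<rho> k
    using that permutes_not_in[of \<rho> "{n..<n + n}" k] unfolding R_def by auto
  have "sum ?G S = sum ?G S'"
  proof (rule sum.mono_neutral_right)
    show "finite S" unfolding S_def by (simp add: finite_permutations)
    show "\<forall>\<sigma>\<in>S - S'. ?G \<sigma> = 0"
    proof
      fix \<sigma> assume s: "\<sigma> \<in> S - S'"
      then obtain k where k: "k < n" "\<sigma> k \<noteq> k" "\<sigma> k \<noteq> n + k" unfolding S'_def by auto
      have "\<sigma> k < n + n" using s k permutes_in_image[of \<sigma> "{..<n + n}" k] unfolding S_def by auto
      then have "\<alpha> k (u (\<sigma> k)) = 0" using zero k by blast
      then show "?G \<sigma> = 0" unfolding lin_prod_def using k(1) by auto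
    qed
  qed (auto simp: S'_def)
  also have "\<dots> = (\<Sum>(K, \<rho>)\<in>Pow {..<n} \<times> R. ?G (flip n K \<circ> \<rho>))"
  proof (rule sum.reindex_bij_witness[of _ "\<lambda>(K, \<rho>). flip n K \<circ> \<rho>"
        "\<lambda>\<sigma>. ({k. k < n \<and> \<sigma> k = n + k}, flip n {k. k < n \<and> \<sigma> k = n + k} \<circ> \<sigma>)"])
    fix \<sigma> assume s: "\<sigma> \<in> S'"
    let ?K = "{k. k < n \<and> \<sigma> k = n + k}"
    show "(case (?K, flip n ?K \<circ> \<sigma>) of (K, \<rho>) \<Rightarrow> flip n K \<circ> \<rho>) = \<sigma>"
      by (simp add: fun_eq_iff flip_flip)
    have "flip n ?K \<circ> \<sigma> permutes {..<n + n}"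
      using s unfolding S'_def S_def by (auto intro: permutes_compose flip_permutes)
    moreover have "(flip n ?K \<circ> \<sigma>) k = k" if "k \<in> {..<n + n} - {n..<n + n}" for k
    proof -
      have k: "k < n" using that by auto
      moreover have "\<sigma> k = k \<or> \<sigma> k = n + k" using s k unfolding S'_def by blast
      ultimately show ?thesis by (elim disjE) (simp_all add: flip_def)
    qed
    ultimately show "(?K, flip n ?K \<circ> \<sigma>) \<in> Pow {..<n} \<times> R"
      unfolding R_def by (auto intro: permutes_superset)
    show "(case (?K, flip n ?K \<circ> \<sigma>) of (K, \<rho>) \<Rightarrow> ?G (flip n K \<circ> \<rho>)) = ?G \<sigma>"
      by (simp add: flip_flip flip: comp_assoc add: flip_comp)
  next
    fix p assume "p \<in> Pow {..<n} \<times> R"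
    then obtain K \<rho> where p: "p = (K, \<rho>)" "K \<subseteq> {..<n}" "\<rho> \<in> R" by auto
    have "{k. k < n \<and> (flip n K \<circ> \<rho>) k = n + k} = K"
      using p R_fix[OF p(3)] by (auto simp: flip_def split: if_splits)
    then show "({k. k < n \<and> (case p of (K, \<rho>) \<Rightarrow> flip n K \<circ> \<rho>) k = n + k},
        flip n {k. k < n \<and> (case p of (K, \<rho>) \<Rightarrow> flip n K \<circ> \<rho>) k = n + k} \<circ> (case p of (K, \<rho>) \<Rightarrow> flip n K \<circ> \<rho>)) = p"
      by (simp add: p(1) fun_eq_iff flip_flip)
    show "(case p of (K, \<rho>) \<Rightarrow> flip n K \<circ> \<rho>) \<in> S'"
      using permutes_compose[OF R_sub[OF p(3)] flip_permutes[of n K]] R_fix[OF p(3)]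
      by (auto simp: p(1) S'_def S_def flip_def)
  qed
  also have "\<dots> = (\<Sum>K\<in>Pow {..<n}. \<Sum>\<rho>\<in>R. ?G (flip n K \<circ> \<rho>))"
    by (simp add: sum.cartesian_product)
  also have "\<dots> = (\<Sum>K\<in>Pow {..<n}. \<Sum>\<rho>\<in>R. (-1) ^ card K * (\<Prod>k<n. \<alpha> k (u (if k \<in> K then n + k else k)))
                  * b (\<lambda>i. u (if i \<in> K then i else n + i)))"
  proof (intro sum.cong refl)
    fix K \<rho> assume K: "K \<in> Pow {..<n}" and r: "\<rho> \<in> R"
    have "lin_prod n \<alpha> (\<lambda>i. u ((flip n K \<circ> \<rho>) i)) = (\<Prod>k<n. \<alpha> k (u (if k \<in> K then n + k else k)))"
      unfolding lin_prod_def using R_fix[OF r] by (intro prod.cong) (auto simp: flip_def)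
    moreover have "b (\<lambda>i. u ((flip n K \<circ> \<rho>) (n + i))) = of_int (sign \<rho>) * b (\<lambda>i. u (flip n K (n + i)))"
      using alt_form_permute_shifted[OF b, of \<rho> "\<lambda>i. u (flip n K i)"] r unfolding R_def by simp
    moreover have "b (\<lambda>i. u (flip n K (n + i))) = b (\<lambda>i. u (if i \<in> K then i else n + i))"
      using K by (intro alt_form_cong[OF b]) (auto simp: flip_def)
    moreover have "of_int (sign (flip n K \<circ> \<rho>)) = (-1) ^ card K * (of_int (sign \<rho>) :: complex)"
      using sign_permutes_compose[OF flip_permutes R_sub[OF r]] sign_flip[of K n] K by simp
    moreover have "of_int (sign \<rho>) * (of_int (sign \<rho>) :: complex) = 1"
      by (simp flip: of_int_mult)
    then have "x * of_int (sign \<rho>) * y * (of_int (sign \<rho>) * z) = x * y * z" for x y z :: complex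
      by (metis (no_types, lifting) mult.assoc mult.commute mult.right_neutral)
    ultimately show "?G (flip n K \<circ> \<rho>) = (-1) ^ card K * (\<Prod>k<n. \<alpha> k (u (if k \<in> K then n + k else k)))
                  * b (\<lambda>i. u (if i \<in> K then i else n + i))" by simp
  qed
  also have "\<dots> = fact n * (\<Sum>K\<in>Pow {..<n}. (-1) ^ card K * (\<Prod>k<n. \<alpha> k (u (if k \<in> K then n + k else k)))
                  * b (\<lambda>i. u (if i \<in> K then i else n + i)))"
    unfolding R_def by (simp add: card_permutations[of _ n] sum_distrib_left)
  finally show ?thesis unfolding S_def .
qed

lemma wedge_permute:
  assumes "\<pi> permutes {..<p + q}"
  shows "wedge p q a b (\<lambda>i. v (\<pi> i)) = of_int (sign \<pi>) * wedge p q a b v"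
proof -
  define f where "f v = a v * b (\<lambda>i. v (p + i))" for v
  have w: "wedge p q a b v = Alt (p + q) f v / (fact p * fact q)" for v
    unfolding wedge_def Alt_def f_def by (simp add: mult.assoc)
  show ?thesis unfolding w using Alt_permute[OF assms] by simp
qed

definition idx :: "nat \<Rightarrow> 4" where "idx k = of_nat (k + 1)"

lemma idx_simps [simp]: "idx 0 = 1" "idx (Suc 0) = 2" "idx 1 = 2" "idx 2 = 3" "idx 3 = 4"
  by (simp_all add: idx_def)

lemma less_4_cases: "k < (4::nat) \<Longrightarrow> k = 0 \<or> k = 1 \<or> k = 2 \<or> k = 3"
  by linarith

lemma idx_eq_iff:
  assumes "j < 4" "k < 4"
  shows "idx j = idx k \<longleftrightarrow> j = k"
  using less_4_cases[OF assms(1)] less_4_cases[OF assms(2)] by (elim disjE) simp_all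

text \<open>The standard frame consists of the vectors \<open>ef k\<close> and \<open>jf k = \<i> \<cdot> ef k\<close>.\<close>

definition ef :: "nat \<Rightarrow> complex^4" where "ef k = axis (idx k) 1"
definition jf :: "nat \<Rightarrow> complex^4" where "jf k = axis (idx k) \<i>"

lemma ef_nth: "j < 4 \<Longrightarrow> k < 4 \<Longrightarrow> ef k $ idx j = (if j = k then 1 else 0)"
  and jf_nth: "j < 4 \<Longrightarrow> k < 4 \<Longrightarrow> jf k $ idx j = (if j = k then \<i> else 0)"
  by (auto simp: ef_def jf_def axis_def idx_eq_iff)

text \<open>The permutation of the standard frame \<open>e\<^sub>1, \<i> e\<^sub>1, \<dots>, e\<^sub>4, \<i> e\<^sub>4\<close> that lists all \<open>e\<^sub>k\<close> first.  It is a product of two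
  3-cycles, hence even.\<close>

definition riffle :: "nat \<Rightarrow> nat" where
  "riffle = (swp 1 2 \<circ> swp 2 4) \<circ> (swp 3 6 \<circ> swp 6 5)"

lemma riffle_permutes: "riffle permutes {..<4 + 4}"
  unfolding riffle_def by (intro permutes_compose permutes_swap_id) auto

lemma sign_riffle: "sign riffle = 1"
  unfolding riffle_def
  by (simp add: sign_compose permutation_compose permutation_swap_id sign_swap_id)

lemma std_frame_riffle:
  assumes "k < 4"
  shows "std_frame (riffle k) = ef k" "std_frame (riffle (4 + k)) = jf k"
  using less_4_cases[OF assms]
  by (elim disjE; simp add: riffle_def Transposition.transpose_def std_frame_def ef_def jf_def idx_def)+

text \<open>After the reordering by \<open>riffle\<close> the frame is \<open>ef 0, \<dots>, ef 3, jf 0, \<dots>, jf 3\<close>, and \<open>\<alpha> k\<close> vanishes on all of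
  these vectors except \<open>ef k\<close> and \<open>jf k\<close>.\<close>

lemma wedge_std_frame:
  assumes b: "alt_form 4 b"
    and zero: "\<And>k j z. k < 4 \<Longrightarrow> j < 4 \<Longrightarrow> j \<noteq> k \<Longrightarrow> \<alpha> k (axis (idx j) z) = 0"
  shows "wedge 4 4 (Alt 4 (lin_prod 4 \<alpha>)) b std_frame
    = (\<Sum>K\<in>Pow {..<4}. (-1) ^ card K * (\<Prod>k<4. \<alpha> k (if k \<in> K then jf k else ef k))
         * b (\<lambda>k. if k \<in> K then ef k else jf k))"
proof -
  define u where "u k = (if k < 4 then ef k else jf (k - 4))" for k
  have ru: "std_frame (riffle k) = u k" if "k < 8" for k
    using that std_frame_riffle(1)[of k] std_frame_riffle(2)[of "k - 4"] by (auto simp: u_def)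
  have "wedge 4 4 (Alt 4 (lin_prod 4 \<alpha>)) b std_frame = wedge 4 4 (Alt 4 (lin_prod 4 \<alpha>)) b (\<lambda>i. std_frame (riffle i))"
    using wedge_permute[OF riffle_permutes] sign_riffle by simp
  also have "\<dots> = (\<Sum>\<sigma> | \<sigma> permutes {..<4 + 4}. of_int (sign \<sigma>) * lin_prod 4 \<alpha> (\<lambda>i. u (\<sigma> i)) * b (\<lambda>i. u (\<sigma> (4 + i)))) / fact 4"
    unfolding wedge_Alt
  proof (intro arg_cong2[of _ _ _ _ "(/)"] sum.cong refl)
    fix \<sigma> :: "nat \<Rightarrow> nat" assume "\<sigma> \<in> {\<sigma>. \<sigma> permutes {..<4 + 4}}"
    then have s: "\<sigma> k < 8" if "k < 8" for k using that permutes_in_image[of \<sigma> "{..<4 + 4}" k] by auto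
    have "lin_prod 4 \<alpha> (\<lambda>i. std_frame (riffle (\<sigma> i))) = lin_prod 4 \<alpha> (\<lambda>i. u (\<sigma> i))"
      unfolding lin_prod_def using s by (intro prod.cong) (auto simp: ru)
    moreover have "b (\<lambda>i. std_frame (riffle (\<sigma> (4 + i)))) = b (\<lambda>i. u (\<sigma> (4 + i)))"
      using s by (intro alt_form_cong[OF b]) (auto simp: ru)
    ultimately show "of_int (sign \<sigma>) * lin_prod 4 \<alpha> (\<lambda>i. std_frame (riffle (\<sigma> i))) * b (\<lambda>i. std_frame (riffle (\<sigma> (4 + i))))
      = of_int (sign \<sigma>) * lin_prod 4 \<alpha> (\<lambda>i. u (\<sigma> i)) * b (\<lambda>i. u (\<sigma> (4 + i)))" by simp
  qed
  also have "\<dots> = (\<Sum>K\<in>Pow {..<4}. (-1) ^ card K * (\<Prod>k<4. \<alpha> k (u (if k \<in> K then 4 + k else k)))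
                  * b (\<lambda>i. u (if i \<in> K then i else 4 + i)))"
  proof (subst sum_transversal_permutations[OF b])
    fix k j :: nat assume "k < 4" "j < 4 + 4" "j \<noteq> k" "j \<noteq> 4 + k"
    then show "\<alpha> k (u j) = 0"
      using zero[of k j] zero[of k "j - 4"] by (cases "j < 4") (auto simp: u_def ef_def jf_def)
  qed simp
  also have "\<dots> = (\<Sum>K\<in>Pow {..<4}. (-1) ^ card K * (\<Prod>k<4. \<alpha> k (if k \<in> K then jf k else ef k))
         * b (\<lambda>k. if k \<in> K then ef k else jf k))"
  proof (intro sum.cong refl arg_cong2[of _ _ _ _ "(*)"])
    fix K :: "nat set"
    show "(\<Prod>k<4. \<alpha> k (u (if k \<in> K then 4 + k else k))) = (\<Prod>k<4. \<alpha> k (if k \<in> K then jf k else ef k))"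
      by (intro prod.cong) (auto simp: u_def)
    show "b (\<lambda>i. u (if i \<in> K then i else 4 + i)) = b (\<lambda>k. if k \<in> K then ef k else jf k)"
      by (intro alt_form_cong[OF b]) (auto simp: u_def)
  qed
  finally show ?thesis .
qed

text \<open>Multilinear expansion of \<open>b\<close> at vectors that are sums of two terms; \<open>K\<close> is the set of places where the second term
  is chosen.\<close>

lemma alt_form_expand:
  assumes b: "alt_form n b"
  shows "b (\<lambda>k. r k *\<^sub>R f k + s k *\<^sub>R g k)
    = (\<Sum>K\<in>Pow {..<n}. of_real (\<Prod>k<n. if k \<in> K then s k else r k) * b (\<lambda>k. if k \<in> K then g k else f k))"
proof -
  define h where "h k = r k *\<^sub>R f k + s k *\<^sub>R g k" for k
  have "b h = (\<Sum>K\<in>Pow {..<l}. of_real (\<Prod>k<l. if k \<in> K then s k else r k)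
            * b (\<lambda>k. if k < l then if k \<in> K then g k else f k else h k))" if "l \<le> n" for l
    using that
  proof (induction l)
    case 0
    then show ?case by simp
  next
    case (Suc l)
    have step: "b (\<lambda>k. if k < l then if k \<in> K then g k else f k else h k)
        = of_real (r l) * b (\<lambda>k. if k < Suc l then if k \<in> K then g k else f k else h k)
        + of_real (s l) * b (\<lambda>k. if k < Suc l then if k \<in> insert l K then g k else f k else h k)"
      if K: "K \<subseteq> {..<l}" for K
    proof -
      define v where "v = (\<lambda>k. if k < l then if k \<in> K then g k else f k else h k)"
      have lin: "linear (\<lambda>w. b (v(l := w)))" using Suc by (intro alt_form_linear[OF b]) simp
      have "b v = b (v(l := h l))" by (rule arg_cong[of _ _ b]) (auto simp: v_def)
      also have "\<dots> = r l *\<^sub>R b (v(l := f l)) + s l *\<^sub>R b (v(l := g l))"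
        unfolding h_def linear_add[OF lin] linear_scale[OF lin] ..
      also have "v(l := f l) = (\<lambda>k. if k < Suc l then if k \<in> K then g k else f k else h k)"
        using K by (auto simp: v_def fun_eq_iff less_Suc_eq)
      also have "v(l := g l) = (\<lambda>k. if k < Suc l then if k \<in> insert l K then g k else f k else h k)"
        using K by (auto simp: v_def fun_eq_iff less_Suc_eq)
      finally show ?thesis unfolding v_def by (simp add: scaleR_conv_of_real)
    qed
    define F where "F l K = of_real (\<Prod>k<l. if k \<in> K then s k else r k)
            * b (\<lambda>k. if k < l then if k \<in> K then g k else f k else h k)" for l K
    have split: "Pow {..<Suc l} = Pow {..<l} \<union> insert l ` Pow {..<l}"
      by (simp add: lessThan_Suc Pow_insert)
    have inj: "inj_on (insert l) (Pow {..<l})" 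
    proof (rule inj_onI)
      fix A B assume "A \<in> Pow {..<l}" "B \<in> Pow {..<l}" "insert l A = insert l B"
      moreover from this have "l \<notin> A" "l \<notin> B" by auto
      ultimately show "A = B" by (simp add: insert_ident)
    qed
    have "(\<Sum>K\<in>Pow {..<Suc l}. F (Suc l) K) = (\<Sum>K\<in>Pow {..<l}. F (Suc l) K) + (\<Sum>K\<in>insert l ` Pow {..<l}. F (Suc l) K)"
      unfolding split by (rule sum.union_disjoint) auto
    also have "(\<Sum>K\<in>insert l ` Pow {..<l}. F (Suc l) K) = (\<Sum>K\<in>Pow {..<l}. F (Suc l) (insert l K))"
      by (simp add: sum.reindex[OF inj])
    also have "(\<Sum>K\<in>Pow {..<l}. F (Suc l) K) + (\<Sum>K\<in>Pow {..<l}. F (Suc l) (insert l K))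
        = (\<Sum>K\<in>Pow {..<l}. F l K)"
      unfolding sum.distrib[symmetric]
    proof (rule sum.cong[OF refl])
      fix K assume K: "K \<in> Pow {..<l}"
      have l: "l \<notin> K" using K by auto
      then have p1: "(\<Prod>k<Suc l. if k \<in> K then s k else r k) = (\<Prod>k<l. if k \<in> K then s k else r k) * r l"
        by simp
      have p2: "(\<Prod>k<Suc l. if k \<in> insert l K then s k else r k) = (\<Prod>k<l. if k \<in> K then s k else r k) * s l"
        using l by (auto intro!: prod.cong)
      have "K \<subseteq> {..<l}" using K by simp
      from step[OF this] show "F (Suc l) K + F (Suc l) (insert l K) = F l K"
        unfolding F_def p1 p2 by (simp only: of_real_mult distrib_left mult.assoc)
    qed
    finally show ?case using Suc unfolding F_def by simp
  qed
  from this[of n] show ?thesis unfolding h_def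
    by (auto intro!: sum.cong alt_form_cong[OF b])
qed

section \<open>A fundamental domain of rational volume\<close>

text \<open>An additive group of rational numbers with bounded denominators is cyclic; its least positive
  element is the reciprocal of an integer because the group contains 1.\<close>

lemma rational_subgroup_cyclic:
  fixes P :: "real set"
  assumes zero: "0 \<in> P" and diff: "\<And>a b. a \<in> P \<Longrightarrow> b \<in> P \<Longrightarrow> a - b \<in> P" and one: "1 \<in> P"
    and d: "d > 0" "\<And>a. a \<in> P \<Longrightarrow> real d * a \<in> \<int>"
  shows "\<exists>e>0. P = {of_int k / real e |k. True}"
proof -
  have neg: "- a \<in> P" if "a \<in> P" for a using diff[OF zero that] by simp
  have add: "a + b \<in> P" if "a \<in> P" "b \<in> P" for a b using diff[OF that(1) neg[OF that(2)]] by simp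
  have nat_mult: "of_nat n * a \<in> P" if "a \<in> P" for a n
    by (induction n) (use zero add that in \<open>auto simp: distrib_right\<close>)
  have int_mult: "of_int k * a \<in> P" if "a \<in> P" for a k
    using nat_mult[OF that, of "nat k"] neg[OF nat_mult[OF that, of "nat (- k)"]]
    by (cases "k \<ge> 0") auto
  define n where "n = (LEAST n. n > 0 \<and> of_nat n / real d \<in> P)"
  have "d > 0 \<and> of_nat d / real d \<in> P" using d one by simp
  then have n: "n > 0" "of_nat n / real d \<in> P" and min: "\<And>k. k > 0 \<Longrightarrow> of_nat k / real d \<in> P \<Longrightarrow> n \<le> k"
    unfolding n_def by (metis (mono_tags, lifting) LeastI, metis (mono_tags, lifting) LeastI, metis (mono_tags, lifting) Least_le)
  have dvd: "int n dvd k" if k: "of_int k / real d \<in> P" for k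
  proof (rule ccontr)
    assume "\<not> int n dvd k"
    then have r: "k mod int n > 0" "k mod int n < int n"
      using n(1) by (simp_all add: dvd_eq_mod_eq_0 order.not_eq_order_implies_strict)
    have "of_int k / real d - of_int (k div int n) * (of_nat n / real d) \<in> P"
      by (intro diff int_mult n k)
    also have "of_int k / real d - of_int (k div int n) * (of_nat n / real d) = of_int (k - k div int n * int n) / real d"
      by (simp add: diff_divide_distrib)
    also have "k - k div int n * int n = k mod int n" by (simp add: minus_div_mult_eq_mod)
    also have "real_of_int (k mod int n) = of_nat (nat (k mod int n))" using r by simp
    finally have "n \<le> nat (k mod int n)" using min r(1) by auto
    then show False using r by linarith
  qed
  have "of_int (int d) / real d \<in> P" using d one by simp
  then have "int n dvd int d" by (rule dvd)
  then obtain e where e: "d = n * e" by auto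
  then have e0: "e > 0" using d(1) by (cases e) auto
  have nd: "of_nat n / real d = 1 / real e" using n(1) e e0 by (simp add: field_simps)
  have "P = {of_int k / real e |k. True}"
  proof (intro subset_antisym subsetI)
    fix a assume a: "a \<in> P"
    then obtain k where k: "real d * a = of_int k" using d(2) by (metis Ints_cases)
    then have ak: "a = of_int k / real d" using d(1) by (simp add: field_simps)
    then obtain l where "k = int n * l" using dvd[of k] a by (auto elim: dvdE)
    then have "a = of_int l * (of_nat n / real d)" unfolding ak by simp
    then have "a = of_int l / real e" unfolding nd by simp
    then show "a \<in> {of_int k / real e |k. True}" by blast
  next
    fix a assume "a \<in> {of_int k / real e |k. True}"
    then obtain k where "a = of_int k / real e" by blast
    then have "a = of_int k * (of_nat n / real d)" unfolding nd by simp
    then show "a \<in> P" using int_mult[OF n(2)] by simp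
  qed
  then show ?thesis using e0 by blast
qed

text \<open>A lattice between \<open>\<int>\<^sup>n\<close> and \<open>(1/d) \<int>\<^sup>n\<close> has a box with rational sides as a fundamental domain.  The last coordinates of
  its elements form the group \<open>(1/e) \<int>\<close> for some \<open>e\<close>, so a vector can be moved in exactly one way to the strip where
  the last coordinate is in \<open>[0, 1/e)\<close>, up to the elements of the lattice whose last coordinate vanishes; these form
  a lattice of the same kind in one dimension less.\<close>

lemma box_transversal:
  fixes G :: "(nat \<Rightarrow> real) set"
  assumes "(\<lambda>_. 0) \<in> G" and "\<And>g h. g \<in> G \<Longrightarrow> h \<in> G \<Longrightarrow> (\<lambda>i. g i - h i) \<in> G"
    and "\<And>g i. g \<in> G \<Longrightarrow> i \<ge> n \<Longrightarrow> g i = 0"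
    and "\<And>i. i < n \<Longrightarrow> (\<lambda>j. if j = i then 1 else 0) \<in> G"
    and "d > 0" and "\<And>g i. g \<in> G \<Longrightarrow> real d * g i \<in> \<int>"
  shows "\<exists>e :: nat \<Rightarrow> nat. (\<forall>i. e i > 0) \<and>
    (\<forall>v. \<exists>!g. g \<in> G \<and> (\<forall>i<n. 0 \<le> v i + g i \<and> v i + g i < 1 / real (e i)))"
  using assms
proof (induction n arbitrary: G)
  case 0
  then have "G = {\<lambda>_. 0}" by (auto simp: fun_eq_iff)
  then show ?case by (auto intro!: exI[of _ "\<lambda>_. 1"])
next
  case (Suc n)
  define P where "P = (\<lambda>g. g n) ` G"
  have "\<exists>e>0. P = {of_int k / real e |k. True}"
  proof (rule rational_subgroup_cyclic)
    show "0 \<in> P" unfolding P_def using Suc.prems(1) by (auto intro!: image_eqI[of _ _ "\<lambda>_. 0"])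
    show "1 \<in> P" unfolding P_def using Suc.prems(4)[of n] by (auto intro!: image_eqI[of _ _ "\<lambda>j. if j = n then 1 else 0"])
    fix a b assume "a \<in> P" "b \<in> P"
    then obtain g h where "a = g n" "b = h n" "g \<in> G" "h \<in> G" unfolding P_def by auto
    then show "a - b \<in> P" unfolding P_def using Suc.prems(2)[of g h] by (auto intro!: image_eqI[of _ _ "\<lambda>i. g i - h i"])
  next
    fix a assume "a \<in> P"
    then show "real d * a \<in> \<int>" using Suc.prems(6) unfolding P_def by auto
  qed (rule Suc.prems(5))
  then obtain en where en: "en > 0" "P = {of_int k / real en |k. True}" by blast
  define G' where "G' = {g \<in> G. g n = 0}"
  have "\<exists>e :: nat \<Rightarrow> nat. (\<forall>i. e i > 0) \<and>
    (\<forall>v. \<exists>!g. g \<in> G' \<and> (\<forall>i<n. 0 \<le> v i + g i \<and> v i + g i < 1 / real (e i)))"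
  proof (rule Suc.IH)
    show "(\<lambda>_. 0) \<in> G'" using Suc.prems(1) by (simp add: G'_def)
    show "(\<lambda>i. g i - h i) \<in> G'" if "g \<in> G'" "h \<in> G'" for g h
      using Suc.prems(2) that by (simp add: G'_def)
    show "g i = 0" if "g \<in> G'" "i \<ge> n" for g i
      using Suc.prems(3)[of g i] that by (cases "i = n") (auto simp: G'_def)
    show "(\<lambda>j. if j = i then 1 else 0) \<in> G'" if "i < n" for i
      using Suc.prems(4)[of i] that by (simp add: G'_def)
    show "real d * g i \<in> \<int>" if "g \<in> G'" for g i using Suc.prems(6) that by (simp add: G'_def)
  qed (rule Suc.prems(5))
  then obtain e where e: "\<And>i. e i > 0"
    "\<And>v. \<exists>!g. g \<in> G' \<and> (\<forall>i<n. 0 \<le> v i + g i \<and> v i + g i < 1 / real (e i))" by blast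
  define e' where "e' = e(n := en)"
  have "\<exists>!g. g \<in> G \<and> (\<forall>i<Suc n. 0 \<le> v i + g i \<and> v i + g i < 1 / real (e' i))" for v
  proof -
    \<comment> \<open>This multiple of \<open>1 / en\<close> moves the last coordinate to \<open>[0, 1/en)\<close>.\<close>
    define k where "k = - \<lfloor>v n * real en\<rfloor>"
    have k: "0 \<le> v n + of_int k / real en" "v n + of_int k / real en < 1 / real en"
    proof -
      have a: "0 \<le> v n * real en + of_int k" "v n * real en + of_int k < 1" unfolding k_def by linarith+
      have e: "v n + of_int k / real en = (v n * real en + of_int k) / real en"
        using en(1) by (simp add: add_divide_distrib)
      show "0 \<le> v n + of_int k / real en"
        unfolding e using a(1) by (rule divide_nonneg_nonneg) simp
      show "v n + of_int k / real en < 1 / real en"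
        unfolding e using a(2) by (rule divide_strict_right_mono) (use en(1) in simp)
    qed
    have "of_int k / real en \<in> P" unfolding en(2) by blast
    then obtain g0 where g0: "g0 \<in> G" "g0 n = of_int k / real en" unfolding P_def by auto
    obtain g1 where g1: "g1 \<in> G'" "\<And>i. i < n \<Longrightarrow> 0 \<le> (v i + g0 i) + g1 i \<and> (v i + g0 i) + g1 i < 1 / real (e i)"
      using e(2)[of "\<lambda>i. v i + g0 i"] by blast
    have "(\<lambda>i. g0 i - (0 - g1 i)) \<in> G"
      using Suc.prems(2)[OF g0(1) Suc.prems(2)[OF Suc.prems(1)], of g1] g1(1) by (simp add: G'_def)
    then have gG: "(\<lambda>i. g0 i + g1 i) \<in> G" by simp
    have "\<forall>i<Suc n. 0 \<le> v i + (g0 i + g1 i) \<and> v i + (g0 i + g1 i) < 1 / real (e' i)"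
    proof (intro allI impI)
      fix i assume "i < Suc n"
      then consider "i < n" | "i = n" by linarith
      then show "0 \<le> v i + (g0 i + g1 i) \<and> v i + (g0 i + g1 i) < 1 / real (e' i)"
      proof cases
        case 1
        then show ?thesis using g1(2)[of i] by (simp add: e'_def add.assoc)
      next
        case 2
        then show ?thesis using g1(1) g0(2) k by (simp add: e'_def G'_def)
      qed
    qed
    moreover have "g = h" if g: "g \<in> G" "\<forall>i<Suc n. 0 \<le> v i + g i \<and> v i + g i < 1 / real (e' i)"
      and h: "h \<in> G" "\<forall>i<Suc n. 0 \<le> v i + h i \<and> v i + h i < 1 / real (e' i)" for g h
    proof -
      define f where "f = (\<lambda>i. g i - h i)"
      have f: "f \<in> G" unfolding f_def by (rule Suc.prems(2)[OF g(1) h(1)])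
      have "f n \<in> P" using f unfolding P_def by blast
      then obtain l where l: "f n = of_int l / real en" unfolding en(2) by blast
      have "\<bar>f n\<bar> < 1 / real en"
        using g(2)[rule_format, of n] h(2)[rule_format, of n] unfolding f_def e'_def by auto
      then have "\<bar>real_of_int l\<bar> < 1" using en(1) unfolding l by (simp add: abs_divide field_simps)
      then have "l = 0" by linarith
      then have "f \<in> G'" using f l by (simp add: G'_def)
      moreover have "\<forall>i<n. 0 \<le> (v i + h i) + f i \<and> (v i + h i) + f i < 1 / real (e i)"
      proof (intro allI impI)
        fix i assume "i < n"
        then show "0 \<le> (v i + h i) + f i \<and> (v i + h i) + f i < 1 / real (e i)"
          using g(2)[rule_format, of i] unfolding f_def e'_def by simp
      qed
      moreover have "(\<lambda>_. 0) \<in> G'" using Suc.prems(1) by (simp add: G'_def)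
      moreover have "\<forall>i<n. 0 \<le> (v i + h i) + (\<lambda>_. 0) i \<and> (v i + h i) + (\<lambda>_. 0) i < 1 / real (e i)"
      proof (intro allI impI)
        fix i assume "i < n"
        then show "0 \<le> (v i + h i) + (\<lambda>_. 0) i \<and> (v i + h i) + (\<lambda>_. 0) i < 1 / real (e i)"
          using h(2)[rule_format, of i] unfolding e'_def by simp
      qed
      ultimately have "f = (\<lambda>_. 0)" using e(2)[of "\<lambda>i. v i + h i"] by blast
      then show "g = h" by (simp add: f_def fun_eq_iff)
    qed
    ultimately show ?thesis using gG by (intro ex1I[of _ "\<lambda>i. g0 i + g1 i"]) blast+
  qed
  moreover have "\<forall>i. e' i > 0" using e(1) en(1) by (simp add: e'_def)
  ultimately show ?case by blast
qed

definition hbox :: "(4 \<Rightarrow> real) \<Rightarrow> (4 \<Rightarrow> real) \<Rightarrow> (real^4) set" where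
  "hbox l u = {a. \<forall>k. l k \<le> a $ k \<and> a $ k < u k}"

lemma hbox_borel: "hbox l u \<in> sets borel"
proof -
  have "hbox l u = (\<Inter>k. {a. l k \<le> a $ k} \<inter> {a. a $ k < u k})" by (auto simp: hbox_def)
  also have "\<dots> \<in> sets borel"
    by (intro sets.countable_INT' sets.Int borel_closed borel_open closed_Collect_le open_Collect_less
        continuous_intros) auto
  finally show ?thesis .
qed

lemma prod_Basis_vec:
  fixes f :: "(real^'n) \<Rightarrow> 'a::comm_monoid_mult"
  shows "(\<Prod>b\<in>Basis. f b) = (\<Prod>k\<in>UNIV. f (axis k 1))"
proof -
  have 1: "(Basis :: (real^'n) set) = range (\<lambda>k. axis k 1)" by (auto simp: Basis_vec_def)
  have 2: "inj (\<lambda>k. axis k 1 :: real^'n)" by (auto simp: inj_on_def axis_eq_axis)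
  show ?thesis unfolding 1 prod.reindex[OF 2] by simp
qed

lemma hbox_measure:
  assumes "\<And>k. l k \<le> u k"
  shows "hbox l u \<in> lmeasurable" "measure lebesgue (hbox l u) = (\<Prod>k\<in>UNIV. u k - l k)"
proof -
  let ?l = "\<chi> k. l k" and ?u = "\<chi> k. u k"
  have sub: "box ?l ?u \<subseteq> hbox l u" "hbox l u \<subseteq> cbox ?l ?u"
    by (auto simp: hbox_def mem_box_cart order.strict_implies_order)
  have leb: "hbox l u \<in> sets lebesgue" using hbox_borel by auto
  show fm: "hbox l u \<in> lmeasurable" by (rule fmeasurableI2[OF lmeasurable_cbox sub(2) leb])
  have le: "\<And>b. b \<in> Basis \<Longrightarrow> ?l \<bullet> b \<le> ?u \<bullet> b"
    using assms by (auto simp: Basis_vec_def inner_axis)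
  have m: "measure lebesgue (box ?l ?u) = (\<Prod>k\<in>UNIV. u k - l k)" "measure lebesgue (cbox ?l ?u) = (\<Prod>k\<in>UNIV. u k - l k)"
    using le by (simp_all add: measure_lborel_box_eq measure_lborel_cbox_eq prod_Basis_vec inner_axis)
  have "measure lebesgue (box ?l ?u) \<le> measure lebesgue (hbox l u)"
    by (rule measure_mono_fmeasurable[OF sub(1) _ fm]) simp
  moreover have "measure lebesgue (hbox l u) \<le> measure lebesgue (cbox ?l ?u)"
    by (rule measure_mono_fmeasurable[OF sub(2) leb lmeasurable_cbox])
  ultimately show "measure lebesgue (hbox l u) = (\<Prod>k\<in>UNIV. u k - l k)" using m by linarith
qed

lemma matrix_inverse_props:
  fixes M :: "real^4^4"
  assumes "det M \<noteq> 0"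
  shows "matrix_inv M *v (M *v a) = a" "M *v (matrix_inv M *v a) = a"
proof -
  have "invertible M" using assms by (simp add: invertible_det_nz)
  then have "matrix_inv M ** M = mat 1" "M ** matrix_inv M = mat 1"
    unfolding invertible_def matrix_inv_def by (metis (mono_tags, lifting) someI_ex)+
  then show "matrix_inv M *v (M *v a) = a" "M *v (matrix_inv M *v a) = a"
    by (simp_all add: matrix_vector_mul_assoc)
qed

lemma linear_image_borel:
  fixes M :: "real^4^4"
  assumes "det M \<noteq> 0" "S \<in> sets borel"
  shows "(*v) M ` S \<in> sets borel"
proof -
  have "(*v) M ` S = (*v) (matrix_inv M) -` S \<inter> space borel"
    using matrix_inverse_props[OF assms(1)] by (auto simp: image_iff) metis
  moreover have "(*v) (matrix_inv M) \<in> borel_measurable borel"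
    by (intro borel_measurable_continuous_onI matrix_vector_mult_linear_continuous_on)
  ultimately show ?thesis using assms(2) measurable_sets by metis
qed

lemma measure_matrix_image_hbox:
  fixes M :: "real^4^4"
  assumes "det M \<noteq> 0" "\<And>k. l k \<le> u k"
  shows "(*v) M ` hbox l u \<in> sets borel" "(*v) M ` hbox l u \<in> lmeasurable"
    "measure lborel ((*v) M ` hbox l u) = \<bar>det M\<bar> * (\<Prod>k\<in>UNIV. u k - l k)"
proof -
  show b: "(*v) M ` hbox l u \<in> sets borel" by (rule linear_image_borel[OF assms(1) hbox_borel])
  show "(*v) M ` hbox l u \<in> lmeasurable"
    by (rule measurable_linear_image) (auto intro: hbox_measure assms)
  have "measure lebesgue ((*v) M ` hbox l u) = \<bar>det M\<bar> * (\<Prod>k\<in>UNIV. u k - l k)"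
    using measure_linear_image[of "(*v) M" "hbox l u"] hbox_measure[OF assms(2)] by simp
  then show "measure lborel ((*v) M ` hbox l u) = \<bar>det M\<bar> * (\<Prod>k\<in>UNIV. u k - l k)"
    using b by (simp add: measure_completion)
qed

definition cjoin :: "(real^4) \<times> (real^4) \<Rightarrow> complex^4" where
  "cjoin = (\<lambda>(p, q). \<chi> j. Complex (p $ j) (q $ j))"

lemma cjoin_borel: "cjoin \<in> borel_measurable borel"
proof -
  have "cjoin = (\<lambda>z. \<chi> j. of_real (fst z $ j) + \<i> * of_real (snd z $ j))"
    by (auto simp: cjoin_def Complex_eq)
  moreover have "continuous_on UNIV (\<lambda>z :: (real^4) \<times> (real^4). \<chi> j. of_real (fst z $ j) + \<i> * complex_of_real (snd z $ j))"
    by (intro continuous_intros)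
  ultimately have "continuous_on UNIV cjoin" by (simp only:)
  then show ?thesis by (rule borel_measurable_continuous_onI)
qed

text \<open>The linear isomorphism from pairs of real vectors to complex vectors preserves Lebesgue measure because it
  maps boxes to boxes.  It makes the volume formula for linear images in real 4-space available.\<close>

lemma lborel_cjoin: "distr (lborel \<Otimes>\<^sub>M lborel) borel cjoin = lborel"
proof (rule lborel_eqI[symmetric])
  have jm: "cjoin \<in> measurable (lborel \<Otimes>\<^sub>M lborel) borel"
    using cjoin_borel by (simp add: lborel_prod)
  fix l u :: "complex^4" assume le: "\<And>b. b \<in> Basis \<Longrightarrow> l \<bullet> b \<le> u \<bullet> b"
  define re im :: "complex^4 \<Rightarrow> real^4" where "re z = (\<chi> j. Re (z $ j))" and "im z = (\<chi> j. Im (z $ j))" for z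
  have B: "(\<forall>b\<in>Basis. P b) \<longleftrightarrow> (\<forall>j. P (axis j 1) \<and> P (axis j \<i>))" for P :: "complex^4 \<Rightarrow> bool"
    by (auto simp: Basis_vec_def Basis_complex_def)
  have leb: "Re (l $ j) \<le> Re (u $ j)" "Im (l $ j) \<le> Im (u $ j)" for j
    using le[of "axis j 1"] le[of "axis j \<i>"]
    by (auto simp: Basis_vec_def Basis_complex_def inner_axis inner_complex_def)
  have mem: "z \<in> box l u \<longleftrightarrow> (\<forall>j. (Re (l $ j) < Re (z $ j) \<and> Re (z $ j) < Re (u $ j))
      \<and> (Im (l $ j) < Im (z $ j) \<and> Im (z $ j) < Im (u $ j)))" for z
    unfolding mem_box B by (simp add: inner_axis inner_complex_def)
  have "cjoin -` box l u \<inter> space (lborel \<Otimes>\<^sub>M lborel) = box (re l) (re u) \<times> box (im l) (im u)"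
    by (auto simp: cjoin_def mem mem_box_cart re_def im_def space_pair_measure)
  then have "emeasure (distr (lborel \<Otimes>\<^sub>M lborel) borel cjoin) (box l u)
      = emeasure lborel (box (re l) (re u)) * emeasure lborel (box (im l) (im u))"
    by (simp add: emeasure_distr[OF jm] lborel.emeasure_pair_measure_Times)
  also have "emeasure lborel (box (re l) (re u)) = ennreal (\<Prod>j\<in>UNIV. Re (u $ j - l $ j))"
  proof -
    have "emeasure lborel (box (re l) (re u)) = ennreal (\<Prod>b\<in>Basis. (re u - re l) \<bullet> b)"
      by (rule emeasure_lborel_box) (auto simp: inner_axis re_def Basis_vec_def leb)
    then show ?thesis by (simp add: prod_Basis_vec inner_axis re_def)
  qed
  also have "emeasure lborel (box (im l) (im u)) = ennreal (\<Prod>j\<in>UNIV. Im (u $ j - l $ j))"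
  proof -
    have "emeasure lborel (box (im l) (im u)) = ennreal (\<Prod>b\<in>Basis. (im u - im l) \<bullet> b)"
      by (rule emeasure_lborel_box) (auto simp: inner_axis im_def Basis_vec_def leb)
    then show ?thesis by (simp add: prod_Basis_vec inner_axis im_def)
  qed
  also have "ennreal (\<Prod>j\<in>UNIV. Re (u $ j - l $ j)) * ennreal (\<Prod>j\<in>UNIV. Im (u $ j - l $ j))
      = ennreal (\<Prod>b\<in>Basis. (u - l) \<bullet> b)"
  proof -
    have Bs: "Basis = (\<lambda>(j, c). axis j c) ` (UNIV \<times> {1, \<i>})" for j :: 4
      by (auto simp: Basis_vec_def Basis_complex_def)
    have inj: "inj_on (\<lambda>(j, c). axis j c) ((UNIV :: 4 set) \<times> {1, \<i>})"
      by (auto simp: inj_on_def axis_eq_axis)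
    have "(\<Prod>b\<in>Basis. (u - l) \<bullet> b) = (\<Prod>(j, c)\<in>UNIV \<times> {1, \<i>}. (u - l) \<bullet> axis j c)"
      unfolding Bs prod.reindex[OF inj] by (simp add: case_prod_beta)
    also have "\<dots> = (\<Prod>j\<in>UNIV. \<Prod>c\<in>{1, \<i>}. (u - l) \<bullet> axis j c)"
      by (rule prod.cartesian_product[symmetric])
    also have "\<dots> = (\<Prod>j\<in>UNIV. Re (u $ j - l $ j)) * (\<Prod>j\<in>UNIV. Im (u $ j - l $ j))"
      by (simp add: inner_axis inner_complex_def prod.distrib)
    finally have e: "(\<Prod>b\<in>Basis. (u - l) \<bullet> b) = (\<Prod>j\<in>UNIV. Re (u $ j - l $ j)) * (\<Prod>j\<in>UNIV. Im (u $ j - l $ j))" .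
    show ?thesis unfolding e
      by (intro ennreal_mult[symmetric] prod_nonneg) (simp_all add: leb)
  qed
  finally show "emeasure (distr (lborel \<Otimes>\<^sub>M lborel) borel cjoin) (box l u) = ennreal (\<Prod>b\<in>Basis. (u - l) \<bullet> b)" .
qed simp

lemma emeasure_lborel_finite:
  fixes Y :: "(real^4) set"
  assumes "Y \<in> sets borel" "Y \<in> lmeasurable"
  shows "emeasure lborel Y = ennreal (measure lborel Y)"
proof (rule emeasure_eq_ennreal_measure[folded infinity_ennreal_def])
  have "emeasure lebesgue Y \<noteq> \<infinity>" using fmeasurableD2[OF assms(2)] by simp
  then show "emeasure lborel Y \<noteq> \<infinity>" using assms(1) by simp
qed

context integral_quartic
begin

lemma det_eps_scaled: "det (\<chi> j k. eps j * D * V $ j $ k) = D ^ 4 * det V"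
  unfolding det_4 by (simp add: power4_eq_xxxx algebra_simps)

text \<open>The imaginary part of \<open>Psi\<close> in matrix form.\<close>

definition W :: "real^4^4" where "W = (\<chi> j k. eps j * D * V $ j $ k)"

lemma det_W: "det W = D ^ 4 * det V" and det_W_pos: "det W > 0"
  using det_eps_scaled det_V_pos D_pos by (simp_all add: W_def)

lemma Psi_cjoin: "Psi a b = cjoin (V *v a, W *v b)"
  by (simp add: Psi_def cjoin_def W_def matrix_vector_mult_def sum_distrib_left mult_ac)

lemma Psi_eq_iff: "Psi a b = Psi a' b' \<longleftrightarrow> a = a' \<and> b = b'"
proof
  assume "Psi a b = Psi a' b'"
  then have "V *v a = V *v a'" "W *v b = W *v b'"
    by (auto simp: Psi_cjoin cjoin_def vec_eq_iff)
  then show "a = a' \<and> b = b'"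
    using matrix_inverse_props(1)[of V] matrix_inverse_props(1)[of W] det_V_pos det_W_pos by (metis less_irrefl)
qed simp

definition re_coord where "re_coord z = matrix_inv V *v (\<chi> j. Re (z $ j))"
definition im_coord where "im_coord z = matrix_inv W *v (\<chi> j. Im (z $ j))"

lemma Psi_coords: "Psi (re_coord z) (im_coord z) = z"
  using det_V_pos det_W_pos
  by (simp add: re_coord_def im_coord_def Psi_cjoin cjoin_def matrix_inverse_props)

lemma coords_Psi [simp]: "re_coord (Psi a b) = a" "im_coord (Psi a b) = b"
  using Psi_coords[of "Psi a b"] by (simp_all add: Psi_eq_iff)

definition coords :: "complex^4 \<Rightarrow> nat \<Rightarrow> real" where
  "coords z i = (if i < 4 then re_coord z $ idx i else if i < 8 then im_coord z $ idx (i - 4) else 0)"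

lemma idx_surj: "\<exists>i<4. k = idx i"
proof -
  have "k = idx 0 \<or> k = idx 1 \<or> k = idx 2 \<or> k = idx 3" using exhaust_4[of k] by simp
  then show ?thesis by (elim disjE) (force intro: exI[of _ "0::nat"] exI[of _ "1::nat"] exI[of _ "2::nat"] exI[of _ "3::nat"])+
qed

lemma all_idx: "(\<forall>k. Q k) \<longleftrightarrow> (\<forall>i<4. Q (idx i))"
  using idx_surj by metis

lemma coords_cong: "coords z = coords z' \<longleftrightarrow> z = z'"
proof
  assume e: "coords z = coords z'"
  have "re_coord z $ idx i = re_coord z' $ idx i" if "i < 4" for i
    using fun_cong[OF e, of i] that by (simp add: coords_def)
  moreover have "im_coord z $ idx i = im_coord z' $ idx i" if "i < 4" for i
    using fun_cong[OF e, of "i + 4"] that by (simp add: coords_def)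
  ultimately have "re_coord z = re_coord z'" "im_coord z = im_coord z'"
    unfolding vec_eq_iff all_idx by auto
  then show "z = z'" using Psi_coords by metis
qed simp

lemma re_coord_diff: "re_coord (z - z') = re_coord z - re_coord z'"
  and im_coord_diff: "im_coord (z - z') = im_coord z - im_coord z'"
proof -
  have "z - z' = Psi (re_coord z - re_coord z') (im_coord z - im_coord z')"
    using Psi_diff[of "re_coord z" "im_coord z" "re_coord z'" "im_coord z'"] by (simp add: Psi_coords)
  then show "re_coord (z - z') = re_coord z - re_coord z'" "im_coord (z - z') = im_coord z - im_coord z'"
    by (metis coords_Psi)+
qed

lemma coords_diff: "coords (z - z') i = coords z i - coords z' i"
  by (simp add: coords_def re_coord_diff im_coord_diff)

lemma coords_add: "coords (z + z') i = coords z i + coords z' i"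
  using coords_diff[of "z + z'" z' i] by simp

text \<open>In the coordinates of \<open>Psi\<close> the lattice contains all integral vectors and has bounded denominators.  The
  fundamental domain is the image of a rational box, and the determinant of \<open>Psi\<close> is \<open>det V \<cdot> det W\<close>, which is
  \<open>m\<^sup>1\<^sup>2 D\<^sup>6\<close> and therefore rational.\<close>

lemma fundamental_domain_rational_volume:
  "\<exists>A. fundamental_domain L A \<and> measure lborel A > 0 \<and> measure lborel A \<in> \<rat>"
proof -
  define G where "G = coords ` L"
  have c0: "coords 0 = (\<lambda>_. 0)" using coords_diff[of 0 0] by auto
  have "\<exists>e :: nat \<Rightarrow> nat. (\<forall>i. e i > 0) \<and>
    (\<forall>v. \<exists>!g. g \<in> G \<and> (\<forall>i<8. 0 \<le> v i + g i \<and> v i + g i < 1 / real (e i)))"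
  proof (rule box_transversal)
    show "(\<lambda>_. 0) \<in> G" unfolding G_def using zero_in_lattice c0 by (metis imageI)
    show "(\<lambda>i. g i - h i) \<in> G" if "g \<in> G" "h \<in> G" for g h
    proof -
      obtain l l' where l: "g = coords l" "h = coords l'" "l \<in> L" "l' \<in> L" using \<open>g \<in> G\<close> \<open>h \<in> G\<close> unfolding G_def by auto
      then have "(\<lambda>i. g i - h i) = coords (l - l')" by (simp add: fun_eq_iff coords_diff)
      then show ?thesis using lattice_diff l unfolding G_def by blast
    qed
    show "g i = 0" if "g \<in> G" "8 \<le> i" for g i using that unfolding G_def coords_def by auto
    show "(\<lambda>j. if j = i then 1 else 0) \<in> G" if "i < 8" for i
    proof -
      define a :: "real^4" where "a = (if i < 4 then axis (idx i) 1 else 0)"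
      define b :: "real^4" where "b = (if i < 4 then 0 else axis (idx (i - 4)) 1)"
      have "a \<in> intvec" "b \<in> intvec" by (auto simp: a_def b_def intvec_def axis_def)
      then have "Psi a b \<in> L" by (rule lattice_contains_integral)
      moreover have "coords (Psi a b) = (\<lambda>j. if j = i then 1 else 0)"
      proof
        fix j
        show "coords (Psi a b) j = (if j = i then 1 else 0)"
          using that by (auto simp: coords_def a_def b_def axis_def idx_eq_iff)
      qed
      ultimately show ?thesis unfolding G_def by (metis imageI)
    qed
    show "denom > 0" by (rule denom_pos)
    show "real denom * g i \<in> \<int>" if g: "g \<in> G" for g i
    proof -
      obtain l where l: "g = coords l" "l \<in> L" using g unfolding G_def by auto
      obtain a b where "l = Psi a b" "\<And>k. real denom * a $ k \<in> \<int>" "\<And>k. real denom * b $ k \<in> \<int>"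
        using lattice_denominators[OF l(2)] by blast
      then show ?thesis unfolding l(1) coords_def by auto
    qed
  qed
  then obtain e :: "nat \<Rightarrow> nat" where e: "\<And>i. e i > 0"
    "\<And>v. \<exists>!g. g \<in> G \<and> (\<forall>i<8. 0 \<le> v i + g i \<and> v i + g i < 1 / real (e i))" by blast
  define cut where "cut z \<longleftrightarrow> (\<forall>i<8. 0 \<le> coords z i \<and> coords z i < 1 / real (e i))" for z
  define A where "A = {z. cut z}"
  have trans: "\<exists>!l. l \<in> L \<and> v + l \<in> A" for v
  proof -
    obtain g where g: "g \<in> G" "\<forall>i<8. 0 \<le> coords v i + g i \<and> coords v i + g i < 1 / real (e i)"
      and uniq: "\<And>h. h \<in> G \<Longrightarrow> (\<forall>i<8. 0 \<le> coords v i + h i \<and> coords v i + h i < 1 / real (e i)) \<Longrightarrow> h = g"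
      using e(2)[of "coords v"] by blast
    obtain l where l: "l \<in> L" "g = coords l" using g(1) unfolding G_def by auto
    show ?thesis
    proof (rule ex1I[of _ l])
      show "l \<in> L \<and> v + l \<in> A" using l g(2) by (simp add: A_def cut_def coords_add)
      fix l' assume l': "l' \<in> L \<and> v + l' \<in> A"
      then have "coords l' = g" by (intro uniq) (auto simp: G_def A_def cut_def coords_add)
      then show "l' = l" using l(2) coords_cong by metis
    qed
  qed
  obtain f :: "4 \<Rightarrow> nat" where f: "\<And>i. i < 4 \<Longrightarrow> f (idx i) = i"
  proof -
    have "inj_on idx {..<4}" by (auto simp: inj_on_def idx_eq_iff)
    then show thesis by (intro that[of "inv_into {..<4} idx"]) simp
  qed
  define r s where "r k = 1 / real (e (f k))" and "s k = 1 / real (e (f k + 4))" for k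
  have cut_iff: "cut z \<longleftrightarrow> re_coord z \<in> hbox (\<lambda>_. 0) r \<and> im_coord z \<in> hbox (\<lambda>_. 0) s" for z
  proof -
    have "cut z \<longleftrightarrow> (\<forall>i<4. (0 \<le> coords z i \<and> coords z i < 1 / real (e i)) \<and> (0 \<le> coords z (i + 4) \<and> coords z (i + 4) < 1 / real (e (i + 4))))"
    proof -
      have "(\<forall>i<8. Q i) \<longleftrightarrow> (\<forall>i<4. Q i \<and> Q (i + 4))" for Q :: "nat \<Rightarrow> bool"
      proof
        assume q: "\<forall>i<4. Q i \<and> Q (i + 4)"
        show "\<forall>i<8. Q i"
        proof (intro allI impI)
          fix i :: nat assume "i < 8"
          then show "Q i" using q[rule_format, of i] q[rule_format, of "i - 4"] by (cases "i < 4") auto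
        qed
      qed auto
      then show ?thesis unfolding cut_def .
    qed
    also have "\<dots> \<longleftrightarrow> re_coord z \<in> hbox (\<lambda>_. 0) r \<and> im_coord z \<in> hbox (\<lambda>_. 0) s"
      unfolding hbox_def mem_Collect_eq all_idx by (auto simp: coords_def r_def s_def f)
    finally show ?thesis .
  qed
  have rs: "\<And>k. 0 \<le> r k" "\<And>k. 0 \<le> s k" by (simp_all add: r_def s_def)
  define S T where "S = (*v) V ` hbox (\<lambda>_. 0) r" and "T = (*v) W ` hbox (\<lambda>_. 0) s"
  have S: "S \<in> sets borel" "S \<in> lmeasurable" "measure lborel S = det V * (\<Prod>k\<in>UNIV. r k)"
    using measure_matrix_image_hbox[of V "\<lambda>_. 0" r] rs det_V_pos by (auto simp: S_def)
  have T: "T \<in> sets borel" "T \<in> lmeasurable" "measure lborel T = det W * (\<Prod>k\<in>UNIV. s k)"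
    using measure_matrix_image_hbox[of W "\<lambda>_. 0" s] rs det_W_pos by (auto simp: T_def)
  have A_eq: "A = cjoin ` (S \<times> T)"
  proof (intro subset_antisym subsetI)
    fix z assume "z \<in> A"
    then show "z \<in> cjoin ` (S \<times> T)"
      unfolding A_def mem_Collect_eq cut_iff S_def T_def
      by (intro image_eqI[of _ _ "(V *v re_coord z, W *v im_coord z)"])
        (auto simp flip: Psi_cjoin simp: Psi_coords)
  next
    fix z assume "z \<in> cjoin ` (S \<times> T)"
    then show "z \<in> A" unfolding A_def cut_iff mem_Collect_eq S_def T_def by (auto simp flip: Psi_cjoin)
  qed
  have inj: "cjoin p = cjoin q \<longleftrightarrow> p = q" for p q
    by (auto simp: cjoin_def vec_eq_iff prod_eq_iff split: prod.splits)
  have vim: "cjoin -` A = S \<times> T" unfolding A_eq using inj by auto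
  have Ab: "A \<in> sets borel"
  proof -
    define split :: "complex^4 \<Rightarrow> (real^4) \<times> (real^4)" where "split z = (\<chi> j. Re (z $ j), \<chi> j. Im (z $ j))" for z
    have sp: "cjoin (split z) = z" for z by (simp add: split_def cjoin_def vec_eq_iff complex_eq_iff)
    have "A = split -` (S \<times> T) \<inter> space borel"
      unfolding vim[symmetric] by (simp add: set_eq_iff sp)
    moreover have "split \<in> borel_measurable borel"
      unfolding split_def by (intro borel_measurable_continuous_onI continuous_intros)
    moreover have "S \<times> T \<in> sets (borel :: ((real^4) \<times> (real^4)) measure)"
      unfolding borel_prod[symmetric] using S(1) T(1) by (rule pair_measureI)
    ultimately show ?thesis by (metis measurable_sets)
  qed
  have jm: "cjoin \<in> measurable (lborel \<Otimes>\<^sub>M lborel) borel"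
    using cjoin_borel by (simp add: lborel_prod)
  have "emeasure lborel A = emeasure (distr (lborel \<Otimes>\<^sub>M lborel) borel cjoin) A" by (simp add: lborel_cjoin)
  also have "\<dots> = emeasure (lborel \<Otimes>\<^sub>M lborel) (S \<times> T)"
    using Ab jm vim by (simp add: emeasure_distr space_pair_measure)
  also have "\<dots> = emeasure lborel S * emeasure lborel T"
    using S(1) T(1) by (intro lborel.emeasure_pair_measure_Times) auto
  also have "\<dots> = ennreal (measure lborel S * measure lborel T)"
  proof -
    have "emeasure lborel S = ennreal (measure lborel S)" "emeasure lborel T = ennreal (measure lborel T)"
      using S(1,2) T(1,2) by (simp_all only: emeasure_lborel_finite)
    then show ?thesis by (simp only: ennreal_mult measure_nonneg)
  qed
  finally have em: "emeasure lborel A = ennreal (measure lborel S * measure lborel T)" .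
  then have fm: "A \<in> fmeasurable lborel" using Ab by (intro fmeasurableI) auto
  have mA: "measure lborel A = measure lborel S * measure lborel T"
    using em by (simp add: measure_def)
  define R where "R = (\<Prod>k\<in>UNIV. r k) * (\<Prod>k\<in>UNIV. s k)"
  have meas: "measure lborel A = real m ^ 12 * (D ^ 2) ^ 3 * R"
    unfolding mA S(3) T(3) det_W unfolding det_V R_def by (simp add: power_def algebra_simps)
  have "R > 0" unfolding R_def r_def s_def using e(1) by (intro mult_pos_pos prod_pos) auto
  moreover have "R \<in> \<rat>" unfolding R_def r_def s_def UNIV_4 by simp
  ultimately have "measure lborel A > 0" "measure lborel A \<in> \<rat>"
    unfolding meas using m_pos D_pos Rats_power[OF D_square_rat, of 3] by simp_all
  then show ?thesis using fm trans unfolding fundamental_domain_def by blast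
qed

end

section \<open>The flat torus as a manifold\<close>

lemma Ck_on_const: "Ck_on k S (\<lambda>x. c)"
  by (induction k arbitrary: c) (auto intro!: exI[of _ "\<lambda>_ _. 0"] derivative_eq_intros)

lemma smooth_on_locally_affine:
  fixes f :: "'a::real_normed_vector \<Rightarrow> 'b::real_normed_vector"
  assumes A: "bounded_linear A" and "open S"
    and loc: "\<And>x. x \<in> S \<Longrightarrow> \<exists>U b. open U \<and> x \<in> U \<and> (\<forall>u\<in>U. f u = A u + b)"
  shows "smooth_on S f" "\<And>x. x \<in> S \<Longrightarrow> (f has_derivative A) (at x)"
proof -
  show d: "(f has_derivative A) (at x)" if x: "x \<in> S" for x
  proof -
    obtain U b where U: "open U" "x \<in> U" "\<And>u. u \<in> U \<Longrightarrow> f u = A u + b" using loc[OF x] by blast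
    have "((\<lambda>u. A u + b) has_derivative A) (at x)"
      using bounded_linear_imp_has_derivative[OF A, of "at x"] by (auto intro!: derivative_eq_intros)
    then show ?thesis by (rule has_derivative_transform_within_open[OF _ U(1,2)]) (simp add: U(3))
  qed
  have "Ck_on k S f" for k
  proof (cases k)
    case 0
    have "continuous_on S f"
      by (rule has_derivative_continuous_on[of S f "\<lambda>_. A"]) (use d in \<open>auto intro: has_derivative_at_withinI\<close>)
    then show ?thesis using 0 by simp
  next
    case (Suc k)
    then show ?thesis using d by (auto intro!: exI[of _ "\<lambda>_. A"] Ck_on_const)
  qed
  then show "smooth_on S f" using \<open>open S\<close> by (simp add: smooth_on_def)
qed

definition expo :: "real^4 \<Rightarrow> complex^4" where "expo t = (\<chi> k. cis (2 * pi * t $ k))"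
definition unit_torus :: "(complex^4) set" where "unit_torus = {z. \<forall>k. cmod (z $ k) = 1}"

definition obox :: "real^4 \<Rightarrow> (real^4) set" where "obox s = {t. \<forall>k. s $ k < t $ k \<and> t $ k < s $ k + 1}"
text \<open>The vectors to which the inverse of \<open>expo\<close> with values in \<open>obox s\<close> extends continuously: \<open>branch s\<close> is obtained from
  the principal argument by rotating the centre of the box to the positive real axis.\<close>

definition slit :: "real^4 \<Rightarrow> (complex^4) set" where
  "slit s = {z. \<forall>k. z $ k * cis (- (2 * pi * (s $ k + 1/2))) \<notin> \<real>\<^sub>\<le>\<^sub>0}"
definition branch :: "real^4 \<Rightarrow> complex^4 \<Rightarrow> real^4" where
  "branch s z = (\<chi> k. s $ k + 1/2 + Arg (z $ k * cis (- (2 * pi * (s $ k + 1/2)))) / (2 * pi))"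

lemma expo_in_unit_torus: "expo t \<in> unit_torus"
  by (simp add: expo_def unit_torus_def)

lemma cis_eq_iff: "cis (2 * pi * a) = cis (2 * pi * b) \<longleftrightarrow> a - b \<in> \<int>"
proof -
  have "cis (2 * pi * a) = cis (2 * pi * b) \<longleftrightarrow> cis (2 * pi * (a - b)) = 1"
    by (simp add: right_diff_distrib flip: cis_divide)
  also have "\<dots> \<longleftrightarrow> a - b \<in> \<int>"
  proof
    assume "cis (2 * pi * (a - b)) = 1"
    then have "cos (2 * pi * (a - b)) = 1" by (simp add: complex_eq_iff)
    then obtain n :: int where "2 * pi * (a - b) = of_int n * 2 * pi" unfolding cos_one_2pi_int by blast
    then have "a - b = of_int n" by simp
    then show "a - b \<in> \<int>" by simp
  qed simp
  finally show ?thesis .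
qed

lemma expo_eq_iff: "expo s = expo t \<longleftrightarrow> (\<forall>k. s $ k - t $ k \<in> \<int>)"
  by (simp add: expo_def vec_eq_iff cis_eq_iff)

lemma cis_shift: "cis (2 * pi * a) * cis (- (2 * pi * b)) = cis (2 * pi * (a - b))"
  by (simp add: cis_mult right_diff_distrib)

lemma open_obox: "open (obox s)"
proof -
  have "obox s = (\<Inter>k. {t. s $ k < t $ k} \<inter> {t. t $ k < s $ k + 1})" by (auto simp: obox_def)
  also have "open \<dots>" by (intro open_INT open_Int open_Collect_less continuous_intros ballI) simp_all
  finally show ?thesis .
qed

lemma open_slit: "open (slit s)"
proof -
  have "slit s = (\<Inter>k. (\<lambda>z. z $ k * cis (- (2 * pi * (s $ k + 1/2)))) -` (- \<real>\<^sub>\<le>\<^sub>0))" by (auto simp: slit_def)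
  also have "open \<dots>"
    by (intro open_INT open_vimage ballI open_Compl closed_nonpos_Reals_complex continuous_intros) auto
  finally show ?thesis .
qed

lemma continuous_branch: "continuous_on (slit s) (branch s)"
  unfolding branch_def by (intro continuous_intros) (auto simp: slit_def)

lemma continuous_expo: "continuous_on S expo"
  unfolding expo_def by (intro continuous_intros)

lemma expo_obox:
  assumes "t \<in> obox s"
  shows "expo t \<in> slit s" "branch s (expo t) = t"
proof -
  define a where "a k = 2 * pi * (t $ k - (s $ k + 1/2))" for k
  have e: "expo t $ k * cis (- (2 * pi * (s $ k + 1/2))) = cis (a k)" for k
    unfolding expo_def a_def vec_lambda_beta by (rule cis_shift)
  have "-1/2 < t $ k - (s $ k + 1/2)" "t $ k - (s $ k + 1/2) < 1/2" for k
    using assms unfolding obox_def by (auto dest: spec[of _ k])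
  then have "2 * pi * (-1/2) < a k" "a k < 2 * pi * (1/2)" for k
    unfolding a_def by (simp_all only: mult_less_cancel_left_pos pi_gt_zero zero_less_mult_iff zero_less_numeral simp_thms)
  then have a: "- pi < a k" "a k < pi" for k by (metis mult.commute mult_minus1 nonzero_mult_div_cancel_left divide_minus_left times_divide_eq_right mult_cancel_left2 field_sum_of_halves mult_2 zero_neq_numeral minus_mult_right, simp)
  have Arg: "Arg (cis (a k)) = a k" for k using a[of k] by (intro Arg_cis) auto
  have "cis (a k) \<notin> \<real>\<^sub>\<le>\<^sub>0" for k
  proof
    assume "cis (a k) \<in> \<real>\<^sub>\<le>\<^sub>0"
    then have "Re (cis (a k)) \<le> 0" "Im (cis (a k)) = 0" by (auto simp: complex_nonpos_Reals_iff)
    moreover have "Re (cis (a k)) \<noteq> 0" using calculation(2) by (metis cis.simps norm_cis complex_eq_0 norm_zero zero_neq_one zero_power2 add_0 complex.sel)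
    ultimately have "Arg (cis (a k)) = pi" by (subst Arg_eq_pi) auto
    then show False using Arg[of k] a[of k] by simp
  qed
  then show "expo t \<in> slit s" unfolding slit_def mem_Collect_eq e by blast
  show "branch s (expo t) = t"
    unfolding branch_def e Arg by (simp add: vec_eq_iff a_def)
qed

lemma branch_slit:
  assumes "z \<in> unit_torus" "z \<in> slit s"
  shows "branch s z \<in> obox s" "expo (branch s z) = z"
proof -
  define u where "u k = z $ k * cis (- (2 * pi * (s $ k + 1/2)))" for k
  have n: "cmod (u k) = 1" for k using assms(1) by (simp add: u_def unit_torus_def norm_mult)
  have "u k \<notin> \<real>\<^sub>\<le>\<^sub>0" for k using assms(2) by (simp add: slit_def u_def)
  then have "Arg (u k) \<noteq> pi" for k unfolding Arg_eq_pi by (auto simp: complex_nonpos_Reals_iff)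
  then have A: "- pi < Arg (u k)" "Arg (u k) < pi" for k
    using mpi_less_Arg[of "u k"] Arg_le_pi[of "u k"] by (auto simp: order.order_iff_strict)
  then have b: "-1/2 < Arg (u k) / (2 * pi)" "Arg (u k) / (2 * pi) < 1/2" for k
    by (simp_all add: field_simps)
  show "branch s z \<in> obox s"
    unfolding obox_def branch_def mem_Collect_eq vec_lambda_beta u_def[symmetric]
  proof
    fix k
    show "s $ k < s $ k + 1/2 + Arg (u k) / (2 * pi) \<and> s $ k + 1/2 + Arg (u k) / (2 * pi) < s $ k + 1"
      using b[of k] by linarith
  qed
  have "cis (Arg (u k)) = u k" for k
    using n[of k] rcis_cmod_Arg[of "u k"] by (simp add: rcis_def)
  moreover have "cis (2 * pi * branch s z $ k) = cis (Arg (u k)) * cis (2 * pi * (s $ k + 1/2))" for k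
  proof -
    have "2 * pi * branch s z $ k = Arg (u k) + 2 * pi * (s $ k + 1/2)"
      unfolding branch_def vec_lambda_beta u_def[symmetric] by (simp add: distrib_left)
    then show ?thesis by (simp only: cis_mult)
  qed
  ultimately have "cis (2 * pi * branch s z $ k) = z $ k" for k
    by (simp add: u_def cis_mult)
  then show "expo (branch s z) = z" by (simp add: expo_def vec_eq_iff)
qed


text \<open>The points of the manifold are the singletons of points of the unit torus, which have the type required of
  the points of a cycle.\<close>

definition pt :: "real^4 \<Rightarrow> (complex^4) set" where "pt t = {expo t}"

lemma pt_eq_iff: "pt s = pt t \<longleftrightarrow> (\<forall>k. s $ k - t $ k \<in> \<int>)"
  by (simp add: pt_def expo_eq_iff)

lemma the_elem_pt [simp]: "the_elem (pt t) = expo t"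
  by (simp add: pt_def)

lemma range_expo: "range expo = unit_torus"
proof (intro subset_antisym subsetI)
  fix z assume z: "z \<in> unit_torus"
  have "cis (Arg (z $ k)) = z $ k" for k
    using z rcis_cmod_Arg[of "z $ k"] by (simp add: rcis_def unit_torus_def)
  then have "expo (\<chi> k. Arg (z $ k) / (2 * pi)) = z" by (simp add: expo_def vec_eq_iff)
  then show "z \<in> range expo" by (metis rangeI)
qed (use expo_in_unit_torus in auto)

lemma range_pt: "range pt = (\<lambda>z. {z}) ` unit_torus"
  unfolding range_expo[symmetric] pt_def by auto

definition torus_top :: "(complex^4) set topology" where
  "torus_top = pullback_topology (range pt) the_elem (top_of_set unit_torus)"

lemma topspace_torus: "topspace torus_top = range pt"
  by (auto simp: torus_top_def topspace_pullback_topology expo_in_unit_torus)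

lemma torus_homeo: "homeomorphic_maps torus_top (top_of_set unit_torus) the_elem (\<lambda>z. {z})"
  unfolding homeomorphic_maps_def
proof (intro conjI ballI)
  show "continuous_map torus_top (top_of_set unit_torus) the_elem"
    using continuous_map_pullback[OF continuous_map_id, of "range pt" the_elem "top_of_set unit_torus"]
    by (simp add: torus_top_def id_def comp_def)
  show "continuous_map (top_of_set unit_torus) torus_top (\<lambda>z. {z})"
    unfolding torus_top_def
    by (rule continuous_map_pullback') (auto simp: comp_def range_pt)
qed (auto simp: topspace_torus pt_def)

lemma compact_unit_torus: "compact unit_torus"
proof -
  have eq: "unit_torus = expo ` cbox 0 (\<chi> k. 1)"
  proof (intro subset_antisym subsetI)
    fix z assume "z \<in> unit_torus"
    then obtain t where t: "z = expo t" using range_expo by auto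
    have "expo (\<chi> k. frac (t $ k)) = expo t" by (auto simp: expo_eq_iff frac_def)
    moreover have "(\<chi> k. frac (t $ k)) \<in> cbox 0 (\<chi> k. 1)"
      by (auto simp: mem_box_cart frac_ge_0 frac_lt_1 less_imp_le)
    ultimately show "z \<in> expo ` cbox 0 (\<chi> k. 1)" using t by (metis imageI)
  qed (use expo_in_unit_torus in auto)
  show ?thesis unfolding eq by (rule compact_continuous_image[OF continuous_expo compact_cbox])
qed

lemma torus_compact_Hausdorff: "compact_space torus_top" "Hausdorff_space torus_top"
proof -
  have h: "torus_top homeomorphic_space top_of_set unit_torus"
    using torus_homeo homeomorphic_space_def by blast
  show "compact_space torus_top"
    unfolding homeomorphic_compact_space[OF h] using compact_unit_torus
    by (simp add: compact_space_subtopology)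
  show "Hausdorff_space torus_top"
    unfolding homeomorphic_Hausdorff_space[OF h] by (simp add: Hausdorff_space_subtopology)
qed

text \<open>The matrix \<open>M\<close> makes the torus the quotient of real 4-space by the lattice spanned by the columns of \<open>M\<close>.\<close>

definition torus_chart :: "real^4^4 \<Rightarrow> real^4 \<Rightarrow> (complex^4) set chart" where
  "torus_chart M s = (pt ` obox s, \<lambda>S. M *v branch s (the_elem S))"

definition torus_manifold :: "real^4^4 \<Rightarrow> (complex^4) set atlas_space" where
  "torus_manifold M = \<lparr>top_of = torus_top, charts_of = range (torus_chart M)\<rparr>"

lemma torus_chart_simps [simp]:
  "chart_dom (torus_chart M s) = pt ` obox s"
  "t \<in> obox s \<Longrightarrow> chart_map (torus_chart M s) (pt t) = M *v t"
  by (simp_all add: torus_chart_def expo_obox)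

lemma torus_chart_img: "chart_img (torus_chart M s) = (*v) M ` obox s"
  by (simp add: image_image)

lemma torus_chart_inv:
  assumes "det M \<noteq> 0" "t \<in> obox s"
  shows "chart_inv (torus_chart M s) (M *v t) = pt t"
proof -
  have "inj_on (chart_map (torus_chart M s)) (chart_dom (torus_chart M s))"
  proof (rule inj_onI)
    fix p q assume pq: "p \<in> chart_dom (torus_chart M s)" "q \<in> chart_dom (torus_chart M s)"
      "chart_map (torus_chart M s) p = chart_map (torus_chart M s) q"
    then obtain a b where ab: "p = pt a" "q = pt b" "a \<in> obox s" "b \<in> obox s" by auto
    then have "M *v a = M *v b" using pq(3) by simp
    then have "a = b" using matrix_inverse_props(1)[OF assms(1)] by metis
    then show "p = q" using ab by simp
  qed
  then show ?thesis using assms(2)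
    by (metis imageI inv_into_f_f torus_chart_simps)
qed

lemma open_matrix_image:
  fixes M :: "real^4^4"
  assumes "det M \<noteq> 0" "open S"
  shows "open ((*v) M ` S)"
proof -
  have "(*v) M ` S = (*v) (matrix_inv M) -` S"
    using matrix_inverse_props[OF assms(1)] by (auto simp: image_iff) metis
  then show ?thesis using assms(2) by (simp add: open_vimage matrix_vector_mult_linear_continuous_on)
qed

lemma expo_image_obox: "expo ` obox s = unit_torus \<inter> slit s"
  using expo_obox(1) branch_slit expo_in_unit_torus by (auto simp: image_iff) (metis)

lemma torus_chart_homeo:
  assumes M: "det M \<noteq> 0"
  shows "homeomorphic_map (subtopology torus_top (pt ` obox s)) (top_of_set ((*v) M ` obox s))
    (chart_map (torus_chart M s))"
proof -
  have 1: "homeomorphic_maps (subtopology torus_top (pt ` obox s)) (top_of_set (expo ` obox s)) the_elem (\<lambda>z. {z})"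
  proof -
    have "homeomorphic_maps (subtopology torus_top (pt ` obox s))
        (subtopology (top_of_set unit_torus) (expo ` obox s)) the_elem (\<lambda>z. {z})"
    proof (rule homeomorphic_maps_subtopologies[OF torus_homeo])
      have "topspace torus_top \<inter> pt ` obox s = pt ` obox s" by (auto simp: topspace_torus)
      moreover have "topspace (top_of_set unit_torus) \<inter> expo ` obox s = expo ` obox s"
        using expo_in_unit_torus by auto
      ultimately show "the_elem ` (topspace torus_top \<inter> pt ` obox s) = topspace (top_of_set unit_torus) \<inter> expo ` obox s"
        by (simp only: image_image the_elem_pt)
    qed
    moreover have "unit_torus \<inter> expo ` obox s = expo ` obox s" using expo_in_unit_torus by auto
    ultimately show ?thesis by (simp add: subtopology_subtopology)
  qed
  have 2: "homeomorphic_maps (top_of_set (expo ` obox s)) (top_of_set ((*v) M ` obox s))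
     (\<lambda>z. M *v branch s z) (\<lambda>y. expo (matrix_inv M *v y))"
    unfolding homeomorphic_maps_def
  proof (intro conjI ballI)
    have "continuous_on (expo ` obox s) (\<lambda>z. M *v branch s z)"
    proof (rule continuous_on_subset)
      show "continuous_on (slit s) (\<lambda>z. M *v branch s z)"
        by (rule continuous_on_compose2[OF matrix_vector_mult_linear_continuous_on[of UNIV] continuous_branch]) simp
    qed (auto simp: expo_image_obox)
    then show "continuous_map (top_of_set (expo ` obox s)) (top_of_set ((*v) M ` obox s)) (\<lambda>z. M *v branch s z)"
      by (auto simp: expo_obox)
    have "continuous_on ((*v) M ` obox s) (\<lambda>y. expo (matrix_inv M *v y))"
      by (rule continuous_on_compose2[OF continuous_expo[of UNIV] matrix_vector_mult_linear_continuous_on]) simp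
    then show "continuous_map (top_of_set ((*v) M ` obox s)) (top_of_set (expo ` obox s)) (\<lambda>y. expo (matrix_inv M *v y))"
      by (auto simp: matrix_inverse_props[OF M])
  qed (auto simp: expo_obox matrix_inverse_props[OF M])
  have "homeomorphic_map (subtopology torus_top (pt ` obox s)) (top_of_set ((*v) M ` obox s))
    ((\<lambda>z. M *v branch s z) \<circ> the_elem)"
    using homeomorphic_maps_compose[OF conjI[OF 1 2]] homeomorphic_map_maps by blast
  then show ?thesis by (simp add: torus_chart_def comp_def)
qed

text \<open>Two branches of the inverse of \<open>expo\<close> differ locally by a constant integral vector.\<close>

lemma torus_transition:
  fixes M :: "real^4^4" and s s' y :: "real^4"
  assumes M: "det M \<noteq> 0"
  defines "Y \<equiv> chart_map (torus_chart M s) ` (chart_dom (torus_chart M s) \<inter> chart_dom (torus_chart M s'))"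
  shows "open Y" "y \<in> Y \<Longrightarrow> \<exists>U b. open U \<and> y \<in> U \<and>
    (\<forall>u\<in>U. (chart_map (torus_chart M s') \<circ> chart_inv (torus_chart M s)) u = u + b)"
proof -
  have dom: "pt ` obox s \<inter> pt ` obox s' = pt ` {t \<in> obox s. expo t \<in> slit s'}"
  proof (intro subset_antisym subsetI)
    fix p assume "p \<in> pt ` {t \<in> obox s. expo t \<in> slit s'}"
    then obtain t where t: "p = pt t" "t \<in> obox s" "expo t \<in> slit s'" by auto
    have "pt t = pt (branch s' (expo t))"
      unfolding pt_def using branch_slit(2)[OF expo_in_unit_torus t(3)] by simp
    then show "p \<in> pt ` obox s \<inter> pt ` obox s'" using t branch_slit(1)[OF expo_in_unit_torus t(3)] by auto
  next
    fix p assume "p \<in> pt ` obox s \<inter> pt ` obox s'"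
    then obtain t t' where t: "p = pt t" "t \<in> obox s" "p = pt t'" "t' \<in> obox s'" by auto
    then have "expo t = expo t'" by (metis the_elem_pt)
    then have "expo t \<in> slit s'" using expo_obox(1)[OF t(4)] by simp
    then show "p \<in> pt ` {t \<in> obox s. expo t \<in> slit s'}" using t by auto
  qed
  have Y: "Y = (*v) M ` {t \<in> obox s. expo t \<in> slit s'}"
    unfolding Y_def torus_chart_simps dom image_image by (intro image_cong) auto
  have "open (expo -` slit s')" by (intro open_vimage open_slit continuous_expo)
  then have "open (obox s \<inter> expo -` slit s')" by (intro open_Int open_obox)
  moreover have "{t \<in> obox s. expo t \<in> slit s'} = obox s \<inter> expo -` slit s'" by auto
  ultimately show "open Y" unfolding Y using open_matrix_image[OF M] by simp
  assume "y \<in> Y"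
  then obtain t where t: "y = M *v t" "t \<in> obox s" "expo t \<in> slit s'" unfolding Y by auto
  define n where "n = branch s' (expo t) - t"
  have "pt (branch s' (expo t)) = pt t"
    unfolding pt_def using branch_slit(2)[OF expo_in_unit_torus t(3)] by simp
  then have n: "n $ k \<in> \<int>" for k unfolding n_def pt_eq_iff by simp
  define O' where "O' = obox s \<inter> (\<lambda>u. u + n) -` obox s'"
  have "open O'" unfolding O'_def by (intro open_Int open_obox open_vimage continuous_intros)
  moreover have "t \<in> O'" using t branch_slit(1)[OF expo_in_unit_torus t(3)] unfolding O'_def n_def by simp
  moreover have "(chart_map (torus_chart M s') \<circ> chart_inv (torus_chart M s)) (M *v u) = M *v u + M *v n" if "u \<in> O'" for u
  proof -
    have u: "u \<in> obox s" "u + n \<in> obox s'" using that unfolding O'_def by auto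
    have "pt u = pt (u + n)" unfolding pt_eq_iff using n by simp
    then have "chart_map (torus_chart M s') (chart_inv (torus_chart M s) (M *v u)) = M *v (u + n)"
      using torus_chart_inv[OF M u(1)] torus_chart_simps(2)[OF u(2)] by simp
    then show ?thesis by (simp add: matrix_vector_right_distrib)
  qed
  ultimately show "\<exists>U b. open U \<and> y \<in> U \<and>
    (\<forall>u\<in>U. (chart_map (torus_chart M s') \<circ> chart_inv (torus_chart M s)) u = u + b)"
    using open_matrix_image[OF M] t(1) by (intro exI[of _ "(*v) M ` O'"] exI[of _ "M *v n"]) auto
qed

lemma torus_manifold:
  assumes M: "det M \<noteq> 0"
  shows "compact_oriented_manifold (torus_manifold M)"
  unfolding compact_oriented_manifold_def
proof (intro conjI ballI)
  show "Hausdorff_space (top_of (torus_manifold M))" "compact_space (top_of (torus_manifold M))"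
    by (simp_all add: torus_manifold_def torus_compact_Hausdorff)
  show "(\<Union>c\<in>charts_of (torus_manifold M). chart_dom c) = topspace (top_of (torus_manifold M))"
  proof -
    have "t \<in> obox (t - (\<chi> k. 1/2))" for t by (simp add: obox_def)
    then show ?thesis by (auto simp: torus_manifold_def topspace_torus)
  qed
next
  fix c assume "c \<in> charts_of (torus_manifold M)"
  then obtain s where c: "c = torus_chart M s" by (auto simp: torus_manifold_def)
  show "openin (top_of (torus_manifold M)) (chart_dom c)"
  proof -
    have "openin torus_top (the_elem -` (unit_torus \<inter> slit s) \<inter> range pt)"
      unfolding torus_top_def openin_pullback_topology using open_slit[of s] by (auto simp: openin_open)
    moreover have "the_elem -` (unit_torus \<inter> slit s) \<inter> range pt = pt ` obox s"
      unfolding expo_image_obox[symmetric] by (auto simp: pt_def)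
    ultimately show ?thesis by (simp add: torus_manifold_def c)
  qed
  show "open (chart_img c)" unfolding c torus_chart_img by (rule open_matrix_image[OF M open_obox])
  show "homeomorphic_map (subtopology (top_of (torus_manifold M)) (chart_dom c)) (top_of_set (chart_img c)) (chart_map c)"
    unfolding c torus_chart_img using torus_chart_homeo[OF M] by (simp add: torus_manifold_def)
  fix d assume "d \<in> charts_of (torus_manifold M)"
  then obtain s' where d: "d = torus_chart M s'" by (auto simp: torus_manifold_def)
  show "smooth_on (chart_map c ` (chart_dom c \<inter> chart_dom d)) (chart_map d \<circ> chart_inv c)"
    unfolding c d
    by (rule smooth_on_locally_affine(1)[OF bounded_linear_ident torus_transition(1)[OF M]])
      (rule torus_transition(2)[OF M])
  fix y assume "y \<in> chart_map c ` (chart_dom c \<inter> chart_dom d)"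
  then have "((chart_map d \<circ> chart_inv c) has_derivative (\<lambda>h. h)) (at y)"
    unfolding c d
    by (intro smooth_on_locally_affine(2)[OF bounded_linear_ident torus_transition(1)[OF M] torus_transition(2)[OF M]])
  then have "frechet_derivative (chart_map d \<circ> chart_inv c) (at y) = (\<lambda>h. h)"
    by (rule frechet_derivative_at[symmetric])
  then have "jacobian (chart_map d \<circ> chart_inv c) (at y) = mat 1"
    unfolding jacobian_def using matrix_id_mat_1 by (simp add: id_def)
  then show "det (jacobian (chart_map d \<circ> chart_inv c) (at y)) > 0" by simp
qed

section \<open>Linear maps to the complex torus\<close>

context integral_quartic
begin

lemma torus_proj_eq_iff: "torus_proj L v = torus_proj L u \<longleftrightarrow> v - u \<in> L"
proof
  assume "torus_proj L v = torus_proj L u"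
  moreover have "v \<in> torus_proj L v" using zero_in_lattice by (auto simp: torus_proj_def intro: image_eqI[of _ _ 0])
  ultimately obtain l where "v = u + l" "l \<in> L" by (auto simp: torus_proj_def)
  then show "v - u \<in> L" by simp
next
  assume d: "v - u \<in> L"
  have "torus_proj L a \<subseteq> torus_proj L b" if "a - b \<in> L" for a b
  proof
    fix z assume "z \<in> torus_proj L a"
    then obtain l where l: "z = a + l" "l \<in> L" by (auto simp: torus_proj_def)
    have "z = b + ((a - b) + l)" by (simp add: l(1))
    then show "z \<in> torus_proj L b" unfolding torus_proj_def using lattice_add[OF that l(2)] by blast
  qed
  moreover have "u - v \<in> L" using lattice_diff[OF zero_in_lattice d] by simp
  ultimately show "torus_proj L v = torus_proj L u" using d by blast
qed

lemma lattice_discrete: "\<exists>U. open U \<and> 0 \<in> U \<and> U \<inter> L = {0}"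
proof (intro exI conjI)
  define U where "U = {z. \<forall>k. \<bar>re_coord z $ k\<bar> < 1 / denom \<and> \<bar>im_coord z $ k\<bar> < 1 / denom}"
  have "continuous_on UNIV re_coord" "continuous_on UNIV im_coord"
    unfolding re_coord_def im_coord_def
    by (intro continuous_on_compose2[OF matrix_vector_mult_linear_continuous_on[of UNIV]] continuous_intros; simp)+
  then have c: "continuous_on UNIV (\<lambda>z. re_coord z $ k)" "continuous_on UNIV (\<lambda>z. im_coord z $ k)" for k
    by (auto intro: continuous_on_component)
  have "U = (\<Inter>k. {z. \<bar>re_coord z $ k\<bar> < 1 / denom} \<inter> {z. \<bar>im_coord z $ k\<bar> < 1 / denom})" by (auto simp: U_def)
  also have "open \<dots>"
    by (intro open_INT open_Int open_Collect_less ballI continuous_on_rabs c) simp_all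
  finally show "open U" .
  have z0: "re_coord 0 = 0" "im_coord 0 = 0" using re_coord_diff[of 0 0] im_coord_diff[of 0 0] by simp_all
  show "0 \<in> U" unfolding U_def using denom_pos by (simp add: z0)
  have "l = 0" if "l \<in> U" "l \<in> L" for l
  proof -
    obtain a b where l: "l = Psi a b" "\<And>k. real denom * a $ k \<in> \<int>" "\<And>k. real denom * b $ k \<in> \<int>"
      using lattice_denominators[OF \<open>l \<in> L\<close>] by blast
    have z: "r = 0" if "real denom * r \<in> \<int>" "\<bar>r\<bar> < 1 / denom" for r
    proof -
      have "\<bar>real denom * r\<bar> < 1" using that(2) denom_pos by (simp add: abs_mult field_simps)
      then have "real denom * r = 0" using that(1) by (metis Ints_nonzero_abs_less1)
      then show "r = 0" using denom_pos by simp
    qed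
    have "a $ k = 0" "b $ k = 0" for k
      using z[OF l(2)[of k]] z[OF l(3)[of k]] \<open>l \<in> U\<close> unfolding U_def l(1) by auto
    then have "re_coord l = re_coord 0" "im_coord l = im_coord 0"
      by (simp_all add: l(1) z0 vec_eq_iff)
    then show "l = 0" by (metis Psi_coords)
  qed
  then show "U \<inter> L = {0}" using \<open>0 \<in> U\<close> zero_in_lattice by blast
qed

definition compatible :: "(real^4 \<Rightarrow> complex^4) \<Rightarrow> bool" where
  "compatible \<Phi> \<longleftrightarrow> linear \<Phi> \<and> (\<forall>n. (\<forall>k. n $ k \<in> \<int>) \<longrightarrow> \<Phi> (V *v n) \<in> L)"

text \<open>The map induced on quotients by a linear map \<open>\<Phi>\<close>; by compatibility the choice of \<open>t\<close> does not matter
  (\<open>torus_map_pt\<close>).\<close>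

definition torus_map :: "(real^4 \<Rightarrow> complex^4) \<Rightarrow> (complex^4) set \<Rightarrow> (complex^4) set" where
  "torus_map \<Phi> S = torus_proj L (\<Phi> (V *v (SOME t. pt t = S)))"

abbreviation "N \<equiv> torus_manifold V"

lemma det_V_nz: "det V \<noteq> 0" using det_V_pos by simp

lemma torus_map_pt:
  assumes "compatible \<Phi>"
  shows "torus_map \<Phi> (pt t) = torus_proj L (\<Phi> (V *v t))"
proof -
  define t' where "t' = (SOME t'. pt t' = pt t)"
  have "pt t' = pt t" unfolding t'_def by (rule someI) (rule refl)
  then have "\<forall>k. (t' - t) $ k \<in> \<int>" unfolding pt_eq_iff by simp
  then have "\<Phi> (V *v (t' - t)) \<in> L" using assms unfolding compatible_def by blast
  moreover have "\<Phi> (V *v (t' - t)) = \<Phi> (V *v t') - \<Phi> (V *v t)"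
    using assms unfolding compatible_def by (simp add: matrix_vector_mult_diff_distrib linear_diff)
  ultimately show ?thesis unfolding torus_map_def t'_def[symmetric] torus_proj_eq_iff by simp
qed

lemma N_charts: "ch \<in> charts_of N \<longleftrightarrow> (\<exists>s. ch = torus_chart V s)"
  by (auto simp: torus_manifold_def)

lemma chart_inv_img:
  assumes "u \<in> chart_img (torus_chart V s)"
  obtains t where "t \<in> obox s" "u = V *v t" "chart_inv (torus_chart V s) u = pt t"
  using assms torus_chart_inv[OF det_V_nz] unfolding torus_chart_img by blast

lemma torus_map_chart:
  assumes "compatible \<Phi>" "u \<in> chart_img (torus_chart V s)"
  shows "torus_map \<Phi> (chart_inv (torus_chart V s) u) = torus_proj L (\<Phi> u)"
  using chart_inv_img[OF assms(2)] torus_map_pt[OF assms(1)] by metis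

lemma local_lift_exists:
  assumes \<Phi>: "compatible \<Phi>" and q: "q \<in> chart_img (torus_chart V s)"
  shows "local_lift L (torus_chart V s) (torus_map \<Phi>) q \<Phi>"
  unfolding local_lift_def
proof (intro exI[of _ "chart_img (torus_chart V s)"] conjI ballI q subset_refl)
  have op: "open (chart_img (torus_chart V s))"
    unfolding torus_chart_img by (rule open_matrix_image[OF det_V_nz open_obox])
  have "bounded_linear \<Phi>" using \<Phi> unfolding compatible_def by (simp add: linear_conv_bounded_linear)
  then show "smooth_on (chart_img (torus_chart V s)) \<Phi>"
    using op
  proof (rule smooth_on_locally_affine(1))
    fix u
    show "\<exists>U b. open U \<and> u \<in> U \<and> (\<forall>u\<in>U. \<Phi> u = \<Phi> u + b)"
      by (intro exI[of _ UNIV] exI[of _ 0]) simp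
  qed
qed (rule torus_map_chart[OF \<Phi>])

text \<open>Any two local lifts differ by a continuous function with values in the lattice, which is locally
  constant because the lattice is discrete.  So every lift has the derivative \<open>\<Phi>\<close>.\<close>

lemma local_lift_derivative:
  assumes \<Phi>: "compatible \<Phi>" and q: "q \<in> chart_img (torus_chart V s)"
    and g: "local_lift L (torus_chart V s) (torus_map \<Phi>) q g"
  shows "(g has_derivative \<Phi>) (at q)"
proof -
  obtain W where W: "q \<in> W" "W \<subseteq> chart_img (torus_chart V s)" "smooth_on W g"
    "\<And>u. u \<in> W \<Longrightarrow> torus_map \<Phi> (chart_inv (torus_chart V s) u) = torus_proj L (g u)"
    using g unfolding local_lift_def by blast
  have openW: "open W" and gc: "continuous_on W g" using W(3) unfolding smooth_on_def by (auto dest: spec[of _ 0])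
  have bl: "bounded_linear \<Phi>" using \<Phi> unfolding compatible_def by (simp add: linear_conv_bounded_linear)
  define h where "h u = g u - \<Phi> u" for u
  have hL: "h u \<in> L" if "u \<in> W" for u
  proof -
    have "torus_proj L (g u) = torus_proj L (\<Phi> u)"
      using torus_map_chart[OF \<Phi>, of u s] W(2,4) that by auto
    then show ?thesis unfolding h_def torus_proj_eq_iff .
  qed
  obtain U where U: "open U" "0 \<in> U" "U \<inter> L = {0}" using lattice_discrete by blast
  have "continuous_on W (\<lambda>u. h u - h q)"
    unfolding h_def by (intro continuous_intros gc linear_continuous_on bl)
  then obtain B where B: "open B" "B \<inter> W = (\<lambda>u. h u - h q) -` U \<inter> W"
    using U(1) unfolding continuous_on_open_invariant by blast
  have hq: "h u - h q = 0" if "u \<in> B \<inter> W" for u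
    using that B(2) U(3) lattice_diff[OF hL hL, of u q] W(1) by blast
  have eq: "\<Phi> u + h q = g u" if "u \<in> B \<inter> W" for u
  proof -
    have "h q = h u" using hq[OF that] by simp
    then show ?thesis by (simp add: h_def)
  qed
  have "((\<lambda>u. \<Phi> u + h q) has_derivative \<Phi>) (at q)"
    using bounded_linear_imp_has_derivative[OF bl, of "at q"] by (auto intro!: derivative_eq_intros)
  then show ?thesis
  proof (rule has_derivative_transform_within_open)
    show "open (B \<inter> W)" using B(1) openW by blast
    show "q \<in> B \<inter> W" using B(2) W(1) U(2) by auto
  qed (rule eq)
qed

lemma torus_deriv_torus_map:
  assumes \<Phi>: "compatible \<Phi>" and q: "q \<in> chart_img (torus_chart V s)"
  shows "torus_deriv L (torus_chart V s) (torus_map \<Phi>) q = \<Phi>"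
proof -
  have "local_lift L (torus_chart V s) (torus_map \<Phi>) q (SOME g. local_lift L (torus_chart V s) (torus_map \<Phi>) q g)"
    by (rule someI[of "local_lift L (torus_chart V s) (torus_map \<Phi>) q" \<Phi>, OF local_lift_exists[OF assms]])
  from frechet_derivative_at[OF local_lift_derivative[OF assms this]]
  show ?thesis unfolding torus_deriv_def by (rule sym)
qed

lemma smooth_torus_map: "compatible \<Phi> \<Longrightarrow> smooth_to_torus L N (torus_map \<Phi>)"
  unfolding smooth_to_torus_def
proof (intro ballI)
  fix ch q assume \<Phi>: "compatible \<Phi>" and ch: "ch \<in> charts_of N" and q: "q \<in> chart_img ch"
  obtain s where s: "ch = torus_chart V s" using ch unfolding N_charts ..
  show "\<exists>g. local_lift L ch (torus_map \<Phi>) q g"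
    using local_lift_exists[OF \<Phi> q[unfolded s]] unfolding s by (rule exI[of _ \<Phi>])
qed

definition frame :: "(real^4 \<Rightarrow> complex^4) \<Rightarrow> nat \<Rightarrow> complex^4" where
  "frame \<Phi> i = \<Phi> (axis (of_nat (i + 1)) 1)"

lemma pullback_coeff_torus_map:
  assumes "compatible \<Phi>" "q \<in> chart_img (torus_chart V s)"
  shows "pullback_coeff L (torus_chart V s) (torus_map \<Phi>) b q = b (frame \<Phi>)"
  unfolding pullback_coeff_def torus_deriv_torus_map[OF assms] frame_def ..

text \<open>The integral over the torus is cut into the sixteen translates of the cube with side \<open>1/2\<close>.  The chart of a cell
  starts at distance \<open>1/4\<close> from its corner, so that its box of side 1 contains the half-open cell.\<close>

definition corner :: "4 set \<Rightarrow> real^4" where "corner K = (\<chi> k. if k \<in> K then 1/2 else 0)"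
definition cell :: "4 set \<Rightarrow> (real^4) set" where
  "cell K = hbox (\<lambda>k. corner K $ k) (\<lambda>k. corner K $ k + 1/2)"
definition cell_chart :: "4 set \<Rightarrow> (complex^4) set chart" where
  "cell_chart K = torus_chart V (corner K - (\<chi> k. 1/4))"

lemma cell_obox: "cell K \<subseteq> obox (corner K - (\<chi> k. 1/4))"
proof
  fix t assume "t \<in> cell K"
  then have t: "corner K $ k \<le> t $ k" "t $ k < corner K $ k + 1/2" for k
    unfolding cell_def hbox_def by blast+
  show "t \<in> obox (corner K - (\<chi> k. 1/4))"
    unfolding obox_def mem_Collect_eq vector_minus_component vec_lambda_beta
  proof
    fix k
    show "corner K $ k - 1/4 < t $ k \<and> t $ k < corner K $ k - 1/4 + 1"
      using t[of k] by linarith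
  qed
qed

lemma cell_unit: "t \<in> cell K \<Longrightarrow> 0 \<le> t $ k \<and> t $ k < 1"
proof -
  assume "t \<in> cell K"
  then have "corner K $ k \<le> t $ k \<and> t $ k < corner K $ k + 1/2" unfolding cell_def hbox_def by blast
  then show ?thesis by (simp add: corner_def split: if_splits)
qed

lemma cell_corner: "t \<in> cell K \<Longrightarrow> K = {k. t $ k \<ge> 1/2}"
proof -
  assume t: "t \<in> cell K"
  have "k \<in> K \<longleftrightarrow> t $ k \<ge> 1/2" for k
  proof -
    have "corner K $ k \<le> t $ k \<and> t $ k < corner K $ k + 1/2" using t unfolding cell_def hbox_def by blast
    then show ?thesis by (simp add: corner_def split: if_splits)
  qed
  then show ?thesis by auto
qed

lemma unit_cell: "(\<And>k. 0 \<le> t $ k \<and> t $ k < 1) \<Longrightarrow> t \<in> cell {k. t $ k \<ge> 1/2}"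
  unfolding cell_def hbox_def corner_def by auto

lemma pt_unit_inj:
  assumes "\<And>k. 0 \<le> t $ k \<and> t $ k < 1" "\<And>k. 0 \<le> t' $ k \<and> t' $ k < 1" "pt t = pt t'"
  shows "t = t'"
proof -
  have "t $ k - t' $ k = 0" for k
  proof (rule ccontr)
    assume "t $ k - t' $ k \<noteq> 0"
    moreover have "t $ k - t' $ k \<in> \<int>" using assms(3) unfolding pt_eq_iff by blast
    moreover have "\<bar>t $ k - t' $ k\<bar> < 1" using assms(1)[of k] assms(2)[of k] by linarith
    ultimately show False by (metis Ints_nonzero_abs_less1)
  qed
  then show ?thesis by (simp add: vec_eq_iff)
qed

lemma has_form_integral_torus_map:
  assumes \<Phi>: "compatible \<Phi>"
  shows "has_form_integral L N (torus_map \<Phi>) b (of_real (det V) * b (frame \<Phi>))"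
proof -
  define P where "P = (\<lambda>K. (cell_chart K, pt ` cell K)) ` (UNIV :: 4 set set)"
  have ne: "corner K \<in> cell K" for K by (simp add: cell_def hbox_def)
  have disj: "K = K'" if pp: "p \<in> pt ` cell K" "p \<in> pt ` cell K'" for p K K'
  proof -
    obtain t t' where t: "p = pt t" "t \<in> cell K" "p = pt t'" "t' \<in> cell K'" using pp by blast
    then have "t = t'" using pt_unit_inj cell_unit by metis
    then show ?thesis using cell_corner t by metis
  qed
  have inj: "inj (\<lambda>K. (cell_chart K, pt ` cell K))"
  proof (rule injI)
    fix K K' assume "(cell_chart K, pt ` cell K) = (cell_chart K', pt ` cell K')"
    then have "pt (corner K) \<in> pt ` cell K" "pt (corner K) \<in> pt ` cell K'" using ne[of K] by auto
    then show "K = K'" by (rule disj)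
  qed
  have img: "chart_map (cell_chart K) ` (pt ` cell K) = (*v) V ` cell K" for K
    unfolding cell_chart_def image_image using cell_obox[of K] by (intro image_cong) auto
  have sub: "(*v) V ` cell K \<subseteq> chart_img (cell_chart K)" for K
    unfolding cell_chart_def torus_chart_img using cell_obox[of K] by blast
  note cell_meas = measure_matrix_image_hbox[OF det_V_nz, of "\<lambda>k. corner K $ k" "\<lambda>k. corner K $ k + 1/2" for K, folded cell_def]
  have borel: "(*v) V ` cell K \<in> sets lborel" for K using cell_meas(1)[of K] by simp
  have fin: "emeasure lborel ((*v) V ` cell K) < \<infinity>" for K
    using emeasure_lborel_finite[OF cell_meas(1,2)[of K]] by simp
  have meas: "measure lborel ((*v) V ` cell K) = det V / 16" for K
    using cell_meas(3)[of K] det_V_pos by (simp add: power4_eq_xxxx)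
  have coeff: "pullback_coeff L (cell_chart K) (torus_map \<Phi>) b q = b (frame \<Phi>)" if "q \<in> (*v) V ` cell K" for q K
  proof -
    have "q \<in> chart_img (torus_chart V (corner K - (\<chi> k. 1/4)))" using sub[of K] that unfolding cell_chart_def by blast
    then show ?thesis unfolding cell_chart_def by (rule pullback_coeff_torus_map[OF \<Phi>])
  qed
  have intb: "set_integrable lborel ((*v) V ` cell K) (pullback_coeff L (cell_chart K) (torus_map \<Phi>) b)" for K
  proof -
    have "set_integrable lborel ((*v) V ` cell K) (\<lambda>_. b (frame \<Phi>))"
      unfolding set_integrable_def using borel fin by (intro integrable_scaleR_left) (simp add: integrable_indicator_iff)
    then show ?thesis by (subst set_integrable_cong[OF refl refl coeff]) auto
  qed
  have val: "set_lebesgue_integral lborel ((*v) V ` cell K) (pullback_coeff L (cell_chart K) (torus_map \<Phi>) b)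
      = of_real (det V / 16) * b (frame \<Phi>)" for K
  proof -
    have "set_lebesgue_integral lborel ((*v) V ` cell K) (pullback_coeff L (cell_chart K) (torus_map \<Phi>) b)
        = set_lebesgue_integral lborel ((*v) V ` cell K) (\<lambda>_. b (frame \<Phi>))"
      using borel coeff by (intro set_lebesgue_integral_cong) auto
    also have "\<dots> = measure lborel ((*v) V ` cell K) *\<^sub>R b (frame \<Phi>)"
      unfolding set_lebesgue_integral_def using borel fin by simp
    finally show ?thesis unfolding meas by (simp add: scaleR_conv_of_real)
  qed
  show ?thesis unfolding has_form_integral_def
  proof (intro exI[of _ P] conjI)
    show "finite P" unfolding P_def by simp
    show "disjoint_family_on snd P" unfolding disjoint_family_on_def
    proof (intro ballI impI)
      fix p q assume pq: "p \<in> P" "q \<in> P" "p \<noteq> q"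
      from pq(1) obtain K where K: "p = (cell_chart K, pt ` cell K)" unfolding P_def by blast
      from pq(2) obtain K' where K': "q = (cell_chart K', pt ` cell K')" unfolding P_def by blast
      have "K \<noteq> K'" using pq(3) unfolding K K' by blast
      then show "snd p \<inter> snd q = {}" unfolding K K' snd_conv using disj by blast
    qed
    show "(\<Union>p\<in>P. snd p) = topspace (top_of N)"
    proof -
      have "p \<in> (\<Union>K. pt ` cell K)" if rp: "p \<in> range pt" for p
      proof -
        obtain t where "p = pt t" using rp by blast
        also have "\<dots> = pt (\<chi> k. frac (t $ k))" by (auto simp: pt_eq_iff frac_def)
        finally have p: "p = pt (\<chi> k. frac (t $ k))" .
        have "(\<chi> k. frac (t $ k)) \<in> cell {k. (\<chi> k. frac (t $ k)) $ k \<ge> 1/2}"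
          by (rule unit_cell) (simp add: frac_ge_0 frac_lt_1)
        then show ?thesis using p by blast
      qed
      then show ?thesis unfolding P_def by (auto simp: torus_manifold_def topspace_torus)
    qed
    show "\<forall>(c, B)\<in>P. c \<in> charts_of N \<and> B \<subseteq> chart_dom c \<and> chart_map c ` B \<in> sets lborel
        \<and> set_integrable lborel (chart_map c ` B) (pullback_coeff L c (torus_map \<Phi>) b)"
    proof -
      have "cell_chart K \<in> charts_of N" "pt ` cell K \<subseteq> chart_dom (cell_chart K)" for K
        unfolding N_charts cell_chart_def using cell_obox[of K] by auto
      then show ?thesis unfolding P_def using img borel intb by auto
    qed
    have "(\<Sum>(c, B)\<in>P. set_lebesgue_integral lborel (chart_map c ` B) (pullback_coeff L c (torus_map \<Phi>) b))
        = (\<Sum>K\<in>(UNIV :: 4 set set). of_real (det V / 16) * b (frame \<Phi>))"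
      unfolding P_def sum.reindex[OF inj] by (simp only: comp_def prod.case img val)
    also have "\<dots> = of_real (det V) * b (frame \<Phi>)" by simp
    finally show "of_real (det V) * b (frame \<Phi>) = (\<Sum>(c, B)\<in>P. set_lebesgue_integral lborel (chart_map c ` B) (pullback_coeff L c (torus_map \<Phi>) b))"
      by (rule sym)
  qed
qed

end

section \<open>The planes are Cayley\<close>

lemma lessThan_4: "{..<4::nat} = {0, 1, 2, 3}"
  by auto

lemma Alt_2: "Alt 2 f v = f (\<lambda>i. v i) - f (\<lambda>i. v (swp 0 1 i))"
proof -
  have l: "{..<2::nat} = {0, 1}" by auto
  have f: "finite {1::nat}" "0 \<notin> {1::nat}" by auto
  show ?thesis
    unfolding Alt_def l sum_over_permutations_insert[OF f] permutes_sing
    by (simp add: sign_swap_id sign_id)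
qed

lemma Alt_4_det:
  "Alt 4 (lin_prod 4 \<alpha>) v = det (\<chi> k i. \<alpha> (pw k) (v (pw i)))"
proof -
  have f: "finite {1::nat, 2, 3}" "0 \<notin> {1::nat, 2, 3}" "finite {2::nat, 3}" "1 \<notin> {2::nat, 3}" "finite {3::nat}" "2 \<notin> {3::nat}"
    by auto
  show ?thesis
    unfolding det_4 Alt_def lin_prod_def lessThan_4
    unfolding sum_over_permutations_insert[OF f(1,2)] sum_over_permutations_insert[OF f(3,4)]
      sum_over_permutations_insert[OF f(5,6)] permutes_sing
    by (simp add: sign_swap_id permutation_swap_id sign_compose sign_id permutation_compose Transposition.transpose_def)
qed

text \<open>The set of places with a conjugation is given by the predicate \<open>B\<close>.  The forms in \<open>M\<close> and \<open>M'\<close> arise from \<open>odd\<close> and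
  \<open>even\<close> because the indices are counted from 0.\<close>

definition coord :: "(nat \<Rightarrow> bool) \<Rightarrow> nat \<Rightarrow> complex^4 \<Rightarrow> complex" where
  "coord B k u = (if B k then cnj (u $ idx k) else u $ idx k)"

lemma linear_coord: "linear (coord B k)"
  unfolding coord_def by (auto simp: linear_iff)

lemma coord_axis: "k < 4 \<Longrightarrow> j < 4 \<Longrightarrow> j \<noteq> k \<Longrightarrow> coord B k (axis (idx j) z) = 0"
  by (simp add: coord_def axis_def idx_eq_iff)

abbreviation coord_form :: "(nat \<Rightarrow> bool) \<Rightarrow> form" where
  "coord_form B \<equiv> Alt 4 (lin_prod 4 (coord B))"

lemma alt_form_coord: "alt_form 4 (coord_form B)"
  by (rule alt_form_Alt_lin_prod) (rule linear_coord)

lemma prod_lessThan_4: "prod f {..<4::nat} = f 0 * f 1 * f 2 * f 3"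
  by (simp add: lessThan_4 mult_ac)

lemma wedge4_coord_form:
  "wedge4 (dz 1) (dz 2) (dz 3) (dz 4) = coord_form (\<lambda>_. False)"
  "wedge4 (dz 1) (dzb 2) (dz 3) (dzb 4) = coord_form odd"
  "wedge4 (dzb 1) (dz 2) (dzb 3) (dz 4) = coord_form even"
  unfolding wedge4_Alt dz_def dzb_def lin_prod_def prod_lessThan_4 by (simp_all add: coord_def)

lemma wedge_1_1_dz: "wedge 1 1 (dz j) (dzb k) v = v 0 $ j * cnj (v 1 $ k) - v 1 $ j * cnj (v 0 $ k)"
  unfolding wedge_1_1 Alt_2 by (simp add: dz_def dzb_def Transposition.transpose_def)

lemma wedge4_explicit:
  fixes f g h e :: "complex^4 \<Rightarrow> complex"
  shows "wedge4 (\<lambda>v. f (v 0)) (\<lambda>v. g (v 0)) (\<lambda>v. h (v 0)) (\<lambda>v. e (v 0)) v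
    = det (\<chi> k i. (if k = 1 then f else if k = 2 then g else if k = 3 then h else e) (v (pw i)))"
proof -
  define \<alpha> where "\<alpha> k = (if k = 0 then f else if k = 1 then g else if k = 2 then h else e)" for k :: nat
  have "wedge4 (\<lambda>v. f (v 0)) (\<lambda>v. g (v 0)) (\<lambda>v. h (v 0)) (\<lambda>v. e (v 0)) = Alt 4 (lin_prod 4 \<alpha>)"
    unfolding wedge4_Alt lin_prod_def prod_lessThan_4 by (simp add: \<alpha>_def numeral_eq_Suc)
  moreover have "(\<chi> k i. \<alpha> (pw k) (v (pw i))) = (\<chi> k i. (if k = 1 then f else if k = 2 then g else if k = 3 then h else e) (v (pw i)))"
    by (simp add: vec_eq_iff forall_4 \<alpha>_def)
  ultimately show ?thesis by (simp add: Alt_4_det)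
qed

lemma wedge4_dz_sort:
  "wedge4 (dz 1) (dzb 2) (dz 3) (dzb 4) v = - wedge4 (dz 1) (dz 3) (dzb 2) (dzb 4) v"
  "wedge4 (dzb 1) (dz 2) (dzb 3) (dz 4) v = - wedge4 (dz 2) (dz 4) (dzb 1) (dzb 3) v"
  unfolding dz_def dzb_def
    wedge4_explicit[of "\<lambda>u. u $ 1" "\<lambda>u. cnj (u $ 2)" "\<lambda>u. u $ 3" "\<lambda>u. cnj (u $ 4)" v]
    wedge4_explicit[of "\<lambda>u. u $ 1" "\<lambda>u. u $ 3" "\<lambda>u. cnj (u $ 2)" "\<lambda>u. cnj (u $ 4)" v]
    wedge4_explicit[of "\<lambda>u. cnj (u $ 1)" "\<lambda>u. u $ 2" "\<lambda>u. cnj (u $ 3)" "\<lambda>u. u $ 4" v]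
    wedge4_explicit[of "\<lambda>u. u $ 2" "\<lambda>u. u $ 4" "\<lambda>u. cnj (u $ 1)" "\<lambda>u. cnj (u $ 3)" v]
    det_4
  by (simp_all add: algebra_simps)

lemma sum_single: "(\<Sum>m\<in>UNIV. if Q \<and> m = q then g m else 0) = (if Q then g q else 0)"
  for q :: "'a::finite" and g :: "'a \<Rightarrow> 'b::comm_monoid_add"
  by (cases Q) simp_all

lemma sum_single_4:
  "(\<Sum>j\<in>UNIV. \<Sum>k\<in>UNIV. \<Sum>l\<in>UNIV. \<Sum>m\<in>UNIV. (if (j, k, l, m) = (a, b, p, q) then z else 0) * f j k l m) = z * f a b p q"
  for a b p q :: "4" and z :: complex
proof -
  have "(if (j, k, l, m) = (a, b, p, q) then z else 0) * f j k l m
      = (if (((True \<and> j = a) \<and> k = b) \<and> l = p) \<and> m = q then z * f j k l m else 0)" for j k l m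
    by simp
  then show ?thesis by (simp only: sum_single if_True)
qed

lemma type_2_2_weil: "type_2_2 (\<lambda>v. r * coord_form odd v + s * coord_form even v)"
proof -
  define C :: "4 \<Rightarrow> 4 \<Rightarrow> 4 \<Rightarrow> 4 \<Rightarrow> complex" where
    "C j k l m = (if (j, k, l, m) = (1, 3, 2, 4) then - r else 0) + (if (j, k, l, m) = (2, 4, 1, 3) then - s else 0)" for j k l m
  have "r * coord_form odd v + s * coord_form even v
    = (\<Sum>j\<in>UNIV. \<Sum>k\<in>UNIV. \<Sum>l\<in>UNIV. \<Sum>m\<in>UNIV. C j k l m * wedge4 (dz j) (dz k) (dzb l) (dzb m) v)" for v
    unfolding C_def distrib_right sum.distrib sum_single_4
    by (simp add: wedge4_dz_sort flip: wedge4_coord_form)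
  then show ?thesis unfolding type_2_2_def by blast
qed

lemma Alt_diagonal:
  assumes "\<And>j k. j < 4 \<Longrightarrow> k < 4 \<Longrightarrow> j \<noteq> k \<Longrightarrow> \<alpha> k (v j) = 0"
  shows "Alt 4 (lin_prod 4 \<alpha>) v = (\<Prod>k<4. \<alpha> k (v k))"
  unfolding Alt_4_det det_4 prod_lessThan_4 by (simp add: assms)

context integral_quartic
begin

text \<open>Multiplication of real points by \<open>s + t \<i> D\<close>; \<open>scal s t j\<close> is the conjugate of this number under the \<open>j\<close>-th
  embedding, and \<open>rho s t\<close> its norm to \<open>\<rat>\<close>.\<close>

definition plane :: "real \<Rightarrow> real \<Rightarrow> real^4 \<Rightarrow> complex^4" where
  "plane s t u = (\<chi> j. Complex (s * u $ j) (t * eps j * D * u $ j))"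

definition scal :: "real \<Rightarrow> real \<Rightarrow> 4 \<Rightarrow> complex" where
  "scal s t j = Complex s (t * eps j * D)"

lemma plane_nth: "plane s t u $ j = scal s t j * of_real (u $ j)"
  by (simp add: plane_def scal_def complex_eq_iff)

lemma compatible_plane:
  assumes "s \<in> \<int>" "t \<in> \<int>"
  shows "compatible (plane s t)"
proof -
  have "linear (plane s t)"
    by (rule linearI) (simp_all add: vec_eq_iff plane_def complex_eq_iff algebra_simps)
  moreover have "plane s t (V *v n) \<in> L" if "\<forall>k. n $ k \<in> \<int>" for n
  proof -
    have "s *\<^sub>R n \<in> intvec" "t *\<^sub>R n \<in> intvec" using assms that by (simp_all add: intvec_def)
    then have "Psi (s *\<^sub>R n) (t *\<^sub>R n) \<in> L" by (rule lattice_contains_integral)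
    moreover have "Psi (s *\<^sub>R n) (t *\<^sub>R n) = plane s t (V *v n)"
      by (simp add: Psi_def plane_def vec_eq_iff matrix_vector_mult_scaleR)
    ultimately show ?thesis by simp
  qed
  ultimately show ?thesis unfolding compatible_def by blast
qed

lemma frame_plane: "k < 4 \<Longrightarrow> frame (plane s t) k = s *\<^sub>R ef k + (t * D * eps (idx k)) *\<^sub>R jf k"
  unfolding frame_def idx_def[symmetric] vec_eq_iff plane_nth
  by (simp add: ef_def jf_def axis_def scal_def complex_eq_iff)

lemma frame_plane_nth: "j < 4 \<Longrightarrow> k < 4 \<Longrightarrow> frame (plane s t) k $ idx j = (if j = k then scal s t (idx k) else 0)"
  unfolding frame_def idx_def[symmetric] plane_nth by (simp add: axis_def idx_eq_iff)

definition rho :: "real \<Rightarrow> real \<Rightarrow> real" where "rho s t = s\<^sup>2 + (t * D)\<^sup>2"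

lemma scal_cnj: "scal s t j * cnj (scal s t j) = of_real (rho s t)"
  by (simp add: scal_def rho_def complex_eq_iff power2_eq_square algebra_simps)

lemma rho_pos: "s \<noteq> 0 \<or> t \<noteq> 0 \<Longrightarrow> rho s t > 0"
  using D_pos by (cases "t = 0") (simp_all add: rho_def add_nonneg_pos)

lemma kahler_eq: "kahler x v = \<i> / of_real D * (\<Sum>j\<in>UNIV. of_real (eps j * mu x j) * (v 0 $ j * cnj (v 1 $ j) - v 1 $ j * cnj (v 0 $ j)))"
  unfolding kahler_def wedge_1_1_dz D_square[symmetric] using D_pos by (simp add: power2_eq_square)

lemma kahler_plane: "v 0 = plane s t a \<Longrightarrow> v 1 = plane s t b \<Longrightarrow> kahler x v = 0"
  by (simp add: kahler_eq plane_nth)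

lemma metric_plane:
  "metric x (plane s t a) (plane s t b) = 2 * rho s t / D * (\<Sum>j\<in>UNIV. eps j * mu x j * (a $ j * b $ j))"
proof -
  have e: "plane s t a $ j * cnj (\<i> * plane s t b $ j) - \<i> * plane s t b $ j * cnj (plane s t a $ j)
      = - 2 * \<i> * of_real (rho s t * (a $ j * b $ j))" for j
  proof -
    have "plane s t a $ j * cnj (\<i> * plane s t b $ j) - \<i> * plane s t b $ j * cnj (plane s t a $ j)
        = - 2 * \<i> * (scal s t j * cnj (scal s t j)) * of_real (a $ j * b $ j)"
      by (simp add: plane_nth algebra_simps)
    then show ?thesis unfolding scal_cnj by simp
  qed
  have "kahler x (\<lambda>i. if i = 0 then plane s t a else (\<chi> j. \<i> * plane s t b $ j))
    = \<i> / of_real D * (\<Sum>j\<in>UNIV. of_real (eps j * mu x j) *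
        (plane s t a $ j * cnj (\<i> * plane s t b $ j) - \<i> * plane s t b $ j * cnj (plane s t a $ j)))"
    unfolding kahler_eq by simp
  also have "\<dots> = (\<Sum>j\<in>UNIV. \<i> / of_real D * (of_real (eps j * mu x j) * (- 2 * \<i> * of_real (rho s t * (a $ j * b $ j)))))"
    unfolding e by (rule sum_distrib_left)
  also have "\<dots> = (\<Sum>j\<in>UNIV. of_real (2 * rho s t / D * (eps j * mu x j * (a $ j * b $ j))))"
    by (intro sum.cong refl) (simp add: field_simps)
  also have "\<dots> = of_real (2 * rho s t / D * (\<Sum>j\<in>UNIV. eps j * mu x j * (a $ j * b $ j)))"
    by (simp add: sum_distrib_left)
  finally have "kahler x (\<lambda>i. if i = 0 then plane s t a else (\<chi> j. \<i> * plane s t b $ j))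
    = of_real (2 * rho s t / D * (\<Sum>j\<in>UNIV. eps j * mu x j * (a $ j * b $ j)))" .
  then show ?thesis unfolding metric_def by simp
qed

text \<open>Each difference of two roots occurs twice in the product.\<close>

lemma prod_eps_mu: "(\<Prod>j\<in>UNIV. eps j * mu x j) = D\<^sup>2"
proof -
  have c: "UNIV - {1::4} = {2, 3, 4}" "UNIV - {2::4} = {1, 3, 4}" "UNIV - {3::4} = {1, 2, 4}" "UNIV - {4::4} = {1, 2, 3}"
    unfolding UNIV_4 by auto
  define p q r p' q' r' where "p = x 1 - x 2" "q = x 1 - x 3" "r = x 1 - x 4"
    "p' = x 2 - x 3" "q' = x 2 - x 4" "r' = x 3 - x 4"
  note defs = this
  have mu: "mu x 1 = p * q * r" "mu x 2 = - (p * p' * q')" "mu x 3 = q * p' * r'" "mu x 4 = - (r * q' * r')"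
    unfolding mu_def c defs by (simp_all add: algebra_simps)
  have D: "D = p * q * r * p' * q' * r'" unfolding disc_root_def defs ..
  have "(\<Prod>j\<in>UNIV. eps j * mu x j) = (p * q * r) * (p * p' * q') * (q * p' * r') * (r * q' * r')"
    unfolding UNIV_4 by (simp add: mu)
  then show ?thesis unfolding D by (simp add: power2_eq_square mult_ac)
qed

lemma wedge_kahler_plane:
  assumes "\<And>i. \<exists>a. v i = plane s t a"
  shows "wedge 2 2 (kahler x) (kahler x) v = 0"
proof -
  have "kahler x (\<lambda>i. v (\<sigma> i)) = 0" for \<sigma>
    using assms[of "\<sigma> 0"] assms[of "\<sigma> 1"] kahler_plane by metis
  then show ?thesis unfolding wedge_def by simp
qed

lemma prod_scal: "(\<Prod>k<4. scal s t (idx k)) = of_real ((rho s t)\<^sup>2)"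
proof -
  have m: "scal s t 2 = cnj (scal s t 1)" "scal s t 3 = scal s t 1" "scal s t 4 = cnj (scal s t 1)"
    by (simp_all add: scal_def complex_eq_iff)
  show ?thesis unfolding prod_lessThan_4 idx_simps m
    using scal_cnj[of s t 1] by (simp add: power2_eq_square mult_ac)
qed

lemma cayley_plane: "cayley_form x (frame (plane s t)) = of_real (4 * (rho s t)\<^sup>2 / D)"
proof -
  have "wedge 2 2 (kahler x) (kahler x) (frame (plane s t)) = 0"
    by (rule wedge_kahler_plane[of _ s t]) (auto simp: frame_def)
  moreover have "theta x (frame (plane s t)) = of_real ((rho s t)\<^sup>2 / D)"
  proof -
    have "coord_form (\<lambda>_. False) (frame (plane s t)) = (\<Prod>k<4. coord (\<lambda>_. False) k (frame (plane s t) k))"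
      by (rule Alt_diagonal) (simp add: coord_def frame_plane_nth)
    also have "\<dots> = (\<Prod>k<4. scal s t (idx k))"
      by (intro prod.cong) (simp_all add: coord_def frame_plane_nth)
    finally show ?thesis unfolding theta_def wedge4_coord_form prod_scal by simp
  qed
  ultimately show ?thesis unfolding cayley_form_def by simp
qed

text \<open>The induced metric is diagonal in the chart coordinates.\<close>

lemma gram_plane:
  "sqrt (det ((\<chi> i j. metric x (plane s t (axis i 1)) (plane s t (axis j 1))) :: real^4^4)) = 4 * (rho s t)\<^sup>2 / D"
proof -
  let ?r = "2 * rho s t / D"
  have "metric x (plane s t (axis i 1)) (plane s t (axis j 1)) = (if i = j then ?r * (eps i * mu x i) else 0)" for i j :: 4
  proof -
    have "(\<Sum>k\<in>UNIV. eps k * mu x k * (axis i 1 $ k * axis j 1 $ k)) = (\<Sum>k\<in>UNIV. if k = i then (if i = j then eps i * mu x i else 0) else 0)"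
      by (intro sum.cong) (auto simp: axis_def)
    then show ?thesis unfolding metric_plane by simp
  qed
  then have "det ((\<chi> i j. metric x (plane s t (axis i 1)) (plane s t (axis j 1))) :: real^4^4) = (\<Prod>i\<in>UNIV. ?r * (eps i * mu x i))"
    by (subst det_diagonal) simp_all
  also have "\<dots> = (\<Prod>i\<in>(UNIV :: 4 set). ?r) * (\<Prod>i\<in>UNIV. eps i * mu x i)" by (rule prod.distrib)
  also have "\<dots> = ?r ^ 4 * D\<^sup>2" unfolding prod_eps_mu by simp
  also have "\<dots> = (4 * (rho s t)\<^sup>2 / D)\<^sup>2"
    using D_pos by (simp add: power_mult_distrib power_divide field_simps power2_eq_square power4_eq_xxxx)
  finally have "det ((\<chi> i j. metric x (plane s t (axis i 1)) (plane s t (axis j 1))) :: real^4^4) = (4 * (rho s t)\<^sup>2 / D)\<^sup>2" .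
  moreover have "4 * (rho s t)\<^sup>2 / D \<ge> 0" using D_pos by simp
  ultimately show ?thesis by (simp only: real_sqrt_abs abs_of_nonneg)
qed

text \<open>Both the Cayley form and the volume form have the coefficient \<open>4 (rho s t)\<^sup>2 / D\<close>.\<close>

lemma cayley_torus:
  assumes st: "s \<in> \<int>" "t \<in> \<int>" "s \<noteq> 0 \<or> t \<noteq> 0"
  shows "cayley_immersion x N (torus_map (plane s t))"
  unfolding cayley_immersion_def
proof (intro conjI ballI)
  note comp = compatible_plane[OF st(1,2)]
  show "compact_oriented_manifold N" by (rule torus_manifold[OF det_V_nz])
  show "smooth_to_torus L N (torus_map (plane s t))" by (rule smooth_torus_map[OF comp])
  fix ch q assume ch: "ch \<in> charts_of N" and q: "q \<in> chart_img ch"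
  obtain r where r: "ch = torus_chart V r" using ch unfolding N_charts ..
  note deriv = torus_deriv_torus_map[OF comp q[unfolded r]]
  have nz: "scal s t j \<noteq> 0" for j using scal_cnj[of s t j] rho_pos[OF st(3)] by auto
  show "inj (torus_deriv L ch (torus_map (plane s t)) q)"
    unfolding r deriv
  proof (rule injI)
    fix a b assume "plane s t a = plane s t b"
    then have "scal s t j * of_real (a $ j) = scal s t j * of_real (b $ j)" for j by (metis plane_nth)
    then show "a = b" using nz by (simp add: vec_eq_iff)
  qed
  show "pullback_coeff L ch (torus_map (plane s t)) (cayley_form x) q = complex_of_real (sqrt (det (\<chi> i j.
      metric x (torus_deriv L ch (torus_map (plane s t)) q (axis i 1)) (torus_deriv L ch (torus_map (plane s t)) q (axis j 1)))))"
    unfolding r deriv gram_plane pullback_coeff_torus_map[OF comp q[unfolded r]] cayley_plane by (rule refl)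
qed

end

section \<open>The cycles representing the two classes\<close>

lemma wedge_linear_left:
  "wedge p q (\<lambda>v. r * a v + s * a' v) b v = r * wedge p q a b v + s * wedge p q a' b v"
  unfolding wedge_def by (simp add: sum.distrib sum_distrib_left algebra_simps add_divide_distrib)

text \<open>The signs of the images of \<open>\<i> D\<close> under the embeddings.\<close>

definition ep :: "nat \<Rightarrow> complex" where "ep k = of_real (eps (idx k))"
definition ep_prod :: "nat set \<Rightarrow> complex" where "ep_prod K = (\<Prod>k\<in>K. ep k)"

lemma ep_square: "ep k * ep k = 1"
  by (simp add: ep_def flip: of_real_mult)

text \<open>The product of all four signs is 1.\<close>

lemma ep_prod_complement:
  assumes "K \<subseteq> {..<4}"
  shows "ep_prod ({..<4} - K) = ep_prod K"
proof -
  have "ep_prod ({..<4} - K) * ep_prod K = ep_prod {..<4}"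
    unfolding ep_prod_def using prod.subset_diff[OF assms, of ep] by simp
  also have "\<dots> = 1" unfolding ep_prod_def prod_lessThan_4 by (simp add: ep_def)
  finally have 1: "ep_prod ({..<4} - K) * ep_prod K = 1" .
  have 2: "ep_prod K * ep_prod K = 1"
    unfolding ep_prod_def by (simp add: ep_square flip: prod.distrib)
  show ?thesis using 1 2 by (metis mult.assoc mult.commute mult_1)
qed

lemma prod_if_subset:
  fixes f g :: "nat \<Rightarrow> 'a::comm_monoid_mult"
  assumes "K \<subseteq> {..<n}"
  shows "(\<Prod>k<n. if k \<in> K then f k else g k) = prod f K * prod g ({..<n} - K)"
proof -
  have "{..<n} \<inter> {k. k \<in> K} = K" "{..<n} \<inter> - {k. k \<in> K} = {..<n} - K" using assms by auto
  then show ?thesis by (simp add: prod.If_cases)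
qed

lemma card_complement_4: "K \<subseteq> {..<4::nat} \<Longrightarrow> card ({..<4} - K) = 4 - card K"
  by (simp add: card_Diff_subset finite_subset)

lemma coord_form_wedge_std_frame:
  assumes b: "alt_form 4 b"
    and B: "\<And>k. k < 4 \<Longrightarrow> coord B k (jf k) = z * ep k" and B1: "\<And>k. k < 4 \<Longrightarrow> coord B k (ef k) = 1"
  shows "wedge 4 4 (coord_form B) b std_frame
    = (\<Sum>K\<in>Pow {..<4}. (- z) ^ (4 - card K) * ep_prod K * b (\<lambda>k. if k \<in> K then jf k else ef k))"
proof -
  have "wedge 4 4 (coord_form B) b std_frame
    = (\<Sum>K\<in>Pow {..<4}. (-1) ^ card K * (\<Prod>k<4. coord B k (if k \<in> K then jf k else ef k))
         * b (\<lambda>k. if k \<in> K then ef k else jf k))"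
    by (rule wedge_std_frame[OF b]) (simp add: coord_axis)
  also have "\<dots> = (\<Sum>K\<in>Pow {..<4}. (- z) ^ card K * ep_prod K * b (\<lambda>k. if k \<in> K then ef k else jf k))"
  proof (rule sum.cong[OF refl])
    fix K :: "nat set" assume K: "K \<in> Pow {..<4}"
    have "(\<Prod>k<4. coord B k (if k \<in> K then jf k else ef k)) = (\<Prod>k<4. if k \<in> K then z * ep k else 1)"
      using B B1 by (intro prod.cong) auto
    also have "\<dots> = z ^ card K * ep_prod K"
      using K by (simp add: prod_if_subset prod.distrib ep_prod_def)
    finally show "(-1) ^ card K * (\<Prod>k<4. coord B k (if k \<in> K then jf k else ef k)) * b (\<lambda>k. if k \<in> K then ef k else jf k)
        = (- z) ^ card K * ep_prod K * b (\<lambda>k. if k \<in> K then ef k else jf k)"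
      by (simp add: power_minus[of z])
  qed
  also have "\<dots> = (\<Sum>K\<in>Pow {..<4}. (- z) ^ (4 - card K) * ep_prod K * b (\<lambda>k. if k \<in> K then jf k else ef k))"
  proof (rule sum.reindex_bij_witness[of _ "\<lambda>K. {..<4} - K" "\<lambda>K. {..<4} - K"])
    fix K :: "nat set" assume K: "K \<in> Pow {..<4}"
    then show "{..<4} - ({..<4} - K) = K" by auto
    show "{..<4} - K \<in> Pow {..<4}" by auto
    have "card K \<le> 4" using K card_mono[of "{..<4::nat}" K] by simp
    then have "4 - card ({..<4} - K) = card K" using K by (simp add: card_complement_4)
    moreover have "b (\<lambda>k. if k \<in> {..<4} - K then jf k else ef k) = b (\<lambda>k. if k \<in> K then ef k else jf k)"
      by (intro alt_form_cong[OF b]) auto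
    ultimately show "(- z) ^ (4 - card ({..<4} - K)) * ep_prod ({..<4} - K) * b (\<lambda>k. if k \<in> {..<4} - K then jf k else ef k)
        = (- z) ^ card K * ep_prod K * b (\<lambda>k. if k \<in> K then ef k else jf k)"
      using K by (simp add: ep_prod_complement)
  next
    fix K :: "nat set" assume K: "K \<in> Pow {..<4}"
    then show "{..<4} - ({..<4} - K) = K" by auto
    show "{..<4} - K \<in> Pow {..<4}" by auto
  qed
  finally show ?thesis .
qed

text \<open>Complementing \<open>K\<close> in \<open>wedge_std_frame\<close> brings the arguments of \<open>b\<close> to the form in which they occur in the
  integrals over the tori; the signs \<open>ep_prod\<close> are invariant under this.\<close>

lemma weil_wedge_std_frame:
  assumes b: "alt_form 4 b"
  shows "wedge 4 4 (\<lambda>v. r * coord_form odd v + s * coord_form even v) b std_frame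
    = (\<Sum>K\<in>Pow {..<4}. (r * (- \<i>) ^ (4 - card K) + s * \<i> ^ (4 - card K)) * ep_prod K * b (\<lambda>k. if k \<in> K then jf k else ef k))"
proof -
  have o: "wedge 4 4 (coord_form odd) b std_frame
    = (\<Sum>K\<in>Pow {..<4}. (- \<i>) ^ (4 - card K) * ep_prod K * b (\<lambda>k. if k \<in> K then jf k else ef k))"
  proof (rule coord_form_wedge_std_frame[OF b])
    fix k :: nat assume k: "k < 4"
    show "coord odd k (jf k) = \<i> * ep k" "coord odd k (ef k) = 1"
      using less_4_cases[OF k] by (auto simp: coord_def jf_nth ef_nth ep_def jf_def ef_def)
  qed
  have e: "wedge 4 4 (coord_form even) b std_frame
    = (\<Sum>K\<in>Pow {..<4}. (- (- \<i>)) ^ (4 - card K) * ep_prod K * b (\<lambda>k. if k \<in> K then jf k else ef k))"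
  proof (rule coord_form_wedge_std_frame[OF b])
    fix k :: nat assume k: "k < 4"
    show "coord even k (jf k) = - \<i> * ep k" "coord even k (ef k) = 1"
      using less_4_cases[OF k] by (auto simp: coord_def jf_nth ef_nth ep_def jf_def ef_def)
  qed
  show ?thesis unfolding wedge_linear_left o e minus_minus
    by (simp add: sum_distrib_left distrib_right sum.distrib mult.assoc)
qed

text \<open>The five points \<open>(1, 0), (0, 1), (1, 1), (1, -1), (1, 2)\<close>.\<close>

definition node_s :: "nat \<Rightarrow> rat" where "node_s k = (if k = 1 then 0 else 1)"
definition node_t :: "nat \<Rightarrow> rat" where
  "node_t k = (if k = 0 then 0 else if k = 3 then - 1 else if k = 4 then 2 else 1)"

text \<open>Prescribing the values of a combination of point evaluations on the five monomials is a linear system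
  of size five, solved explicitly; it is nonsingular because no two of the points are proportional.\<close>

lemma quartic_moments:
  fixes M :: "nat \<Rightarrow> rat"
  shows "\<exists>q. \<forall>n\<le>4. (\<Sum>k<5. q k * node_s k ^ (4 - n) * node_t k ^ n) = M n"
proof -
  define q4 where "q4 = (M 3 - M 1) / 6"
  define q2 where "q2 = ((M 2 - 4 * q4) + (M 1 - 2 * q4)) / 2"
  define q3 where "q3 = ((M 2 - 4 * q4) - (M 1 - 2 * q4)) / 2"
  define q where "q k = (if k = 0 then M 0 - q2 - q3 - q4 else if k = 1 then M 4 - q2 - q3 - 16 * q4
     else if k = 2 then q2 else if k = 3 then q3 else q4)" for k :: nat
  have l: "{..<5::nat} = {0, 1, 2, 3, 4}" by auto
  have "(\<Sum>k<5. q k * node_s k ^ (4 - n) * node_t k ^ n) = M n" if "n \<le> 4" for n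
  proof -
    have "n = 0 \<or> n = 1 \<or> n = 2 \<or> n = 3 \<or> n = 4" using that by linarith
    then show ?thesis
      by (elim disjE) (simp_all add: l node_s_def node_t_def q_def q2_def q3_def q4_def field_simps)
  qed
  then show ?thesis by blast
qed

lemma idx_pw: "idx (pw k) = k"
  using exhaust_4[of k] by auto

lemma pw_less: "pw k < 4"
  by (simp add: pw_def)

lemma odd_pw: "odd (pw k) \<longleftrightarrow> eps k = - 1"
  using exhaust_4[of k] by auto

context integral_quartic
begin

text \<open>The integrand of the torus of \<open>s + t \<i> D\<close> as a binary quartic form in \<open>s\<close> and \<open>t\<close>.\<close>

lemma frame_plane_expand:
  assumes b: "alt_form 4 b"
  shows "b (frame (plane s t)) = (\<Sum>K\<in>Pow {..<4}. of_real (s ^ (4 - card K) * (t * D) ^ card K) * ep_prod K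
     * b (\<lambda>k. if k \<in> K then jf k else ef k))"
proof -
  have "b (frame (plane s t)) = b (\<lambda>k. s *\<^sub>R ef k + (t * D * eps (idx k)) *\<^sub>R jf k)"
    by (rule alt_form_cong[OF b]) (rule frame_plane)
  also have "\<dots> = (\<Sum>K\<in>Pow {..<4}. of_real (\<Prod>k<4. if k \<in> K then t * D * eps (idx k) else s)
     * b (\<lambda>k. if k \<in> K then jf k else ef k))" by (rule alt_form_expand[OF b])
  also have "\<dots> = (\<Sum>K\<in>Pow {..<4}. of_real (s ^ (4 - card K) * (t * D) ^ card K) * ep_prod K
     * b (\<lambda>k. if k \<in> K then jf k else ef k))"
  proof (rule sum.cong[OF refl])
    fix K :: "nat set" assume K: "K \<in> Pow {..<4}"
    have "(\<Prod>k<4. if k \<in> K then t * D * eps (idx k) else s) = (t * D) ^ card K * (\<Prod>k\<in>K. eps (idx k)) * s ^ (4 - card K)"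
      using K by (simp add: prod_if_subset prod.distrib card_complement_4 del: mult.assoc)
    then show "of_real (\<Prod>k<4. if k \<in> K then t * D * eps (idx k) else s) * b (\<lambda>k. if k \<in> K then jf k else ef k)
      = of_real (s ^ (4 - card K) * (t * D) ^ card K) * ep_prod K * b (\<lambda>k. if k \<in> K then jf k else ef k)"
      by (simp add: ep_prod_def ep_def mult_ac)
  qed
  finally show ?thesis .
qed

definition torus_cycle :: "(nat \<Rightarrow> rat) \<Rightarrow> cycle" where
  "torus_cycle q = map (\<lambda>k. (q k, N, torus_map (plane (of_rat (node_s k)) (of_rat (node_t k))))) [0..<5]"

lemma node_int: "real_of_rat (node_s k) \<in> \<int>" "real_of_rat (node_t k) \<in> \<int>"
  "real_of_rat (node_s k) \<noteq> 0 \<or> real_of_rat (node_t k) \<noteq> 0"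
  by (auto simp: node_s_def node_t_def of_rat_minus)

lemma torus_cycle_cayley: "rational_cayley_cycle x (torus_cycle q)"
  unfolding rational_cayley_cycle_def torus_cycle_def using cayley_torus[OF node_int] by auto

text \<open>The assumption compares, for each size \<open>n\<close> of \<open>K\<close>, the coefficient in the integral over the complex torus with the one in
  the integral over the cycle.\<close>

lemma torus_cycle_represents:
  assumes A: "fundamental_domain L A"
    and eq: "\<And>n. n \<le> 4 \<Longrightarrow> of_real (measure lborel A) * (r * (- \<i>) ^ (4 - n) + s * \<i> ^ (4 - n))
       = of_real (det V * D ^ n) * of_rat (\<Sum>k<5. q k * node_s k ^ (4 - n) * node_t k ^ n)"
  shows "represents L (torus_cycle q) (\<lambda>v. r * coord_form odd v + s * coord_form even v)"
  unfolding represents_def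
proof (intro allI impI)
  fix b :: form assume b: "alt_form 4 b"
  define \<Phi> where "\<Phi> k = plane (of_rat (node_s k)) (of_rat (node_t k))" for k
  define I where "I k = of_real (det V) * b (frame (\<Phi> k))" for k
  define \<beta> where "\<beta> K = ep_prod K * b (\<lambda>k. if k \<in> K then jf k else ef k)" for K
  have len: "length (torus_cycle q) = 5" by (simp add: torus_cycle_def)
  have nth: "torus_cycle q ! k = (q k, N, torus_map (\<Phi> k))" if "k < 5" for k
    using that by (simp add: torus_cycle_def \<Phi>_def)
  have int: "has_form_integral L N (torus_map (\<Phi> k)) b (I k)" for k
    unfolding I_def \<Phi>_def by (intro has_form_integral_torus_map compatible_plane node_int)
  have "(\<Sum>k<5. of_rat (q k) * I k)
    = (\<Sum>k<5. \<Sum>K\<in>Pow {..<4}. of_real (det V * D ^ card K) * of_rat (q k * node_s k ^ (4 - card K) * node_t k ^ card K) * \<beta> K)"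
    unfolding I_def \<Phi>_def frame_plane_expand[OF b] sum_distrib_left
    by (intro sum.cong refl) (simp add: \<beta>_def power_mult_distrib of_rat_mult of_rat_power of_rat_eq_of_real[where 'a = complex] mult_ac)
  also have "\<dots> = (\<Sum>K\<in>Pow {..<4}. of_real (det V * D ^ card K) * of_rat (\<Sum>k<5. q k * node_s k ^ (4 - card K) * node_t k ^ card K) * \<beta> K)"
    by (subst sum.swap) (simp add: of_rat_sum sum_distrib_left sum_distrib_right)
  also have "\<dots> = (\<Sum>K\<in>Pow {..<4}. of_real (measure lborel A) * (r * (- \<i>) ^ (4 - card K) + s * \<i> ^ (4 - card K)) * \<beta> K)"
  proof (rule sum.cong[OF refl])
    fix K :: "nat set" assume "K \<in> Pow {..<4}"
    then have "card K \<le> 4" using card_mono[of "{..<4::nat}" K] by simp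
    from eq[OF this] show "of_real (det V * D ^ card K) * of_rat (\<Sum>k<5. q k * node_s k ^ (4 - card K) * node_t k ^ card K) * \<beta> K
      = of_real (measure lborel A) * (r * (- \<i>) ^ (4 - card K) + s * \<i> ^ (4 - card K)) * \<beta> K" by simp
  qed
  also have "\<dots> = of_real (measure lborel A) * wedge 4 4 (\<lambda>v. r * coord_form odd v + s * coord_form even v) b std_frame"
    unfolding weil_wedge_std_frame[OF b] sum_distrib_left \<beta>_def by (simp add: mult.assoc)
  finally have "has_torus_integral L (wedge 4 4 (\<lambda>v. r * coord_form odd v + s * coord_form even v) b)
      (\<Sum>k<5. of_rat (q k) * I k)"
    unfolding has_torus_integral_def using A by blast
  moreover have "(\<Sum>k<5. of_rat (q k) * I k) = (\<Sum>k<length (torus_cycle q). of_rat (fst (torus_cycle q ! k)) * I k)"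
    unfolding len by (intro sum.cong refl) (simp add: nth)
  moreover have "\<forall>k<length (torus_cycle q). case torus_cycle q ! k of (q', N', f) \<Rightarrow> has_form_integral L N' f b (I k)"
  proof (intro allI impI)
    fix k assume "k < length (torus_cycle q)"
    then have "torus_cycle q ! k = (q k, N, torus_map (\<Phi> k))" using nth len by simp
    then show "case torus_cycle q ! k of (q', N', f) \<Rightarrow> has_form_integral L N' f b (I k)"
      by (simp only: prod.case int)
  qed
  ultimately show "\<exists>I. (\<forall>k<length (torus_cycle q). case torus_cycle q ! k of (q', N', f) \<Rightarrow> has_form_integral L N' f b (I k))
        \<and> has_torus_integral L (wedge 4 4 (\<lambda>v. r * coord_form odd v + s * coord_form even v) b)
             (\<Sum>k<length (torus_cycle q). of_rat (fst (torus_cycle q ! k)) * I k)"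
    by (intro exI[of _ I] conjI) simp_all
qed

text \<open>By \<open>quartic_moments\<close> it is enough that the required moments are rational.\<close>

lemma cayley_representative:
  assumes mom: "\<And>A n. fundamental_domain L A \<Longrightarrow> n \<le> 4 \<Longrightarrow> measure lborel A \<in> \<rat> \<Longrightarrow>
    \<exists>z. of_real (measure lborel A) * (r * (- \<i>) ^ (4 - n) + s * \<i> ^ (4 - n)) = of_real (det V * D ^ n) * of_rat z"
  shows "\<exists>C. rational_cayley_cycle x C \<and> represents L C (\<lambda>v. r * coord_form odd v + s * coord_form even v)"
proof -
  obtain A where A: "fundamental_domain L A" "measure lborel A \<in> \<rat>"
    using fundamental_domain_rational_volume by blast
  have "\<forall>n. \<exists>z. n \<le> 4 \<longrightarrow> of_real (measure lborel A) * (r * (- \<i>) ^ (4 - n) + s * \<i> ^ (4 - n)) = of_real (det V * D ^ n) * of_rat z"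
    using mom[OF A(1) _ A(2)] by blast
  then obtain M where M: "\<And>n. n \<le> 4 \<Longrightarrow> of_real (measure lborel A) * (r * (- \<i>) ^ (4 - n) + s * \<i> ^ (4 - n)) = of_real (det V * D ^ n) * of_rat (M n)"
    by metis
  obtain q where q: "\<And>n. n \<le> 4 \<Longrightarrow> (\<Sum>k<5. q k * node_s k ^ (4 - n) * node_t k ^ n) = M n"
    using quartic_moments[of M] by blast
  have "represents L (torus_cycle q) (\<lambda>v. r * coord_form odd v + s * coord_form even v)"
    by (rule torus_cycle_represents[OF A(1)]) (simp only: M q)
  then show ?thesis using torus_cycle_cayley by blast
qed

lemma rational_moment:
  assumes "z \<in> \<rat>" "Z = complex_of_real (det V * D ^ n * z)"
  shows "\<exists>z. Z = of_real (det V * D ^ n) * of_rat z"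
proof -
  obtain z' where "z = of_rat z'" using assms(1) by (auto elim: Rats_cases)
  then have "complex_of_real z = of_rat z'" using of_rat_eq_of_real[where 'a = complex, of z'] by simp
  then show ?thesis by (intro exI[of _ z']) (simp only: assms(2) of_real_mult)
qed

lemma cases_le_4: "n \<le> (4::nat) \<Longrightarrow> n = 0 \<or> n = 1 \<or> n = 2 \<or> n = 3 \<or> n = 4"
  by linarith

lemma class_M_coord: "class_M x = (\<lambda>v. of_real D * coord_form odd v + of_real D * coord_form even v)"
  unfolding class_M_def wedge4_coord_form by (simp add: distrib_left)

lemma class_M'_coord: "class_M' = (\<lambda>v. \<i> * coord_form odd v + (- \<i>) * coord_form even v)"
  unfolding class_M'_def wedge4_coord_form by (simp add: right_diff_distrib)

lemma class_M_cycle: "\<exists>C. rational_cayley_cycle x C \<and> represents L C (class_M x)"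
  unfolding class_M_coord
proof (rule cayley_representative)
  fix A n assume n: "n \<le> (4::nat)" and A: "measure lborel A \<in> \<rat>"
  \<comment> \<open>\<open>a\<close> is the moment that balances \<open>2 \<cdot> measure lborel A\<close>, as \<open>det V = m\<^sup>6 D\<close>; each further factor \<open>D\<^sup>2\<close> is cancelled below.\<close>
  define a where "a = 2 * measure lborel A / of_nat m ^ 6"
  have a: "a \<in> \<rat>" unfolding a_def using A by simp
  have nz: "D \<noteq> 0" "m > 0" using D_pos m_pos by auto
  have r2: "- a / D\<^sup>2 \<in> \<rat>" and r4: "a / (D\<^sup>2 * D\<^sup>2) \<in> \<rat>"
    using a D_square_rat Rats_divide[OF a Rats_mult[OF D_square_rat D_square_rat]] by simp_all
  have "\<exists>z. z \<in> \<rat> \<and> of_real (measure lborel A) * (of_real D * (- \<i>) ^ (4 - n) + of_real D * \<i> ^ (4 - n)) = complex_of_real (det V * D ^ n * z)"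
    using cases_le_4[OF n]
  proof (elim disjE)
    assume "n = 0"
    then show ?thesis using a nz by (intro exI[of _ a]) (simp add: a_def det_V)
  next
    assume "n = 1"
    then show ?thesis by (intro exI[of _ 0]) (simp add: power3_eq_cube)
  next
    assume "n = 2"
    then show ?thesis using nz
      by (intro exI[of _ "- a / D\<^sup>2"] conjI r2) (simp add: a_def det_V field_simps)
  next
    assume "n = 3"
    then show ?thesis by (intro exI[of _ 0]) simp
  next
    assume "n = 4"
    then show ?thesis using nz
      by (intro exI[of _ "a / (D\<^sup>2 * D\<^sup>2)"] conjI r4) (simp add: a_def det_V field_simps power2_eq_square power4_eq_xxxx)
  qed
  then show "\<exists>z. of_real (measure lborel A) * (of_real D * (- \<i>) ^ (4 - n) + of_real D * \<i> ^ (4 - n)) = of_real (det V * D ^ n) * of_rat z"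
    using rational_moment by blast
qed

lemma class_M'_cycle: "\<exists>C. rational_cayley_cycle x C \<and> represents L C class_M'"
  unfolding class_M'_coord
proof (rule cayley_representative)
  fix A n assume n: "n \<le> (4::nat)" and A: "measure lborel A \<in> \<rat>"
  \<comment> \<open>\<open>a\<close> is the moment that balances \<open>2 \<cdot> measure lborel A\<close>, as \<open>det V = m\<^sup>6 D\<close>; each further factor \<open>D\<^sup>2\<close> is cancelled below.\<close>
  define a where "a = 2 * measure lborel A / of_nat m ^ 6"
  have a: "a \<in> \<rat>" unfolding a_def using A by simp
  have nz: "D \<noteq> 0" "m > 0" using D_pos m_pos by auto
  have r2: "- a / D\<^sup>2 \<in> \<rat>" and r4: "a / (D\<^sup>2 * D\<^sup>2) \<in> \<rat>"
    using a D_square_rat Rats_divide[OF a Rats_mult[OF D_square_rat D_square_rat]] by simp_all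
  have "\<exists>z. z \<in> \<rat> \<and> of_real (measure lborel A) * (\<i> * (- \<i>) ^ (4 - n) + - \<i> * \<i> ^ (4 - n)) = complex_of_real (det V * D ^ n * z)"
    using cases_le_4[OF n]
  proof (elim disjE)
    assume "n = 1"
    then show ?thesis using nz
      by (intro exI[of _ "- a / D\<^sup>2"] conjI r2) (simp add: a_def det_V field_simps power3_eq_cube power2_eq_square)
  next
    assume "n = 3"
    then show ?thesis using nz
      by (intro exI[of _ "a / (D\<^sup>2 * D\<^sup>2)"] conjI r4) (simp add: a_def det_V field_simps power2_eq_square power3_eq_cube)
  qed (intro exI[of _ 0]; simp)+
  then show "\<exists>z. of_real (measure lborel A) * (\<i> * (- \<i>) ^ (4 - n) + - \<i> * \<i> ^ (4 - n)) = of_real (det V * D ^ n) * of_rat z"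
    using rational_moment by blast
qed

definition quad_field :: "complex set" where
  "quad_field = {of_real p + \<i> * of_real D * of_real q |p q. p \<in> \<rat> \<and> q \<in> \<rat>}"

lemma quad_fieldI: "p \<in> \<rat> \<Longrightarrow> q \<in> \<rat> \<Longrightarrow> z = of_real p + \<i> * of_real D * of_real q \<Longrightarrow> z \<in> quad_field"
  unfolding quad_field_def by blast

lemma quad_field_add: "a \<in> quad_field \<Longrightarrow> b \<in> quad_field \<Longrightarrow> a + b \<in> quad_field"
proof -
  assume "a \<in> quad_field" "b \<in> quad_field"
  then obtain p q p' q' where "p \<in> \<rat>" "q \<in> \<rat>" "p' \<in> \<rat>" "q' \<in> \<rat>"
    "a = of_real p + \<i> * of_real D * of_real q" "b = of_real p' + \<i> * of_real D * of_real q'"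
    unfolding quad_field_def by blast
  then show ?thesis by (intro quad_fieldI[of "p + p'" "q + q'"]) (simp_all add: algebra_simps)
qed

lemma quad_field_mult: "a \<in> quad_field \<Longrightarrow> b \<in> quad_field \<Longrightarrow> a * b \<in> quad_field"
proof -
  assume "a \<in> quad_field" "b \<in> quad_field"
  then obtain p q p' q' where "p \<in> \<rat>" "q \<in> \<rat>" "p' \<in> \<rat>" "q' \<in> \<rat>"
    "a = of_real p + \<i> * of_real D * of_real q" "b = of_real p' + \<i> * of_real D * of_real q'"
    unfolding quad_field_def by blast
  then show ?thesis using D_square_rat
    by (intro quad_fieldI[of "p * p' - D\<^sup>2 * (q * q')" "p * q' + q * p'"])
      (simp_all add: complex_eq_iff algebra_simps power2_eq_square)
qed

lemma quad_field_of_int: "of_int k \<in> quad_field"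
  by (rule quad_fieldI[of "of_int k" 0]) simp_all

lemma quad_field_sum: "(\<And>i. i \<in> I \<Longrightarrow> f i \<in> quad_field) \<Longrightarrow> sum f I \<in> quad_field"
  using quad_field_of_int[of 0]
  by (induction I rule: infinite_finite_induct) (auto intro: quad_field_add)

lemma quad_field_prod: "(\<And>i. i \<in> I \<Longrightarrow> f i \<in> quad_field) \<Longrightarrow> prod f I \<in> quad_field"
  using quad_field_of_int[of 1]
  by (induction I rule: infinite_finite_induct) (auto intro: quad_field_mult)

text \<open>With conjugations at the even indices \<open>2\<close> and \<open>4\<close>, all four embeddings fix \<open>\<i> D\<close>, so the matrix of the values factors
  into the Vandermonde matrix and a matrix with entries in \<open>\<rat>(\<i> D)\<close>.\<close>

lemma coord_form_lattice:
  assumes v: "\<And>i. i < 4 \<Longrightarrow> v i \<in> L"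
  shows "\<exists>p\<in>\<rat>. \<exists>q\<in>\<rat>. coord_form odd v = of_real (det V) * (of_real p + \<i> * of_real D * of_real q)
    \<and> coord_form even v = of_real (det V) * (of_real p - \<i> * of_real D * of_real q)"
proof -
  have "\<exists>a b. v i = Psi a b \<and> a \<in> ratvec \<and> b \<in> ratvec" if "i < 4" for i
    using v[OF that] unfolding period_lattice_eq by blast
  then obtain a b where ab: "\<And>i. i < 4 \<Longrightarrow> v i = Psi (a i) (b i)" "\<And>i. i < 4 \<Longrightarrow> a i \<in> ratvec" "\<And>i. i < 4 \<Longrightarrow> b i \<in> ratvec"
    by metis
  define M where "M = ((\<chi> k i. coord odd (pw k) (v (pw i))) :: complex^4^4)"
  define Vc where "Vc = (\<chi> k l. complex_of_real (V $ k $ l))"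
  define Cf :: "complex^4^4" where "Cf = (\<chi> l i. of_real (a (pw i) $ l) + \<i> * of_real D * of_real (b (pw i) $ l))"
  have "coord odd (pw k) (Psi a b) = of_real ((V *v a) $ k) + \<i> * of_real D * of_real ((V *v b) $ k)" for k a b
  proof (cases "eps k = - 1")
    case True
    then show ?thesis by (simp add: coord_def odd_pw idx_pw Psi_nth complex_eq_iff)
  next
    case False
    then have "eps k = 1" using eps_cases[of k] by auto
    then show ?thesis by (simp add: coord_def odd_pw idx_pw Psi_nth complex_eq_iff)
  qed
  then have "M = Vc ** Cf"
    unfolding M_def Vc_def Cf_def matrix_matrix_mult_def vec_eq_iff
    by (simp add: ab(1) pw_less matrix_vector_mult_def sum.distrib sum_distrib_left algebra_simps)
  moreover have "det Vc = of_real (det V)" unfolding Vc_def det_4 by simp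
  ultimately have det_M: "det M = of_real (det V) * det Cf" by (simp add: det_mul)
  have "Cf $ l $ i \<in> quad_field" for l i
    unfolding Cf_def using ab(2)[OF pw_less[of i]] ab(3)[OF pw_less[of i]]
    by (intro quad_fieldI[of "a (pw i) $ l" "b (pw i) $ l"]) (simp_all add: ratvec_def)
  then have "det Cf \<in> quad_field"
    unfolding det_def by (intro quad_field_sum quad_field_mult quad_field_of_int quad_field_prod)
  then obtain p q where pq: "p \<in> \<rat>" "q \<in> \<rat>" "det Cf = of_real p + \<i> * of_real D * of_real q"
    unfolding quad_field_def by blast
  have odd: "coord_form odd v = of_real (det V) * (of_real p + \<i> * of_real D * of_real q)"
    unfolding Alt_4_det M_def[symmetric] det_M pq(3) ..
  have "coord_form even v = det (\<chi> k i. cnj (M $ k $ i))"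
    unfolding Alt_4_det M_def by (rule arg_cong[of _ _ det]) (simp add: vec_eq_iff coord_def)
  also have "\<dots> = cnj (det M)" unfolding det_4 by simp
  also have "\<dots> = of_real (det V) * (of_real p - \<i> * of_real D * of_real q)"
    unfolding det_M pq(3) by simp
  finally show ?thesis using odd pq(1,2) by blast
qed

lemma hodge_class_weil:
  assumes "\<And>p q. p \<in> \<rat> \<Longrightarrow> q \<in> \<rat> \<Longrightarrow> of_real (det V) * (r * (of_real p + \<i> * of_real D * of_real q)
    + s * (of_real p - \<i> * of_real D * of_real q)) \<in> \<rat>"
  shows "hodge_class L (\<lambda>v. r * coord_form odd v + s * coord_form even v)"
  unfolding hodge_class_def rational_class_def
proof (intro conjI allI impI type_2_2_weil)
  show "alt_form 4 (\<lambda>v. r * coord_form odd v + s * coord_form even v)"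
    by (intro alt_form_add alt_form_cmult alt_form_coord)
  fix v :: "nat \<Rightarrow> complex^4" assume "\<forall>i<4. v i \<in> L"
  then obtain p q where pq: "p \<in> \<rat>" "q \<in> \<rat>" "coord_form odd v = of_real (det V) * (of_real p + \<i> * of_real D * of_real q)"
    "coord_form even v = of_real (det V) * (of_real p - \<i> * of_real D * of_real q)"
    using coord_form_lattice by blast
  have "r * coord_form odd v + s * coord_form even v
      = of_real (det V) * (r * (of_real p + \<i> * of_real D * of_real q) + s * (of_real p - \<i> * of_real D * of_real q))"
    unfolding pq(3,4) by (simp add: algebra_simps)
  then show "r * coord_form odd v + s * coord_form even v \<in> \<rat>"
    using assms[OF pq(1,2)] by simp
qed

lemma of_real_Rats: "u \<in> \<rat> \<Longrightarrow> complex_of_real u \<in> \<rat>"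
  by (auto elim!: Rats_cases simp flip: of_rat_eq_of_real)

lemma class_M_hodge: "hodge_class L (class_M x)"
  unfolding class_M_coord
proof (rule hodge_class_weil)
  fix p q :: real assume "p \<in> \<rat>"
  then have "2 * of_nat m ^ 6 * D\<^sup>2 * p \<in> \<rat>" using D_square_rat by simp
  then have "complex_of_real (2 * of_nat m ^ 6 * D\<^sup>2 * p) \<in> \<rat>" by (rule of_real_Rats)
  then show "of_real (det V) * (of_real D * (of_real p + \<i> * of_real D * of_real q)
      + of_real D * (of_real p - \<i> * of_real D * of_real q)) \<in> \<rat>"
    unfolding det_V by (simp add: algebra_simps power2_eq_square)
qed

lemma class_M'_hodge: "hodge_class L class_M'"
  unfolding class_M'_coord
proof (rule hodge_class_weil)
  fix p q :: real assume "q \<in> \<rat>"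
  then have "- 2 * of_nat m ^ 6 * D\<^sup>2 * q \<in> \<rat>" using D_square_rat by simp
  then have "complex_of_real (- 2 * of_nat m ^ 6 * D\<^sup>2 * q) \<in> \<rat>" by (rule of_real_Rats)
  also have "complex_of_real (- 2 * of_nat m ^ 6 * D\<^sup>2 * q) = of_real (det V) * (\<i> * (of_real p + \<i> * of_real D * of_real q)
      + - \<i> * (of_real p - \<i> * of_real D * of_real q))"
    unfolding det_V by (simp add: complex_eq_iff algebra_simps power2_eq_square)
  finally show "of_real (det V) * (\<i> * (of_real p + \<i> * of_real D * of_real q)
      + - \<i> * (of_real p - \<i> * of_real D * of_real q)) \<in> \<rat>" .
qed

end

theorem theorem5p3:
  fixes p0 p1 p2 p4 :: rat and x :: "4 \<Rightarrow> real"
  assumes "Factorial_Ring.irreducible [:p0, p1, p2, 0, p4:]"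
    and "\<And>j. poly (map_poly of_rat [:p0, p1, p2, 0, p4:]) (x j) = 0"
    and "x 1 > x 2" and "x 2 > x 3" and "x 3 > x 4"
    and "galois_group (rat_adjoin (range x)) \<cong> sym_group 4"
    and "discrim x \<in> \<int>"
  shows "hodge_class (period_lattice x) (class_M x)
       \<and> (\<exists>C. rational_cayley_cycle x C \<and> represents (period_lattice x) C (class_M x))
       \<and> hodge_class (period_lattice x) class_M'
       \<and> (\<exists>C. rational_cayley_cycle x C \<and> represents (period_lattice x) C class_M')"
proof -
  \<comment> \<open>Otherwise the degree is at most 2, in contradiction to the three distinct roots \<open>x 1\<close>, \<open>x 2\<close> and \<open>x 3\<close>.\<close>
  have "p4 \<noteq> 0"
  proof
    assume "p4 = 0"
    then have deg: "degree [:p0, p1, p2, 0, p4:] \<le> 2" by simp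
    let ?R = "map_poly of_rat [:p0, p1, p2, 0, p4:] :: real poly"
    have R: "?R \<noteq> 0" "degree ?R \<le> 2"
      using assms(1) deg by (auto simp: map_poly_eq_0_iff degree_map_poly)
    have "card {x 1, x 2, x 3} \<le> card {u. poly ?R u = 0}"
      using assms(2) poly_roots_finite[OF R(1)] by (intro card_mono) auto
    also have "\<dots> \<le> 2" using card_poly_roots_bound[OF R(1)] R(2) by linarith
    finally show False using assms(3,4) by simp
  qed
  then interpret quartic_field "[:p0, p1, p2, 0, p4:]" x
    using assms by unfold_locales (simp_all add: qpoly_def)
  obtain m where "m > 0" "\<forall>j. algebraic_int (of_nat m * x j)" using integral_multiple by blast
  then interpret integral_quartic "[:p0, p1, p2, 0, p4:]" x m
    by unfold_locales auto
  show ?thesis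
    by (intro conjI class_M_hodge class_M_cycle class_M'_hodge class_M'_cycle)
qed

end
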